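(* Suppose that $C_\infty^{(q)}\neq 0$ for some $q$ satisfying $\mathcal{O}<q\le P$ (i.e. $A\tilde\theta(q)$ and $\tilde\theta_q(q)$ are asymptotically correlated), and let $q^*$ denote the largest $q$ with this property. Then the following holds for each $\theta\in M_{q^*-1}$, each $0<\sigma<\infty$, and each $t\in\mathbf{R}^k$. There exist $\delta_0>0$ and $0<\rho_0<\infty$ such that any estimator $\hat G_n(t|\hat p)$ of $G_{n,\theta,\sigma}(t|\hat p)$ satisfying $$P_{n,\theta,\sigma}\big(|\hat G_n(t|\hat p)-G_{n,\theta,\sigma}(t|\hat p)|>\delta\big)\xrightarrow{n\to\infty}0\quad\text{for each }\delta>0$$ also satisfies $$\liminf_{n\to\infty}\ \sup_{\substack{\vartheta\in M_{q^*}\\ \|\vartheta-\theta\|<\rho_0/\sqrt n}}P_{n,\vartheta,\sigma}\big(|\hat G_n(t|\hat p)-G_{n,\vartheta,\sigma}(t|\hat p)|>\delta_0\big)\ \ge\ 2(1-\Phi(c_{q^*}))\prod_{q=q^*+1}^{P}(2\Phi(c_q)-1)\ >\ 0 .$$ The constants $\delta_0$ and $\rho_0$ may be chosen in such a way that they depend only on $t,Q,A,\sigma$ and the critical value $c_{q^*}$. Moreover, $$\liminf_{n\to\infty}\ \inf_{\hat G_n(t|\hat p)}\ \sup_{\substack{\vartheta\in M_{q^*}\\ \|\vartheta-\theta\|<\rho_0/\sqrt n}}P_{n,\vartheta,\sigma}\big(|\hat G_n(t|\hat p)-G_{n,\vartheta,\sigma}(t|\hat p)|>\delta_0\big)>0$$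 and $$\sup_{\delta>0}\ \liminf_{n\to\infty}\ \inf_{\hat G_n(t|\hat p)}\ \sup_{\substack{\vartheta\in M_{q^*}\\ \|\vartheta-\theta\|<\rho_0/\sqrt n}}P_{n,\vartheta,\sigma}\big(|\hat G_n(t|\hat p)-G_{n,\vartheta,\sigma}(t|\hat p)|>\delta\big)\ \ge\ (1-\Phi(c_{q^*}))\prod_{q=q^*+1}^{P}(2\Phi(c_q)-1)>0$$ hold, where the infima extend over all estimators $\hat G_n(t|\hat p)$ of $G_{n,\theta,\sigma}(t|\hat p)$ at sample size $n$. Furthermore, $2(1-\Phi(c_{q^*}))\prod_{q=q^*+1}^{P}(2\Phi(c_q)-1)=\lim_{n\to\infty}P_{n,\theta,\sigma}(\hat p=q^* )$.
   Context: Model. For each $n>P\ge1$ let $Y=X\theta+u$, where $X$ is a nonstochastic $n\times P$ matrix of rank $P$ (its elements may depend on $n$), $u\sim N(0,\sigma^2I_n)$, $\theta\in\mathbf{R}^P$, $0<\sigma<\infty$. Assume that $Q=\lim_{n\to\infty}X'X/n$ exists and is nonsingular. $P_{n,\theta,\sigma}$ denotes the probability measure corresponding to a sample of size $n$ from this model. $\|\cdot\|$ is the Euclidean norm, inequalities between vectors are componentwise, $\Phi$ is the standard normal c.d.f., empty products equal 1. Notation. For a matrix $D$ with $P$ columns, $D[p]$ is the matrix of its first $p$ columns. $Q[p:p]$ is the leading $p\times p$ submatrix of $Q$, and $e_p$ is the $p$th standard basis vector in $\mathbf{R}^p$. Models and estimators. For $0\le p\le P$, $M_p=\{\theta\in\mathbf{R}^P:\theta_{p+1}=\dots=\theta_P=0\}$.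 The integer $\mathcal{O}$, $0\le\mathcal{O}<P$, is fixed by the user. $\tilde\theta(p)$ is the restricted least-squares estimator of $\theta$ under $\theta_{p+1}=\dots=\theta_P=0$: its first $p$ coordinates are $(X[p]'X[p])^{-1}X[p]'Y$, the others are $0$ ($\tilde\theta(0)=0$). Model selection. Let $\hat\sigma^2=(n-P)^{-1}\|Y-X\tilde\theta(P)\|^2$, $\xi_{n,p}=\big([(X[p]'X[p]/n)^{-1}]_{p,p}\big)^{1/2}$ and $T_p=\sqrt n\,\tilde\theta_p(p)/(\hat\sigma\xi_{n,p})$ for $0<p\le P$; $T_0=0$. The critical values $c_p$ do not depend on $n$, $c_{\mathcal{O}}=0$ and $0<c_p<\infty$ for $\mathcal{O}<p\le P$. The selected model order is $\hat p=\max\{p:|T_p|\ge c_p,\ \mathcal{O}\le p\le P\}$. The post-model-selection estimator is $\tilde\theta=\sum_{p=\mathcal{O}}^{P}\tilde\theta(p)\mathbf 1(\hat p=p)$. Target. $A$ is a fixed nonstochastic $k\times P$ matrix of rank $k$, $1\le k\le P$. For $\mathcal{O}\le p\le P$ and $t\in\mathbf{R}^k$, $G_{n,\theta,\sigma}(t|p)=P_{n,\theta,\sigma}(\sqrt n A(\tilde\theta-\theta)\le t\,|\,\hat p=p)$ (the conditioning event always has positive probability), and $G_{n,\theta,\sigma}(t|\hat p)=\sum_{p=\mathcal{O}}^{P}G_{n,\theta,\sigma}(t|p)\mathbf 1(\hat p=p)$. An estimator of this quantity (at fixed $t$) at sample size $n$ is any real-valued random variable that is a (measurable) function of $(Y,X)$;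 it need not lie in $[0,1]$. Outside the infima, $\hat G_n(t|\hat p)$ stands for a sequence of such estimators. $C_\infty^{(q)}=A[q]\,Q[q:q]^{-1}e_q\in\mathbf{R}^k$ for $1\le q\le P$. *)

theory Defs
  imports
    "HOL-Probability.Probability"
    "Jordan_Normal_Form.DL_Rank"
    "Jordan_Normal_Form.Gauss_Jordan_Elimination"
begin

unbundle no vec_syntax

text \<open>
  Vectors and matrices are those of Jordan_Normal_Form. A design matrix X carries the dimensions of
  the regression: the sample size is dim_row X and the number of regressors is dim_col X.
  Regressors are numbered from 1 in the mathematics and from 0 in vectors and matrices, so the p-th
  coordinate has index p - 1.
\<close>

definition euclid_norm :: "real Matrix.vec \<Rightarrow> real" where
  "euclid_norm v = L2_set (\<lambda>i. v $ i) {..<dim_vec v}"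

text \<open>Only meaningful for invertible matrices: mat_inverse returns None otherwise.\<close>

definition inv_mat :: "real mat \<Rightarrow> real mat" where
  "inv_mat B = the (mat_inverse B)"

definition first_cols :: "real mat \<Rightarrow> nat \<Rightarrow> real mat" where
  "first_cols D p = Matrix.mat (dim_row D) p (\<lambda>(i, j). D $$ (i, j))"

definition leading_submat :: "real mat \<Rightarrow> nat \<Rightarrow> real mat" where
  "leading_submat D p = Matrix.mat p p (\<lambda>(i, j). D $$ (i, j))"

definition gram :: "real mat \<Rightarrow> real mat" where
  "gram X = transpose_mat X * X"

definition submodel :: "nat \<Rightarrow> nat \<Rightarrow> real Matrix.vec set" where
  "submodel P p = {\<theta> \<in> carrier_vec P. \<forall>i. p \<le> i \<and> i < P \<longrightarrow> \<theta> $ i = 0}"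

text \<open>The Borel sets of n-dimensional space, carried over from the product space.\<close>

definition sample_space :: "nat \<Rightarrow> real Matrix.vec measure" where
  "sample_space n =
     vimage_algebra (carrier_vec n) (\<lambda>v. \<lambda>i\<in>{..<n}. v $ i) (\<Pi>\<^sub>M i\<in>{..<n}. (borel :: real measure))"

definition noise_law :: "nat \<Rightarrow> real \<Rightarrow> (nat \<Rightarrow> real) measure" where
  "noise_law n \<sigma> = (\<Pi>\<^sub>M i\<in>{..<n}. density lborel (normal_density 0 \<sigma>))"

text \<open>The law of \<open>Y = X \<theta> + u\<close>.\<close>

definition sample_law :: "real mat \<Rightarrow> real Matrix.vec \<Rightarrow> real \<Rightarrow> real Matrix.vec measure" where
  "sample_law X \<theta> \<sigma> =
     distr (noise_law (dim_row X) \<sigma>) (sample_space (dim_row X))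
       (\<lambda>u. X *\<^sub>v \<theta> + Matrix.vec (dim_row X) u)"

definition restricted_ls :: "real mat \<Rightarrow> nat \<Rightarrow> real Matrix.vec \<Rightarrow> real Matrix.vec" where
  "restricted_ls X p y = Matrix.vec (dim_col X) (\<lambda>i. if i < p
     then (inv_mat (gram (first_cols X p)) *\<^sub>v (transpose_mat (first_cols X p) *\<^sub>v y)) $ i else 0)"

definition sigma_hat :: "real mat \<Rightarrow> real Matrix.vec \<Rightarrow> real" where
  "sigma_hat X y = sqrt ((euclid_norm (y - X *\<^sub>v restricted_ls X (dim_col X) y))\<^sup>2
     / (real (dim_row X) - real (dim_col X)))"

definition xi :: "real mat \<Rightarrow> nat \<Rightarrow> real" where
  "xi X p = sqrt (inv_mat ((1 / real (dim_row X)) \<cdot>\<^sub>m gram (first_cols X p)) $$ (p - 1, p - 1))"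

definition t_stat :: "real mat \<Rightarrow> nat \<Rightarrow> real Matrix.vec \<Rightarrow> real" where
  "t_stat X p y = (if p = 0 then 0
     else sqrt (real (dim_row X)) * restricted_ls X p y $ (p - 1) / (sigma_hat X y * xi X p))"

text \<open>
  In the following, \<open>m\<close> is the user-chosen minimal model order and \<open>c p\<close> the p-th critical value.
\<close>

definition sel_order :: "nat \<Rightarrow> (nat \<Rightarrow> real) \<Rightarrow> real mat \<Rightarrow> real Matrix.vec \<Rightarrow> nat" where
  "sel_order m c X y = Max {p. m \<le> p \<and> p \<le> dim_col X \<and> \<bar>t_stat X p y\<bar> \<ge> c p}"

definition pms_estimator :: "nat \<Rightarrow> (nat \<Rightarrow> real) \<Rightarrow> real mat \<Rightarrow> real Matrix.vec \<Rightarrow> real Matrix.vec" where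
  "pms_estimator m c X y = Matrix.vec (dim_col X)
     (\<lambda>i. \<Sum>p = m..dim_col X. restricted_ls X p y $ i * of_bool (sel_order m c X y = p))"

text \<open>Here \<open>\<le>\<close> on vectors is the componentwise order.\<close>

definition cond_cdf ::
  "nat \<Rightarrow> (nat \<Rightarrow> real) \<Rightarrow> real mat \<Rightarrow> real mat \<Rightarrow> real Matrix.vec \<Rightarrow> real \<Rightarrow> real Matrix.vec \<Rightarrow> nat \<Rightarrow> real"
where
  "cond_cdf m c A X \<theta> \<sigma> t p =
     \<P>(y in sample_law X \<theta> \<sigma>.
          sqrt (real (dim_row X)) \<cdot>\<^sub>v (A *\<^sub>v (pms_estimator m c X y - \<theta>)) \<le> t
        \<bar> sel_order m c X y = p)"

definition cond_cdf_sel ::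
  "nat \<Rightarrow> (nat \<Rightarrow> real) \<Rightarrow> real mat \<Rightarrow> real mat \<Rightarrow> real Matrix.vec \<Rightarrow> real \<Rightarrow> real Matrix.vec
     \<Rightarrow> real Matrix.vec \<Rightarrow> real"
where
  "cond_cdf_sel m c A X \<theta> \<sigma> t y =
     (\<Sum>p = m..dim_col X. cond_cdf m c A X \<theta> \<sigma> t p * of_bool (sel_order m c X y = p))"

text \<open>The design is nonstochastic, so an estimator is a function of the observation alone.\<close>

definition estimators :: "nat \<Rightarrow> (real Matrix.vec \<Rightarrow> real) set" where
  "estimators n = borel_measurable (sample_space n)"

definition error_prob ::
  "nat \<Rightarrow> (nat \<Rightarrow> real) \<Rightarrow> real mat \<Rightarrow> real mat \<Rightarrow> real Matrix.vec \<Rightarrow> real \<Rightarrow> real Matrix.vec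
     \<Rightarrow> real \<Rightarrow> (real Matrix.vec \<Rightarrow> real) \<Rightarrow> real"
where
  "error_prob m c A X \<theta> \<sigma> t \<delta> g =
     \<P>(y in sample_law X \<theta> \<sigma>. \<bar>g y - cond_cdf_sel m c A X \<theta> \<sigma> t y\<bar> > \<delta>)"

definition local_sup_error ::
  "nat \<Rightarrow> (nat \<Rightarrow> real) \<Rightarrow> real mat \<Rightarrow> real mat \<Rightarrow> real Matrix.vec \<Rightarrow> real \<Rightarrow> real Matrix.vec
     \<Rightarrow> nat \<Rightarrow> real \<Rightarrow> real \<Rightarrow> (real Matrix.vec \<Rightarrow> real) \<Rightarrow> ereal"
where
  "local_sup_error m c A X \<theta> \<sigma> t q \<rho> \<delta> g =
     (SUP \<eta> \<in> {\<eta> \<in> submodel (dim_col X) q. euclid_norm (\<eta> - \<theta>) < \<rho> / sqrt (real (dim_row X))}.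
        ereal (error_prob m c A X \<eta> \<sigma> t \<delta> g))"

definition C_inf :: "real mat \<Rightarrow> real mat \<Rightarrow> nat \<Rightarrow> real Matrix.vec" where
  "C_inf A Q q = first_cols A q *\<^sub>v (inv_mat (leading_submat Q q) *\<^sub>v unit_vec q (q - 1))"

abbreviation std_normal_cdf :: "real \<Rightarrow> real" where
  "std_normal_cdf \<equiv> cdf std_normal_distribution"

end

theory Submission
  imports Defs "HOL-Real_Asymp.Real_Asymp"
begin

text \<open>
  Write \<open>q\<close> for the last order at which the target estimator is asymptotically correlated with the
  tested coefficient, let \<open>s = q - 1\<close> be its index, and look at the local parameters
  \<open>\<theta> + (\<nu> / \<surd>n) e\<^sub>q\<close>. The argument has three parts.

  \<^emph>\<open>A fixed limit experiment.\<close> Orthogonalising the columns of the design one after the other produces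
  orthonormal directions in sample space. The inner products of the noise with these directions,
  divided by \<open>\<sigma>\<close>, are independent standard normal variables, for every sample size and every design
  (\<open>orthonormal_scores_distr\<close>). The event that order \<open>q\<close> is selected and that the scaled estimation
  error lies below \<open>t\<close> is a condition on these variables and on the estimated noise level
  (\<open>good_event_iff\<close>); its coefficients converge because the moment matrix does, and the estimated
  noise level converges to \<open>\<sigma>\<close>. All probabilities are therefore computed in one
  Gaussian space, and dominated convergence gives their limits (\<open>event_prob_tendsto\<close>). The tests of
  orders above \<open>q\<close> involve coordinates that the other conditions do not contain, so they contribute a
  common factor. In the conditional distribution function that factor cancels, and what remains is
  \<open>H \<nu> = P(W \<le> t | \<bar>Z + \<nu> / (\<sigma> \<xi>)\<bar> \<ge> c\<^sub>q)\<close>, where \<open>Z\<close> is the coordinate of index \<open>s\<close> and \<open>W\<close> is a linear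
  function of the coordinates up to \<open>s\<close>.

  \<^emph>\<open>The limit depends on \<open>\<nu>\<close>.\<close> This is where the correlation enters: some component of \<open>W\<close>
  contains \<open>Z\<close> with a nonzero coefficient. If \<open>H\<close> were constant, comparing \<open>\<nu> = \<infinity>\<close> with finite \<open>\<nu>\<close>
  would show that \<open>W \<le> t\<close> has the same conditional probability on every window
  \<open>\<bar>Z + \<nu> / (\<sigma> \<xi>)\<bar> < c\<^sub>q\<close>. Windows far out on the appropriate side make that component of \<open>W\<close> large, so
  this probability would be zero; but \<open>A\<close> has full row rank and the orders beyond \<open>q\<close> are
  uncorrelated with the target, so \<open>W\<close> is nondegenerate and \<open>W \<le> t\<close> has positive probability (\<open>cond_limit_not_constant\<close>, \<open>limit_cdf_not_constant\<close>).

  \<^emph>\<open>Two-point comparison.\<close> The sample laws at two local parameters are shifts of the same Gaussian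
  law by a vector of bounded length, so their likelihood ratio has the second moment
  \<open>exp(\<bar>\<mu>\<bar>\<^sup>2 / \<sigma>\<^sup>2)\<close>. This bounds both the probability of an event under one law by its probability under
  the other and the difference of the two (\<open>sample_law_bounds\<close>). If \<open>H\<close> differs at the two points, then
  on the event that order \<open>q\<close> is selected no estimator is close to both targets (\<open>two_point_bound\<close>).
  The limiting selection probability is smallest at \<open>\<nu> = 0\<close>, where it equals \<open>2\<pi>\<close>.
  An estimator that is consistent at \<open>\<theta>\<close> remains close to the target for \<open>\<theta>\<close> under the local
  alternatives, so there it fails on the whole selection event. For an arbitrary
  estimator a fixed pair of points gives a positive bound, and a pair with different values of \<open>H\<close> but
  almost equal sample laws gives a bound arbitrarily close to half the selection probability; such pairs
  exist because \<open>H\<close> must change somewhere along any subdivision of a segment between two points where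
  it differs. The constants are read off \<open>H\<close>, which is built from \<open>t\<close>, \<open>Q\<close>, \<open>A\<close>,
  \<open>\<sigma>\<close> and \<open>c\<^sub>q\<close>.
\<close>

section \<open>Orthogonalisation with respect to a positive definite form\<close>

lemma sum_of_bool_eq:
  fixes f :: "nat \<Rightarrow> real"
  assumes "r < P"
  shows "(\<Sum>i<P. of_bool (i = r) * f i) = f r" "(\<Sum>i<P. of_bool (r = i) * f i) = f r"
  using assms by (simp_all add: of_bool_def if_distrib[of "\<lambda>x. x * _"] cong: if_cong)

lemma inv_mat_eqI:
  assumes B: "B \<in> carrier_mat n n" and B': "B' \<in> carrier_mat n n" and "B * B' = 1\<^sub>m n"
  shows "inv_mat B = B'"
proof (cases "mat_inverse B")
  case None
  have "B' * B = 1\<^sub>m n" using mat_mult_left_right_inverse[OF B B'] assms by simp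
  hence "B \<in> Units (ring_mat TYPE(real) n ())"
    using assms unfolding Units_def ring_mat_def by auto
  with mat_inverse(1)[OF B None, of "()"] show ?thesis by simp
next
  case (Some C)
  note C = mat_inverse(2)[OF B Some]
  have "C = C * (B * B')" unfolding assms(3) using C by (intro right_mult_one_mat[symmetric]) blast
  also have "\<dots> = (C * B) * B'" using assms C by (intro assoc_mult_mat[symmetric]) auto
  also have "\<dots> = B'" using C B' by simp
  finally show ?thesis using Some by (simp add: inv_mat_def)
qed

text \<open>
  Cramer's rule exhibits the entries of the inverse as continuous functions of the entries of the
  matrix.
\<close>

lemma inv_mat_eq_adj_mat:
  assumes B: "B \<in> carrier_mat n n" and "Determinant.det B \<noteq> 0"
  shows "inv_mat B = (1 / Determinant.det B) \<cdot>\<^sub>m adj_mat B"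
proof (rule inv_mat_eqI[OF B])
  show "(1 / Determinant.det B) \<cdot>\<^sub>m adj_mat B \<in> carrier_mat n n" using adj_mat(1)[OF B] by simp
  have "B * ((1 / Determinant.det B) \<cdot>\<^sub>m adj_mat B) = (1 / Determinant.det B) \<cdot>\<^sub>m (B * adj_mat B)"
    using B adj_mat(1)[OF B] by (simp add: mult_smult_distrib)
  also have "\<dots> = 1\<^sub>m n" unfolding adj_mat(2)[OF B] using assms(2) by (intro eq_matI) auto
  finally show "B * ((1 / Determinant.det B) \<cdot>\<^sub>m adj_mat B) = 1\<^sub>m n" .
qed

text \<open>
  Vectors are functions on the natural numbers here and below, so that leading blocks of different
  sizes act on the same objects without changes of dimension.
\<close>

definition pos_def :: "nat \<Rightarrow> real mat \<Rightarrow> bool" where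
  "pos_def P S \<longleftrightarrow> S \<in> carrier_mat P P \<and> (\<forall>i<P. \<forall>j<P. S $$ (i, j) = S $$ (j, i)) \<and>
     (\<forall>x. (\<exists>j<P. x j \<noteq> 0) \<longrightarrow> 0 < (\<Sum>i<P. \<Sum>j<P. x i * S $$ (i, j) * x j))"

lemma leading_submat_carrier [simp]: "leading_submat S p \<in> carrier_mat p p"
  by (simp add: leading_submat_def)

lemma leading_submat_index [simp]: "i < p \<Longrightarrow> j < p \<Longrightarrow> leading_submat S p $$ (i, j) = S $$ (i, j)"
  by (simp add: leading_submat_def)

lemma sum_lessThan_restrict:
  fixes f :: "nat \<Rightarrow> real"
  assumes "p \<le> P" "\<And>j. p \<le> j \<Longrightarrow> j < P \<Longrightarrow> f j = 0"
  shows "(\<Sum>j<P. f j) = (\<Sum>j<p. f j)"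
  using assms by (intro sum.mono_neutral_right) (auto simp: not_less)

text \<open>
  A kernel vector of a leading block, padded with zeros, would be a nonzero vector on which the
  form vanishes.
\<close>

lemma det_leading_submat_nonzero:
  assumes S: "pos_def P S" and p: "p \<le> P"
  shows "Determinant.det (leading_submat S p) \<noteq> 0"
proof
  assume "Determinant.det (leading_submat S p) = 0"
  then obtain v where v: "v \<in> carrier_vec p" "v \<noteq> 0\<^sub>v p" "leading_submat S p *\<^sub>v v = 0\<^sub>v p"
    using det_0_iff_vec_prod_zero_field[OF leading_submat_carrier] by blast
  define x where "x j = (if j < p then v $ j else 0)" for j
  have "\<exists>j<p. v $ j \<noteq> 0"
  proof (rule ccontr)
    assume "\<not> ?thesis"
    hence "v = 0\<^sub>v p" using v(1) by (intro eq_vecI) auto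
    with v(2) show False by simp
  qed
  hence "\<exists>j<P. x j \<noteq> 0" using p by (force simp: x_def)
  hence "0 < (\<Sum>i<P. \<Sum>j<P. x i * S $$ (i, j) * x j)" using S by (simp add: pos_def_def)
  also have "(\<Sum>i<P. \<Sum>j<P. x i * S $$ (i, j) * x j) = (\<Sum>i<P. x i * (\<Sum>j<P. S $$ (i, j) * x j))"
    by (simp add: sum_distrib_left mult.assoc)
  also have "\<dots> = (\<Sum>i<p. x i * (\<Sum>j<P. S $$ (i, j) * x j))"
    by (rule sum_lessThan_restrict[OF p]) (simp add: x_def)
  also have "\<dots> = 0"
  proof (intro sum.neutral ballI)
    fix i assume "i \<in> {..<p}" hence i: "i < p" by simp
    have "(\<Sum>j<P. S $$ (i, j) * x j) = (\<Sum>j<p. S $$ (i, j) * x j)"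
      by (rule sum_lessThan_restrict[OF p]) (simp add: x_def)
    also have "\<dots> = (leading_submat S p *\<^sub>v v) $ i"
      using i v(1) carrier_matD[OF leading_submat_carrier[of S p]]
      by (auto simp: scalar_prod_def x_def lessThan_atLeast0 intro!: sum.cong)
    also have "\<dots> = 0" using v(3) i by simp
    finally show "x i * (\<Sum>j<P. S $$ (i, j) * x j) = 0" by simp
  qed
  finally show False by simp
qed

lemma leading_submat_inverse:
  assumes S: "pos_def P S" and p: "p \<le> P"
  shows "inv_mat (leading_submat S p) \<in> carrier_mat p p"
    "leading_submat S p * inv_mat (leading_submat S p) = 1\<^sub>m p"
proof -
  let ?B = "leading_submat S p"
  have B: "?B \<in> carrier_mat p p" by simp
  have d: "Determinant.det ?B \<noteq> 0" by (rule det_leading_submat_nonzero[OF assms])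
  note e = inv_mat_eq_adj_mat[OF B d]
  show "inv_mat ?B \<in> carrier_mat p p" unfolding e using adj_mat(1)[OF B] by simp
  have "?B * inv_mat ?B = (1 / Determinant.det ?B) \<cdot>\<^sub>m (?B * adj_mat ?B)"
    unfolding e by (rule mult_smult_distrib[OF B adj_mat(1)[OF B]])
  also have "\<dots> = 1\<^sub>m p" unfolding adj_mat(2)[OF B] using d by (intro eq_matI) auto
  finally show "?B * inv_mat ?B = 1\<^sub>m p" .
qed

text \<open>
  The last column of the inverse of the leading block of size \<open>r + 1\<close>, padded with zeros. Up to a
  factor it is the coefficient vector of the \<open>r\<close>-th vector that the Gram-Schmidt process for the form
  \<open>S\<close> makes out of the standard basis. In a regression, with \<open>S\<close> the normalised Gram matrix of the design, its inner
  product with \<open>X\<^sup>T y / n\<close> is the last coefficient of the least-squares fit of order \<open>r + 1\<close>.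
\<close>

definition gs_coef :: "real mat \<Rightarrow> nat \<Rightarrow> nat \<Rightarrow> real" where
  "gs_coef S r j = (if j \<le> r then inv_mat (leading_submat S (Suc r)) $$ (j, r) else 0)"

lemma gs_coef_above [simp]: "r < j \<Longrightarrow> gs_coef S r j = 0"
  by (simp add: gs_coef_def)

text \<open>
  This is the equation that the last column of the inverse satisfies; all further properties
  of the vectors follow from it.
\<close>

lemma gs_coef_dual:
  assumes S: "pos_def P S" and r: "r < P" and i: "i \<le> r"
  shows "(\<Sum>j<P. S $$ (i, j) * gs_coef S r j) = of_bool (i = r)"
proof -
  let ?B = "leading_submat S (Suc r)"
  have r': "Suc r \<le> P" using r by simp
  note I = leading_submat_inverse[OF S r']
  have "(\<Sum>j<P. S $$ (i, j) * gs_coef S r j) = (\<Sum>j<Suc r. S $$ (i, j) * gs_coef S r j)"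
    by (rule sum_lessThan_restrict[OF r']) simp
  also have "\<dots> = (?B * inv_mat ?B) $$ (i, r)"
    using i I(1) carrier_matD[OF leading_submat_carrier[of S "Suc r"]]
    by (auto simp: scalar_prod_def gs_coef_def lessThan_atLeast0 simp del: sum.op_ivl_Suc sum.lessThan_Suc intro!: sum.cong)
  also have "\<dots> = of_bool (i = r)" unfolding I(2) using i by auto
  finally show ?thesis .
qed

text \<open>
  The vector with the smaller index is supported where the dual equation for the other one applies.
\<close>

lemma gs_coef_orthogonal_aux:
  assumes S: "pos_def P S" and r: "r < P" "s \<le> r"
  shows "(\<Sum>i<P. \<Sum>j<P. gs_coef S s i * S $$ (i, j) * gs_coef S r j) = of_bool (s = r) * gs_coef S r r"
proof -
  have "(\<Sum>i<P. \<Sum>j<P. gs_coef S s i * S $$ (i, j) * gs_coef S r j)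
      = (\<Sum>i<P. gs_coef S s i * (\<Sum>j<P. S $$ (i, j) * gs_coef S r j))"
    by (simp add: sum_distrib_left mult.assoc)
  also have "\<dots> = (\<Sum>i<P. of_bool (i = r) * gs_coef S s r)"
  proof (rule sum.cong)
    fix i assume "i \<in> {..<P}"
    show "gs_coef S s i * (\<Sum>j<P. S $$ (i, j) * gs_coef S r j) = of_bool (i = r) * gs_coef S s r"
    proof (cases "i \<le> r")
      case True thus ?thesis by (simp add: gs_coef_dual[OF S r(1)])
    next
      case False thus ?thesis using r by simp
    qed
  qed simp
  also have "\<dots> = gs_coef S s r" using r by (intro sum_of_bool_eq)
  finally show ?thesis using r(2) by (cases "s = r") auto
qed

lemma gs_coef_orthogonal:
  assumes S: "pos_def P S" and r: "r < P" "s < P"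
  shows "(\<Sum>i<P. \<Sum>j<P. gs_coef S s i * S $$ (i, j) * gs_coef S r j) = of_bool (s = r) * gs_coef S r r"
proof (cases "s \<le> r")
  case True thus ?thesis by (rule gs_coef_orthogonal_aux[OF S r(1)])
next
  case False
  have sym: "S $$ (i, j) = S $$ (j, i)" if "i < P" "j < P" for i j
    using S that by (simp add: pos_def_def)
  have "(\<Sum>i<P. \<Sum>j<P. gs_coef S s i * S $$ (i, j) * gs_coef S r j)
      = (\<Sum>j<P. \<Sum>i<P. gs_coef S s i * S $$ (i, j) * gs_coef S r j)" by (rule sum.swap)
  also have "\<dots> = (\<Sum>j<P. \<Sum>i<P. gs_coef S r j * S $$ (j, i) * gs_coef S s i)"
    by (intro sum.cong refl) (simp add: sym)
  also have "\<dots> = of_bool (r = s) * gs_coef S s s"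
    using False by (intro gs_coef_orthogonal_aux[OF S r(2)]) simp
  finally show ?thesis using False by auto
qed

lemma gs_coef_diag_pos:
  assumes S: "pos_def P S" and r: "r < P"
  shows "0 < gs_coef S r r"
proof -
  have "\<exists>j<P. gs_coef S r j \<noteq> 0"
  proof (rule ccontr)
    assume "\<not> ?thesis"
    hence "(\<Sum>j<P. S $$ (r, j) * gs_coef S r j) = 0" by (intro sum.neutral) auto
    thus False using gs_coef_dual[OF S r, of r] by simp
  qed
  hence "0 < (\<Sum>i<P. \<Sum>j<P. gs_coef S r i * S $$ (i, j) * gs_coef S r j)"
    using S by (simp add: pos_def_def)
  thus ?thesis by (simp add: gs_coef_orthogonal[OF S r r])
qed

text \<open>
  The Gram-Schmidt vectors form a triangular matrix \<open>M\<close> with \<open>M\<^sup>T S M\<close> diagonal. Solving for \<open>S\<close> and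
  inverting gives the inverse of every leading block as a sum of rank-one terms, with the same
  vectors for all blocks. This is what lets one set of scores describe all restricted estimators at
  once.
\<close>

lemma inv_leading_submat_eq:
  assumes S: "pos_def P S" and p: "p \<le> P" and ij: "i < p" "j < p"
  shows "inv_mat (leading_submat S p) $$ (i, j)
    = (\<Sum>r<p. gs_coef S r i * gs_coef S r j / gs_coef S r r)"
proof -
  let ?B = "leading_submat S p" and ?a = "gs_coef S"
  define M where "M = Matrix.mat p p (\<lambda>(i, r). ?a r i / ?a r r)"
  define M' where "M' = Matrix.mat p p (\<lambda>(r, j). ?a r j)"
  have M: "M \<in> carrier_mat p p" "M' \<in> carrier_mat p p" "?B \<in> carrier_mat p p"
    by (auto simp: M_def M'_def)
  have "M' * (?B * M) = 1\<^sub>m p"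
  proof (rule eq_matI)
    fix s r assume "s < dim_row (1\<^sub>m p :: real mat)" "r < dim_col (1\<^sub>m p :: real mat)"
    hence sr: "s < p" "r < p" by auto
    hence srP: "s < P" "r < P" using p by auto
    have "(M' * (?B * M)) $$ (s, r) = (\<Sum>i<p. ?a s i * (\<Sum>j<p. S $$ (i, j) * (?a r j / ?a r r)))"
      using sr M carrier_matD[OF M(3)]
      by (auto simp: scalar_prod_def M_def M'_def lessThan_atLeast0 intro!: sum.cong)
    also have "\<dots> = (\<Sum>i<P. ?a s i * (\<Sum>j<p. S $$ (i, j) * (?a r j / ?a r r)))"
      by (rule sum_lessThan_restrict[OF p, symmetric]) (use sr in simp)
    also have "\<dots> = (\<Sum>i<P. ?a s i * (\<Sum>j<P. S $$ (i, j) * (?a r j / ?a r r)))"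
      by (intro sum.cong refl arg_cong2[where f = "(*)"] sum_lessThan_restrict[OF p, symmetric]) (use sr in simp)
    also have "\<dots> = (\<Sum>i<P. \<Sum>j<P. ?a s i * S $$ (i, j) * ?a r j) / ?a r r"
      by (simp add: sum_distrib_left sum_divide_distrib mult.assoc)
    also have "\<dots> = of_bool (s = r)"
      unfolding gs_coef_orthogonal[OF S srP(2,1)] using gs_coef_diag_pos[OF S srP(2)] by simp
    finally show "(M' * (?B * M)) $$ (s, r) = 1\<^sub>m p $$ (s, r)" using sr by simp
  qed (use M in auto)
  hence "(?B * M) * M' = 1\<^sub>m p"
    by (rule mat_mult_left_right_inverse[OF M(2) mult_carrier_mat[OF M(3,1)]])
  hence "?B * (M * M') = 1\<^sub>m p" unfolding assoc_mult_mat[OF M(3,1,2)] .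
  hence "inv_mat ?B = M * M'" by (rule inv_mat_eqI[OF M(3) mult_carrier_mat[OF M(1,2)]])
  thus ?thesis using ij
    by (auto simp: scalar_prod_def M_def M'_def lessThan_atLeast0 intro!: sum.cong)
qed

lemma gs_coef_basis:
  assumes S: "pos_def P S" and q: "q \<le> P" and \<theta>: "\<And>j. q \<le> j \<Longrightarrow> j < P \<Longrightarrow> \<theta> j = 0"
  obtains z where "\<And>j. j < P \<Longrightarrow> \<theta> j = (\<Sum>r<q. z r * gs_coef S r j)"
proof -
  let ?B = "leading_submat S q" and ?a = "gs_coef S"
  define z where "z r = (\<Sum>i<q. ?a r i * (\<Sum>l<q. S $$ (i, l) * \<theta> l)) / ?a r r" for r
  note I = leading_submat_inverse[OF S q]
  have I': "inv_mat ?B * ?B = 1\<^sub>m q" 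
    by (rule mat_mult_left_right_inverse[OF leading_submat_carrier I])
  have "\<theta> j = (\<Sum>r<q. z r * ?a r j)" if j: "j < P" for j
  proof (cases "j < q")
    case True
    have *: "(\<Sum>i<q. inv_mat ?B $$ (j, i) * S $$ (i, l)) = of_bool (j = l)" if "l < q" for l
    proof -
      have "(\<Sum>i<q. inv_mat ?B $$ (j, i) * S $$ (i, l)) = (inv_mat ?B * ?B) $$ (j, l)"
        using True that I(1) carrier_matD[OF leading_submat_carrier[of S q]]
        by (auto simp: scalar_prod_def lessThan_atLeast0 intro!: sum.cong)
      thus ?thesis unfolding I' using True that by simp
    qed
    have "(\<Sum>r<q. z r * ?a r j)
        = (\<Sum>r<q. \<Sum>i<q. ?a r j * ?a r i / ?a r r * (\<Sum>l<q. S $$ (i, l) * \<theta> l))"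
      by (simp add: z_def sum_distrib_left sum_divide_distrib mult_ac)
    also have "\<dots> = (\<Sum>i<q. \<Sum>r<q. ?a r j * ?a r i / ?a r r * (\<Sum>l<q. S $$ (i, l) * \<theta> l))"
      by (rule sum.swap)
    also have "\<dots> = (\<Sum>i<q. inv_mat ?B $$ (j, i) * (\<Sum>l<q. S $$ (i, l) * \<theta> l))"
      by (simp add: inv_leading_submat_eq[OF S q True] sum_distrib_right)
    also have "\<dots> = (\<Sum>i<q. \<Sum>l<q. (inv_mat ?B $$ (j, i) * S $$ (i, l)) * \<theta> l)"
      by (simp add: sum_distrib_left mult.assoc)
    also have "\<dots> = (\<Sum>l<q. (\<Sum>i<q. inv_mat ?B $$ (j, i) * S $$ (i, l)) * \<theta> l)"
      unfolding sum_distrib_right by (rule sum.swap)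
    also have "\<dots> = (\<Sum>l<q. of_bool (j = l) * \<theta> l)" by (simp add: *)
    also have "\<dots> = \<theta> j" using True by (rule sum_of_bool_eq)
    finally show ?thesis by simp
  next
    case False
    thus ?thesis using \<theta>[of j] j by simp
  qed
  thus thesis by (rule that)
qed

lemma tendsto_det:
  fixes B :: "nat \<Rightarrow> real mat"
  assumes B: "\<And>n. B n \<in> carrier_mat p p" "C \<in> carrier_mat p p"
    and lim: "\<And>i j. i < p \<Longrightarrow> j < p \<Longrightarrow> (\<lambda>n. B n $$ (i, j)) \<longlonglongrightarrow> C $$ (i, j)"
  shows "(\<lambda>n. Determinant.det (B n)) \<longlonglongrightarrow> Determinant.det C"
proof -
  have eq: "Determinant.det D = (\<Sum>\<pi> | \<pi> permutes {0..<p}. signof \<pi> * (\<Prod>i = 0..<p. D $$ (i, \<pi> i)))"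
    if "D \<in> carrier_mat p p" for D :: "real mat"
    using that by (rule det_def')
  show ?thesis unfolding eq[OF B(1)] eq[OF B(2)]
    by (intro tendsto_sum tendsto_mult tendsto_const tendsto_prod lim) (auto simp: permutes_in_image)
qed

lemma tendsto_inv_mat:
  fixes B :: "nat \<Rightarrow> real mat"
  assumes B: "\<And>n. B n \<in> carrier_mat p p" "C \<in> carrier_mat p p"
    and lim: "\<And>i j. i < p \<Longrightarrow> j < p \<Longrightarrow> (\<lambda>n. B n $$ (i, j)) \<longlonglongrightarrow> C $$ (i, j)"
    and det: "Determinant.det C \<noteq> 0" and ij: "i < p" "j < p"
  shows "(\<lambda>n. inv_mat (B n) $$ (i, j)) \<longlonglongrightarrow> inv_mat C $$ (i, j)"
proof -
  note d = tendsto_det[OF B lim]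
  have "(\<lambda>n. Determinant.det (mat_delete (B n) j i)) \<longlonglongrightarrow> Determinant.det (mat_delete C j i)"
  proof (rule tendsto_det[where p = "p - 1"])
    show "mat_delete (B n) j i \<in> carrier_mat (p - 1) (p - 1)" for n
      using carrier_matD[OF B(1)] by (simp add: mat_delete_def)
    show "mat_delete C j i \<in> carrier_mat (p - 1) (p - 1)"
      using carrier_matD[OF B(2)] by (simp add: mat_delete_def)
    show "(\<lambda>n. mat_delete (B n) j i $$ (a, b)) \<longlonglongrightarrow> mat_delete C j i $$ (a, b)"
      if "a < p - 1" "b < p - 1" for a b
      using that carrier_matD[OF B(1)] carrier_matD[OF B(2)] by (auto simp: mat_delete_def intro!: lim)
  qed
  hence adj: "(\<lambda>n. 1 / Determinant.det (B n) * adj_mat (B n) $$ (i, j)) \<longlonglongrightarrow> 1 / Determinant.det C * adj_mat C $$ (i, j)"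
    using ij carrier_matD[OF B(1)] carrier_matD[OF B(2)]
    by (auto simp: adj_mat_def cofactor_def intro!: tendsto_intros d det)
  have "\<forall>\<^sub>F n in sequentially. Determinant.det (B n) \<noteq> 0"
    using d det by (rule tendsto_imp_eventually_ne)
  hence "\<forall>\<^sub>F n in sequentially. 1 / Determinant.det (B n) * adj_mat (B n) $$ (i, j) = inv_mat (B n) $$ (i, j)"
  proof eventually_elim
    case (elim n)
    show ?case unfolding inv_mat_eq_adj_mat[OF B(1) elim]
      using ij carrier_matD[OF adj_mat(1)[OF B(1)]] by simp
  qed
  moreover have "1 / Determinant.det C * adj_mat C $$ (i, j) = inv_mat C $$ (i, j)"
    unfolding inv_mat_eq_adj_mat[OF B(2) det]
    using ij carrier_matD[OF adj_mat(1)[OF B(2)]] by simp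
  ultimately show ?thesis using Lim_transform_eventually[OF adj] by simp
qed

text \<open>
  Positive definiteness of the limit keeps its leading determinants away from zero, so the quotients
  in Cramer's rule pass to the limit.
\<close>

lemma tendsto_gs_coef:
  assumes S: "pos_def P S" and r: "r < P"
    and lim: "\<And>i j. i < P \<Longrightarrow> j < P \<Longrightarrow> (\<lambda>n. B n $$ (i, j)) \<longlonglongrightarrow> S $$ (i, j)"
  shows "(\<lambda>n. gs_coef (B n) r j) \<longlonglongrightarrow> gs_coef S r j"
proof (cases "j \<le> r")
  case True
  have "(\<lambda>n. inv_mat (leading_submat (B n) (Suc r)) $$ (j, r)) \<longlonglongrightarrow> inv_mat (leading_submat S (Suc r)) $$ (j, r)"
    using r True by (intro tendsto_inv_mat[where p = "Suc r"] det_leading_submat_nonzero[OF S]) (auto intro!: lim)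
  thus ?thesis using True by (simp add: gs_coef_def)
qed simp

section \<open>Full-rank matrices and regression in orthonormal coordinates\<close>

text \<open>
  A set of columns may hide repetitions, so the count given by the rank is first used to show that
  the columns are distinct.
\<close>

lemma full_column_rank_injective:
  fixes X :: "real mat"
  assumes X: "X \<in> carrier_mat n P" and rank: "vec_space.rank n X = P"
    and zero: "\<And>l. l < n \<Longrightarrow> (\<Sum>j<P. X $$ (l, j) * x j) = 0" and j: "j < P"
  shows "x j = 0"
proof -
  interpret vec_space "TYPE(real)" n .
  obtain U where U: "maximal U (\<lambda>T. T \<subseteq> set (cols X) \<and> lin_indpt T)"
    using maximal_exists[of "(\<lambda>T. T \<subseteq> set (cols X) \<and> lin_indpt T)" "card (set (cols X))" "{}"]
    by (meson List.finite_set card_mono empty_iff empty_subsetI finite_lin_indpt2 rev_finite_subset)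
  have "card U = P" using rank_card_indpt[OF X U] rank by simp
  moreover have "card U \<le> card (set (cols X))" using U by (simp add: card_mono maximal_def)
  ultimately have "length (cols X) \<le> card (set (cols X))" using X by simp
  hence "card (set (cols X)) = length (cols X)" using card_length[of "cols X"] by linarith
  hence dist: "distinct (cols X)" by (rule card_distinct)
  have indpt: "lin_indpt (set (cols X))" by (rule full_rank_lin_indpt[OF X rank dist])
  have "X *\<^sub>v Matrix.vec P x = 0\<^sub>v n"
    using X zero by (intro eq_vecI) (auto simp: scalar_prod_def lessThan_atLeast0)
  hence "Matrix.vec P x = 0\<^sub>v P" using lin_depI[OF X _ _ _ dist] indpt vec_carrier by blast
  hence "Matrix.vec P x $ j = 0\<^sub>v P $ j" by simp
  thus ?thesis using j by simp
qed

lemma full_row_rank_surjective: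
  fixes A :: "real mat"
  assumes A: "A \<in> carrier_mat k P" and rank: "vec_space.rank k A = k"
  obtains x where "\<And>i. i < k \<Longrightarrow> (\<Sum>j<P. A $$ (i, j) * x j) = w i"
proof -
  interpret vec_space "TYPE(real)" k .
  obtain U where U: "maximal U (\<lambda>T. T \<subseteq> set (cols A) \<and> lin_indpt T)"
    using maximal_exists[of "(\<lambda>T. T \<subseteq> set (cols A) \<and> lin_indpt T)" "card (set (cols A))" "{}"]
    by (meson List.finite_set card_mono empty_iff empty_subsetI finite_lin_indpt2 rev_finite_subset)
  have card: "card U = k" using rank_card_indpt[OF A U] rank by simp
  have colsA: "set (cols A) \<subseteq> carrier_vec k" using A cols_dim by blast
  have U': "U \<subseteq> set (cols A)" "lin_indpt U" using U by (auto simp: maximal_def)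
  have "basis U" using U' colsA card finite_subset[OF U'(1)]
    by (intro dim_li_is_basis) (auto simp: dim_is_n)
  hence "span U = carrier_vec k" by (simp add: basis_def)
  hence "Matrix.vec k w \<in> span (set (cols A))" using span_is_monotone[OF U'(1)] by auto
  hence "Matrix.vec k w \<in> span_list (cols A)" using span_list_as_span[OF colsA] by simp
  then obtain c where "Matrix.vec k w = lincomb_list c (cols A)" by (auto simp: span_list_def)
  also have "\<dots> = mat_of_cols k (cols A) *\<^sub>v Matrix.vec (length (cols A)) c"
    using colsA by (intro lincomb_list_as_mat_mult) auto
  also have "mat_of_cols k (cols A) = A" using A by (metis carrier_matD(1) mat_of_cols_cols)
  finally have *: "Matrix.vec k w = A *\<^sub>v Matrix.vec P c" using A by simp
  show thesis
  proof (rule that[of c])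
    fix i assume i: "i < k"
    have "w i = Matrix.vec k w $ i" using i by simp
    also have "\<dots> = (\<Sum>j<P. A $$ (i, j) * c j)"
      unfolding * using i A by (auto simp: scalar_prod_def lessThan_atLeast0)
    finally show "(\<Sum>j<P. A $$ (i, j) * c j) = w i" by simp
  qed
qed

text \<open>
  The matrix that converges to \<open>Q\<close>.
\<close>

definition moment_mat :: "real mat \<Rightarrow> real mat" where
  "moment_mat X = (1 / real (dim_row X)) \<cdot>\<^sub>m gram X"

text \<open>
  The square of the normalising constant in the test statistic of order \<open>r + 1\<close>.
\<close>

definition xi_sq :: "real mat \<Rightarrow> nat \<Rightarrow> real" where
  "xi_sq X r = gs_coef (moment_mat X) r r"

text \<open>
  The residual of the \<open>r\<close>-th column after projection on the preceding ones, normalised to unit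
  length.
\<close>

definition direction :: "real mat \<Rightarrow> nat \<Rightarrow> nat \<Rightarrow> real" where
  "direction X r l = (\<Sum>j<dim_col X. X $$ (l, j) * gs_coef (moment_mat X) r j)
     / (sqrt (real (dim_row X)) * sqrt (xi_sq X r))"

text \<open>
  Scores take functions rather than vectors, because they are applied both to observations and to
  noise, and the noise law lives on functions.
\<close>

definition score :: "real mat \<Rightarrow> nat \<Rightarrow> (nat \<Rightarrow> real) \<Rightarrow> real" where
  "score X r y = (\<Sum>l<dim_row X. direction X r l * y l)"

lemma score_add: "score X r (\<lambda>l. y l + z l) = score X r y + score X r z"
  by (simp add: score_def sum.distrib distrib_left)

lemma gram_index:
  "i < dim_col X \<Longrightarrow> j < dim_col X \<Longrightarrow> gram X $$ (i, j) = (\<Sum>l<dim_row X. X $$ (l, i) * X $$ (l, j))"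
  by (auto simp: gram_def scalar_prod_def lessThan_atLeast0)

lemma moment_mat_index:
  "i < dim_col X \<Longrightarrow> j < dim_col X \<Longrightarrow>
    moment_mat X $$ (i, j) = (\<Sum>l<dim_row X. X $$ (l, i) * X $$ (l, j)) / real (dim_row X)"
  by (simp add: moment_mat_def gram_index[symmetric]) (simp add: gram_def)

lemma moment_mat_gram:
  "i < dim_col X \<Longrightarrow> j < dim_col X \<Longrightarrow> moment_mat X $$ (i, j) = gram X $$ (i, j) / real (dim_row X)"
  by (simp add: moment_mat_index gram_index)

lemma moment_quadratic:
  assumes "dim_col X = P" "dim_row X = n"
  shows "(\<Sum>i<P. \<Sum>j<P. x i * moment_mat X $$ (i, j) * z j)
    = (\<Sum>l<n. (\<Sum>i<P. X $$ (l, i) * x i) * (\<Sum>j<P. X $$ (l, j) * z j)) / real n"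
proof -
  have "(\<Sum>i<P. \<Sum>j<P. x i * moment_mat X $$ (i, j) * z j)
      = (\<Sum>i<P. \<Sum>j<P. \<Sum>l<n. X $$ (l, i) * x i * (X $$ (l, j) * z j) / real n)"
    using assms by (intro sum.cong refl)
      (auto simp: moment_mat_index sum_distrib_left sum_distrib_right sum_divide_distrib mult_ac)
  also have "\<dots> = (\<Sum>i<P. \<Sum>l<n. \<Sum>j<P. X $$ (l, i) * x i * (X $$ (l, j) * z j) / real n)"
    by (intro sum.cong refl sum.swap)
  also have "\<dots> = (\<Sum>l<n. \<Sum>i<P. \<Sum>j<P. X $$ (l, i) * x i * (X $$ (l, j) * z j) / real n)"
    by (rule sum.swap)
  also have "\<dots> = (\<Sum>l<n. (\<Sum>i<P. X $$ (l, i) * x i) * (\<Sum>j<P. X $$ (l, j) * z j)) / real n"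
    by (simp add: sum_product sum_divide_distrib)
  finally show ?thesis .
qed

locale regression =
  fixes X :: "real mat" and n P :: nat
  assumes X: "X \<in> carrier_mat n P" and rank: "vec_space.rank n X = P"
    and P: "0 < P" and nP: "P < n"
begin

lemma dim [simp]: "dim_row X = n" "dim_col X = P"
  using X by auto

lemma n0: "0 < real n" "0 < n" using nP by auto

abbreviation "S \<equiv> moment_mat X"
abbreviation "a \<equiv> gs_coef (moment_mat X)"

lemma moment_carrier [simp]: "S \<in> carrier_mat P P"
  using X by (simp add: moment_mat_def gram_def)

lemma moment_pos_def: "pos_def P S"
  unfolding pos_def_def
proof (intro conjI allI impI)
  show "S \<in> carrier_mat P P" by simp
  show "S $$ (i, j) = S $$ (j, i)" if "i < P" "j < P" for i j
    using that by (simp add: moment_mat_index mult.commute)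
  fix x :: "nat \<Rightarrow> real" assume x: "\<exists>j<P. x j \<noteq> 0"
  have "\<not> (\<forall>l<n. (\<Sum>i<P. X $$ (l, i) * x i) = 0)"
    using full_column_rank_injective[OF X rank, of x] x by blast
  then obtain l where l: "l < n" "(\<Sum>i<P. X $$ (l, i) * x i) \<noteq> 0" by blast
  have "0 < (\<Sum>l<n. (\<Sum>i<P. X $$ (l, i) * x i)\<^sup>2)"
    using l by (intro sum_pos2[of _ l]) auto
  thus "0 < (\<Sum>i<P. \<Sum>j<P. x i * S $$ (i, j) * x j)"
    using n0 by (simp add: moment_quadratic[of X P n] power2_eq_square)
qed

lemma xi_sq_pos: "r < P \<Longrightarrow> 0 < xi_sq X r"
  unfolding xi_sq_def by (rule gs_coef_diag_pos[OF moment_pos_def])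

lemma direction_orthonormal:
  assumes "r < P" "s < P"
  shows "(\<Sum>l<n. direction X r l * direction X s l) = of_bool (r = s)"
proof -
  have "(\<Sum>l<n. direction X r l * direction X s l)
      = (\<Sum>l<n. (\<Sum>i<P. X $$ (l, i) * a r i) * (\<Sum>j<P. X $$ (l, j) * a s j)) / real n
        / (sqrt (xi_sq X r) * sqrt (xi_sq X s))"
    unfolding sum_divide_distrib[where A = "{..<n}"] direction_def dim times_divide_times_eq divide_divide_eq_left
    using n0 by (intro sum.cong refl arg_cong2[where f = "(/)"]) (simp_all add: mult_ac)
  also have "\<dots> = of_bool (r = s) * xi_sq X r / (sqrt (xi_sq X r) * sqrt (xi_sq X s))"
    using gs_coef_orthogonal[OF moment_pos_def assms(2,1)]
    by (cases "r = s") (auto simp: moment_quadratic[of X P n] xi_sq_def)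
  also have "\<dots> = of_bool (r = s)" using xi_sq_pos[OF assms(1)] by auto
  finally show ?thesis .
qed

lemma gram_first_cols:
  assumes "p \<le> P"
  shows "gram (first_cols X p) = real n \<cdot>\<^sub>m leading_submat S p"
    "(1 / real n) \<cdot>\<^sub>m gram (first_cols X p) = leading_submat S p"
proof -
  show 1: "gram (first_cols X p) = real n \<cdot>\<^sub>m leading_submat S p"
    using assms n0
    by (intro eq_matI)
       (auto simp: gram_def scalar_prod_def first_cols_def leading_submat_def moment_mat_index lessThan_atLeast0)
  show "(1 / real n) \<cdot>\<^sub>m gram (first_cols X p) = leading_submat S p"
    unfolding 1 using n0 by (intro eq_matI) auto
qed

lemma inv_gram_first_cols:
  assumes "p \<le> P"
  shows "inv_mat (gram (first_cols X p)) = (1 / real n) \<cdot>\<^sub>m inv_mat (leading_submat S p)"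
proof (rule inv_mat_eqI)
  note I = leading_submat_inverse[OF moment_pos_def assms]
  show "gram (first_cols X p) \<in> carrier_mat p p" by (simp add: gram_first_cols[OF assms])
  show "(1 / real n) \<cdot>\<^sub>m inv_mat (leading_submat S p) \<in> carrier_mat p p" using I by simp
  show "gram (first_cols X p) * ((1 / real n) \<cdot>\<^sub>m inv_mat (leading_submat S p)) = 1\<^sub>m p"
    unfolding gram_first_cols(1)[OF assms]
    unfolding mult_smult_distrib[OF smult_carrier_mat[OF leading_submat_carrier] I(1)]
    unfolding mult_smult_assoc_mat[OF leading_submat_carrier I(1)] I(2)
    using n0 by (intro eq_matI) auto
qed

text \<open>
  In orthonormal coordinates the restricted estimator of order \<open>p\<close> is the truncation of one
  expansion after \<open>p\<close> terms. The formula covers the coordinates that are set to zero as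
  well, since the padded vectors vanish there.
\<close>

lemma restricted_ls_eq:
  assumes y: "y \<in> carrier_vec n" and p: "p \<le> P" and i: "i < P"
  shows "restricted_ls X p y $ i = (\<Sum>r<p. a r i / (sqrt (real n) * sqrt (xi_sq X r)) * score X r (($) y))"
proof (cases "i < p")
  case True
  note I = leading_submat_inverse[OF moment_pos_def p]
  have dimI: "dim_row (inv_mat (leading_submat S p)) = p" "dim_col (inv_mat (leading_submat S p)) = p"
    using I(1) by auto
  have dirn: "(\<Sum>j<p. X $$ (l, j) * a r j) = sqrt (real n) * sqrt (xi_sq X r) * direction X r l"
    if "r < p" for r l
  proof -
    have "(\<Sum>j<p. X $$ (l, j) * a r j) = (\<Sum>j<P. X $$ (l, j) * a r j)"
      by (rule sum_lessThan_restrict[OF p, symmetric]) (use that in simp)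
    thus ?thesis using n0 xi_sq_pos[of r] that p by (simp add: direction_def)
  qed
  have "restricted_ls X p y $ i
     = (\<Sum>j<p. 1 / real n * inv_mat (leading_submat S p) $$ (i, j) * (\<Sum>l<n. X $$ (l, j) * y $ l))"
    using True i y dimI p unfolding restricted_ls_def inv_gram_first_cols[OF p]
    by (auto simp: scalar_prod_def first_cols_def lessThan_atLeast0 intro!: sum.cong)
  also have "\<dots> = (\<Sum>j<p. (\<Sum>r<p. 1 / real n * (a r i * a r j / xi_sq X r)) * (\<Sum>l<n. X $$ (l, j) * y $ l))"
    by (intro sum.cong refl)
      (simp add: inv_leading_submat_eq[OF moment_pos_def p True] xi_sq_def sum_distrib_left)
  also have "\<dots> = (\<Sum>j<p. \<Sum>r<p. a r i / (real n * xi_sq X r) * (\<Sum>l<n. X $$ (l, j) * a r j * y $ l))"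
    by (simp add: sum_distrib_left sum_distrib_right sum_divide_distrib mult_ac)
  also have "\<dots> = (\<Sum>r<p. \<Sum>j<p. a r i / (real n * xi_sq X r) * (\<Sum>l<n. X $$ (l, j) * a r j * y $ l))"
    by (rule sum.swap)
  also have "\<dots> = (\<Sum>r<p. a r i / (real n * xi_sq X r) * (\<Sum>l<n. (\<Sum>j<p. X $$ (l, j) * a r j) * y $ l))"
    unfolding sum_distrib_left[symmetric] sum_distrib_right by (intro sum.cong refl arg_cong2[where f = "(*)"] sum.swap)
  also have "\<dots> = (\<Sum>r<p. a r i / (sqrt (real n) * sqrt (xi_sq X r)) * score X r (($) y))"
  proof (intro sum.cong refl)
    fix r assume "r \<in> {..<p}" hence r: "r < p" "r < P" using p by auto
    have s: "xi_sq X r = sqrt (xi_sq X r) * sqrt (xi_sq X r)" "real n = sqrt (real n) * sqrt (real n)"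
      using xi_sq_pos[OF r(2)] by auto
    have "(\<Sum>l<n. (\<Sum>j<p. X $$ (l, j) * a r j) * y $ l)
      = sqrt (real n) * sqrt (xi_sq X r) * score X r (($) y)"
      using r by (simp add: dirn score_def sum_distrib_left mult.assoc)
    thus "a r i / (real n * xi_sq X r) * (\<Sum>l<n. (\<Sum>j<p. X $$ (l, j) * a r j) * y $ l)
      = a r i / (sqrt (real n) * sqrt (xi_sq X r)) * score X r (($) y)"
      using xi_sq_pos[OF r(2)] n0 by (subst s(1), subst s(2)) (simp add: field_simps)
  qed
  finally show ?thesis .
next
  case False
  thus ?thesis using i by (simp add: restricted_ls_def)
qed

lemma xi_eq:
  assumes "0 < p" "p \<le> P"
  shows "xi X p = sqrt (xi_sq X (p - 1))"
  using assms unfolding xi_def dim gram_first_cols(2)[OF assms(2)] by (simp add: xi_sq_def gs_coef_def)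

text \<open>
  At its last coordinate the estimator of order \<open>p\<close> sees only the last term of the expansion, and
  the normalisation turns the coefficient of this term into one.
\<close>

lemma t_stat_eq:
  assumes y: "y \<in> carrier_vec n" and p: "0 < p" "p \<le> P"
  shows "t_stat X p y = score X (p - 1) (($) y) / sigma_hat X y"
proof -
  obtain r where r: "p = Suc r" using p(1) by (cases p) auto
  hence rP: "r < P" using p by simp
  define s where "s = sqrt (xi_sq X r)"
  have s: "0 < s" "a r r = s * s" using xi_sq_pos[OF rP] by (simp_all add: s_def xi_sq_def)
  have "restricted_ls X p y $ r = a r r / (sqrt (real n) * s) * score X r (($) y)"
    using restricted_ls_eq[OF y p(2) rP] by (simp add: r s_def)
  also have "\<dots> = s / sqrt (real n) * score X r (($) y)" using s by simp
  finally have "restricted_ls X p y $ r = s / sqrt (real n) * score X r (($) y)" .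
  moreover have "xi X p = s" using p by (simp add: xi_eq r s_def)
  ultimately show ?thesis
    using p n0 s(1) by (simp add: t_stat_def r)
qed

lemma fitted_eq:
  assumes y: "y \<in> carrier_vec n" and l: "l < n"
  shows "(X *\<^sub>v restricted_ls X P y) $ l = (\<Sum>r<P. direction X r l * score X r (($) y))"
proof -
  have "(X *\<^sub>v restricted_ls X P y) $ l = (\<Sum>j<P. X $$ (l, j) * restricted_ls X P y $ j)"
    using l X by (auto simp: scalar_prod_def restricted_ls_def lessThan_atLeast0)
  also have "\<dots> = (\<Sum>j<P. \<Sum>r<P. X $$ (l, j) * a r j / (sqrt (real n) * sqrt (xi_sq X r)) * score X r (($) y))"
    by (intro sum.cong refl) (simp add: restricted_ls_eq[OF y] sum_distrib_left mult_ac)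
  also have "\<dots> = (\<Sum>r<P. \<Sum>j<P. X $$ (l, j) * a r j / (sqrt (real n) * sqrt (xi_sq X r)) * score X r (($) y))"
    by (rule sum.swap)
  also have "\<dots> = (\<Sum>r<P. direction X r l * score X r (($) y))"
    by (simp add: direction_def sum_distrib_right sum_distrib_left sum_divide_distrib mult_ac)
  finally show ?thesis .
qed

lemma sigma_hat_eq:
  assumes y: "y \<in> carrier_vec n"
  shows "sigma_hat X y =
    sqrt ((\<Sum>l<n. (y $ l - (\<Sum>r<P. direction X r l * score X r (($) y)))\<^sup>2) / (real n - real P))"
proof -
  have "(y - X *\<^sub>v restricted_ls X P y) $ l = y $ l - (\<Sum>r<P. direction X r l * score X r (($) y))"
    if "l < n" for l using that y X fitted_eq[OF y that] by (simp del: index_mult_mat_vec)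
  moreover have "dim_vec (y - X *\<^sub>v restricted_ls X P y) = n" using X by simp
  ultimately show ?thesis
    by (simp add: sigma_hat_def euclid_norm_def L2_set_def sum_nonneg)
qed

text \<open>
  A parameter in the submodel of order \<open>q\<close> is a combination of the first \<open>q\<close> Gram-Schmidt vectors, and
  these are mapped by the design to multiples of the directions.
\<close>

lemma signal_expansion:
  assumes \<theta>: "\<theta> \<in> submodel P q" and q: "q \<le> P"
  obtains z where "\<And>r. r < P \<Longrightarrow> score X r (($) (X *\<^sub>v \<theta>)) = (if r < q then z r * sqrt (real n) * sqrt (xi_sq X r) else 0)"
    and "\<And>j. j < P \<Longrightarrow> \<theta> $ j = (\<Sum>r<q. z r * a r j)"
proof -
  obtain z where z: "\<And>j. j < P \<Longrightarrow> \<theta> $ j = (\<Sum>r<q. z r * a r j)"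
    using gs_coef_basis[OF moment_pos_def q, of "($) \<theta>"] \<theta> by (force simp: submodel_def)
  have th: "dim_vec \<theta> = P" using \<theta> by (auto simp: submodel_def)
  have signal: "(X *\<^sub>v \<theta>) $ l = (\<Sum>s<q. z s * sqrt (real n) * sqrt (xi_sq X s) * direction X s l)"
    if l: "l < n" for l
  proof -
    have "(X *\<^sub>v \<theta>) $ l = (\<Sum>j<P. X $$ (l, j) * \<theta> $ j)"
      using l X th by (auto simp: scalar_prod_def lessThan_atLeast0)
    also have "\<dots> = (\<Sum>j<P. \<Sum>s<q. X $$ (l, j) * (z s * a s j))"
      by (simp add: z sum_distrib_left)
    also have "\<dots> = (\<Sum>s<q. \<Sum>j<P. X $$ (l, j) * (z s * a s j))" by (rule sum.swap)
    also have "\<dots> = (\<Sum>s<q. z s * (\<Sum>j<P. X $$ (l, j) * a s j))"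
      by (simp add: sum_distrib_left mult_ac)
    also have "\<dots> = (\<Sum>s<q. z s * sqrt (real n) * sqrt (xi_sq X s) * direction X s l)"
    proof (intro sum.cong refl)
      fix s assume "s \<in> {..<q}" hence "s < P" using q by auto
      thus "z s * (\<Sum>j<P. X $$ (l, j) * a s j) = z s * sqrt (real n) * sqrt (xi_sq X s) * direction X s l"
        using xi_sq_pos[of s] n0 by (simp add: direction_def)
    qed
    finally show ?thesis .
  qed
  have score: "score X r (($) (X *\<^sub>v \<theta>)) = (if r < q then z r * sqrt (real n) * sqrt (xi_sq X r) else 0)"
    if r: "r < P" for r
  proof -
    have "score X r (($) (X *\<^sub>v \<theta>))
      = (\<Sum>l<n. \<Sum>s<q. z s * sqrt (real n) * sqrt (xi_sq X s) * (direction X r l * direction X s l))"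
      by (simp add: score_def signal sum_distrib_left mult_ac del: index_mult_mat_vec)
    also have "\<dots> = (\<Sum>s<q. \<Sum>l<n. z s * sqrt (real n) * sqrt (xi_sq X s) * (direction X r l * direction X s l))"
      by (rule sum.swap)
    also have "\<dots> = (\<Sum>s<q. z s * sqrt (real n) * sqrt (xi_sq X s) * (\<Sum>l<n. direction X r l * direction X s l))"
      by (simp only: sum_distrib_left)
    also have "\<dots> = (\<Sum>s<q. z s * sqrt (real n) * sqrt (xi_sq X s) * of_bool (r = s))"
      using r q by (intro sum.cong refl) (simp add: direction_orthonormal)
    also have "\<dots> = (\<Sum>s<q. of_bool (r = s) * (z s * sqrt (real n) * sqrt (xi_sq X s)))"
      by (simp add: mult_ac)
    also have "\<dots> = (if r < q then z r * sqrt (real n) * sqrt (xi_sq X r) else 0)"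
      by (cases "r < q") (auto simp: sum_of_bool_eq)
    finally show ?thesis .
  qed
  show thesis using score z by (rule that)
qed

text \<open>
  Tests of orders above the true one see pure noise.
\<close>

lemma score_signal_above:
  assumes \<theta>: "\<theta> \<in> submodel P q" and "q \<le> r" "r < P"
  shows "score X r (($) (X *\<^sub>v \<theta>)) = 0"
proof -
  have "q \<le> P" using assms by simp
  with \<theta> show ?thesis by (rule signal_expansion) (use assms in auto)
qed

lemma score_signal_top:
  assumes \<theta>: "\<theta> \<in> submodel P (Suc r)" and r: "r < P"
  shows "score X r (($) (X *\<^sub>v \<theta>)) = sqrt (real n) * \<theta> $ r / sqrt (xi_sq X r)"
proof -
  have "Suc r \<le> P" using r by simp
  from signal_expansion[OF \<theta> this] obtain z where
    z: "score X r (($) (X *\<^sub>v \<theta>)) = z r * sqrt (real n) * sqrt (xi_sq X r)"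
      "\<And>j. j < P \<Longrightarrow> \<theta> $ j = (\<Sum>s<Suc r. z s * a s j)"
    using r by (metis lessI)
  define s where "s = sqrt (xi_sq X r)"
  have s: "0 < s" "a r r = s * s" using xi_sq_pos[OF r] by (simp_all add: s_def xi_sq_def)
  have "\<theta> $ r = z r * a r r" using z(2)[OF r] by simp
  thus ?thesis using z(1) s by (simp add: s_def[symmetric])
qed

lemma signal_reproduced:
  assumes \<theta>: "\<theta> \<in> submodel P q" and q: "q \<le> P" and j: "j < P"
  shows "(\<Sum>r<q. a r j / (sqrt (real n) * sqrt (xi_sq X r)) * score X r (($) (X *\<^sub>v \<theta>))) = \<theta> $ j"
proof -
  from signal_expansion[OF \<theta> q] obtain z where z: "\<And>r. r < P \<Longrightarrow> score X r (($) (X *\<^sub>v \<theta>)) =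
        (if r < q then z r * sqrt (real n) * sqrt (xi_sq X r) else 0)"
      "\<And>j. j < P \<Longrightarrow> \<theta> $ j = (\<Sum>r<q. z r * a r j)"
    by metis
  have "(\<Sum>r<q. a r j / (sqrt (real n) * sqrt (xi_sq X r)) * score X r (($) (X *\<^sub>v \<theta>))) = (\<Sum>r<q. z r * a r j)"
  proof (intro sum.cong refl)
    fix r assume "r \<in> {..<q}" hence r: "r < q" "r < P" using q by auto
    thus "a r j / (sqrt (real n) * sqrt (xi_sq X r)) * score X r (($) (X *\<^sub>v \<theta>)) = z r * a r j"
      using xi_sq_pos[OF r(2)] n0 by (simp add: z(1))
  qed
  thus ?thesis using z(2)[OF j] by simp
qed

end

section \<open>Identifying standard normal vectors by characteristic functions\<close>

lemma std_normal_prob: "prob_space std_normal_distribution"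
  by (intro prob_space_normal_density) simp

text \<open>
  Allowing an unnormalised measure of total mass \<open>K\<close> makes the one-dimensional uniqueness theorem
  applicable to measures with a density, which is how it is used below.
\<close>

lemma char_std_normal_determines:
  fixes M :: "'a measure"
  assumes fin: "finite_measure M" and f: "f \<in> borel_measurable M"
    and ch: "\<And>s. (CLINT x|M. iexp (s * f x)) = complex_of_real (K * exp (- s\<^sup>2 / 2))"
    and A: "A \<in> sets borel"
  shows "measure M (f -` A \<inter> space M) = K * measure std_normal_distribution A"
proof -
  interpret M: finite_measure M by fact
  have K: "K = measure M (space M)"
  proof -
    have "complex_of_real (measure M (space M)) = (CLINT x|M. 1)" by (simp add: scaleR_conv_of_real)
    also have "\<dots> = complex_of_real K" using ch[of 0] by simp
    finally show ?thesis by simp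
  qed
  show ?thesis
  proof (cases "K = 0")
    case True
    have "measure M (f -` A \<inter> space M) \<le> measure M (space M)" by (rule M.bounded_measure)
    thus ?thesis using True K by (simp add: measure_le_0_iff)
  next
    case False
    hence K0: "0 < K" using K by (simp add: zero_less_measure_iff)
    define N where "N = distr (scale_measure (ennreal (1 / K)) M) borel f"
    have f': "f \<in> borel_measurable (scale_measure (ennreal (1 / K)) M)" using f by simp
    have dens: "scale_measure (ennreal (1 / K)) M = density M (\<lambda>_. ennreal (1 / K))"
      by (rule measure_eqI) (simp_all add: emeasure_density nn_integral_cmult)
    have emN: "emeasure N B = ennreal (1 / K) * emeasure M (f -` B \<inter> space M)" if "B \<in> sets borel" for B
      using that f' f unfolding N_def by (simp add: emeasure_distr space_scale_measure)
    have "emeasure N (space N) = ennreal (1 / K) * ennreal K"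
      using emN[of UNIV] K by (simp add: N_def M.emeasure_eq_measure)
    also have "\<dots> = 1" using K0 by (simp flip: ennreal_mult)
    finally have "prob_space N" by (rule prob_spaceI)
    hence rd: "real_distribution N"
      by (simp add: real_distribution_def real_distribution_axioms_def N_def)
    have "char N = char std_normal_distribution"
    proof
      fix s
      have "char N s = (CLINT x|scale_measure (ennreal (1 / K)) M. iexp (s * f x))"
        unfolding char_def N_def by (subst integral_distr[OF f']) simp_all
      also have "\<dots> = (CLINT x|M. (1 / K) *\<^sub>R iexp (s * f x))"
        unfolding dens using K0 f by (subst integral_density) simp_all
      also have "\<dots> = complex_of_real (exp (- s\<^sup>2 / 2))"
        using ch[of s] K0 by (simp add: scaleR_conv_of_real)
      finally show "char N s = char std_normal_distribution s"
        by (simp add: char_std_normal_distribution)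
    qed
    hence "N = std_normal_distribution"
      by (rule Levy_uniqueness[OF rd real_dist_normal_dist])
    hence "emeasure std_normal_distribution A = ennreal (1 / K) * emeasure M (f -` A \<inter> space M)"
      using emN[OF A] by simp
    hence "measure std_normal_distribution A = 1 / K * measure M (f -` A \<inter> space M)"
      using K0 by (simp add: measure_def enn2real_mult)
    thus ?thesis using K0 by simp
  qed
qed

text \<open>
  Only one-dimensional uniqueness of characteristic functions is used. The coordinates are treated one
  at a time: the first \<open>j\<close> enter through events, the others still through exponentials. To pass from
  \<open>j\<close> to \<open>j + 1\<close>, weight the measure with the indicator of the current event times \<open>1 + h(w)\<close>, where \<open>w\<close>
  is the phase contributed by the later coordinates and \<open>h\<close> is cosine, sine or zero. The weight is
  nonnegative, so uniqueness applies to the law of the next coordinate, and the real and imaginary parts are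
  recovered by subtraction.
\<close>

lemma (in prob_space) joint_char_std_normal_step:
  fixes f :: "nat \<Rightarrow> 'a \<Rightarrow> real"
  assumes f: "\<And>p. p < P \<Longrightarrow> f p \<in> borel_measurable M"
    and ch: "\<And>s. (CLINT x|M. iexp (\<Sum>p<P. s p * f p x)) = complex_of_real (\<Prod>p<P. exp (- (s p)\<^sup>2 / 2))"
    and A: "\<And>p. p < P \<Longrightarrow> A p \<in> sets borel" and j: "j \<le> P"
  shows "(CLINT x|M. indicator {x\<in>space M. \<forall>p<j. f p x \<in> A p} x *\<^sub>R iexp (\<Sum>p=j..<P. s p * f p x))
    = complex_of_real ((\<Prod>p<j. measure std_normal_distribution (A p)) * (\<Prod>p=j..<P. exp (- (s p)\<^sup>2 / 2)))"
  using j
proof (induction j arbitrary: s)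
  case 0
  have "(CLINT x|M. indicator {x\<in>space M. \<forall>p<0. f p x \<in> A p} x *\<^sub>R iexp (\<Sum>p=0..<P. s p * f p x))
     = (CLINT x|M. iexp (\<Sum>p=0..<P. s p * f p x))"
    by (intro Bochner_Integration.integral_cong) auto
  thus ?case using ch[of s] by (simp add: atLeast0LessThan)
next
  case (Suc j)
  let ?G = "measure std_normal_distribution"
  define E where "E = {x\<in>space M. \<forall>p<j. f p x \<in> A p}"
  define w where "w x = (\<Sum>p=Suc j..<P. s p * f p x)" for x
  define c where "c = (\<Prod>p=Suc j..<P. exp (- (s p)\<^sup>2 / 2))"
  define g where "g = (\<Prod>p<j. ?G (A p))"
  have jP: "j < P" using Suc.prems by simp
  have E: "E \<in> sets M"
  proof -
    have "E = {x\<in>space M. \<forall>p\<in>{..<j}. x \<in> f p -` A p \<inter> space M}" by (auto simp: E_def)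
    also have "\<dots> \<in> sets M"
    proof (rule sets.sets_Collect_finite_All)
      fix p assume "p \<in> {..<j}"
      hence "f p -` A p \<inter> space M \<in> sets M" using f[of p] A[of p] jP by (intro measurable_sets[of "f p"]) auto
      thus "{x\<in>space M. x \<in> f p -` A p \<inter> space M} \<in> sets M" by (simp add: Collect_conj_eq[symmetric] vimage_def Int_def conj_commute cong: conj_cong)
    qed simp
    finally show ?thesis .
  qed
  have w [measurable]: "w \<in> borel_measurable M" unfolding w_def using f by (intro borel_measurable_sum borel_measurable_times) auto
  have fj [measurable]: "f j \<in> borel_measurable M" using f jP by simp
  note E [measurable]
  have base: "(CLINT x|M. indicator E x *\<^sub>R iexp (r * f j x + b * w x)) =
      complex_of_real (g * (exp (- r\<^sup>2 / 2) * (if b = 0 then 1 else c)))" if "b \<in> {0, 1, -1}" for r b :: real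
  proof -
    \<comment> \<open>The induction hypothesis at modified arguments: the later phases enter with factor \<open>1\<close>, \<open>-1\<close> or \<open>0\<close>.\<close>
    define s' where "s' p = (if p = j then r else b * s p)" for p
    have "(\<Sum>p=j..<P. s' p * f p x) = r * f j x + b * w x" for x
      using jP by (simp add: sum.atLeast_Suc_lessThan s'_def w_def sum_distrib_left mult.assoc)
    moreover have "(\<Prod>p=j..<P. exp (- (s' p)\<^sup>2 / 2)) = exp (- r\<^sup>2 / 2) * (if b = 0 then 1 else c)"
      using jP that by (auto simp: prod.atLeast_Suc_lessThan s'_def c_def power_mult_distrib)
    ultimately show ?thesis using Suc.IH[of s'] jP by (simp add: E_def g_def)
  qed
  have intb: "integrable M (\<lambda>x. indicator E x *\<^sub>R iexp (r * f j x + b * w x))" for r b :: real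
    by (rule integrable_const_bound[where B = 1]) (auto simp: indicator_def)
  let ?V = "f j -` A j \<inter> space M"
  have V: "?V \<in> sets M" using fj A[OF jP] by (rule measurable_sets)
  note V [measurable]
  have key: "(\<integral>x. indicator ?V x * (indicator E x * (1 + h (w x))) \<partial>M) = g * (1 + k) * ?G (A j)"
    if h: "h \<in> borel_measurable borel" "\<And>u. \<bar>h u\<bar> \<le> 1"
      and hk: "\<And>r. (CLINT x|M. indicator E x *\<^sub>R (iexp (r * f j x) * of_real (h (w x)))) = complex_of_real (g * exp (- r\<^sup>2 / 2) * k)"
    for h :: "real \<Rightarrow> real" and k
  proof -
    note h(1) [measurable]
    define W where "W x = indicator E x * (1 + h (w x))" for x
    have W0: "0 \<le> W x" for x using h(2)[of "w x"] by (auto simp: W_def indicator_def)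
    have W2: "W x \<le> 2" for x using h(2)[of "w x"] by (auto simp: W_def indicator_def)
    have Wm [measurable]: "W \<in> borel_measurable M" unfolding W_def by measurable
    have Wi: "integrable M W" using W0 W2 by (intro integrable_const_bound[where B = 2]) auto
    define N where "N = density M (\<lambda>x. ennreal (W x))"
    have fin: "finite_measure N" unfolding N_def using Wi W0
      by (intro finite_measureI) (simp add: emeasure_density nn_integral_eq_integral cong: nn_integral_cong_simp)
    have "measure N (f j -` A j \<inter> space N) = (g * (1 + k)) * ?G (A j)"
    proof (rule char_std_normal_determines[OF fin])
      show "f j \<in> borel_measurable N" by (simp add: N_def)
      fix r :: real
      have "(CLINT x|N. iexp (r * f j x)) = (CLINT x|M. W x *\<^sub>R iexp (r * f j x))"
        unfolding N_def using W0 by (subst integral_density) auto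
      also have "\<dots> = (CLINT x|M. indicator E x *\<^sub>R iexp (r * f j x + 0 * w x) + indicator E x *\<^sub>R (iexp (r * f j x) * of_real (h (w x))))"
        by (intro Bochner_Integration.integral_cong) (auto simp: W_def indicator_def scaleR_conv_of_real algebra_simps)
      also have "\<dots> = (CLINT x|M. indicator E x *\<^sub>R iexp (r * f j x + 0 * w x)) + (CLINT x|M. indicator E x *\<^sub>R (iexp (r * f j x) * of_real (h (w x))))"
        using h(2) by (intro Bochner_Integration.integral_add intb integrable_const_bound[where B = 1])
          (auto simp: indicator_def norm_mult)
      also have "\<dots> = complex_of_real (g * (1 + k) * exp (- r\<^sup>2 / 2))"
        unfolding base[of 0, simplified] hk using base[of 0 r] hk[of r] by (simp add: algebra_simps)
      finally show "(CLINT x|N. iexp (r * f j x)) = complex_of_real (g * (1 + k) * exp (- r\<^sup>2 / 2))" .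
    qed (use A jP in auto)
    also have "measure N (f j -` A j \<inter> space N) = (\<integral>x. indicator ?V x * W x \<partial>M)"
    proof -
      have "emeasure N ?V = (\<integral>\<^sup>+x. ennreal (indicator ?V x * W x) \<partial>M)"
        using V unfolding N_def
        by (subst emeasure_density) (auto simp: indicator_def intro!: nn_integral_cong)
      also have "\<dots> = ennreal (\<integral>x. indicator ?V x * W x \<partial>M)"
      proof (intro nn_integral_eq_integral integrable_const_bound[where B = 2])
        show "AE x in M. norm (indicator ?V x * W x) \<le> 2" using W0 W2 by (auto simp: indicator_def)
        show "AE x in M. 0 \<le> indicator ?V x * W x" using W0 by auto
      qed measurable
      finally show ?thesis using W0 by (simp add: measure_def N_def integral_nonneg)
    qed
    finally show ?thesis by (simp add: W_def)
  qed
  have cos_exp: "iexp u * of_real (cos v) = (iexp (u + 1 * v) + iexp (u + (-1) * v)) / 2" for u v :: real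
    by (simp add: complex_eq_iff Re_exp Im_exp cos_add sin_add cos_diff sin_diff)
  have sin_exp: "iexp u * of_real (sin v) = (iexp (u + 1 * v) - iexp (u + (-1) * v)) / (2 * \<i>)" for u v :: real
    by (subst nonzero_eq_divide_eq)
      (simp_all add: complex_eq_iff Re_exp Im_exp cos_add sin_add cos_diff sin_diff)
  have cos: "(CLINT x|M. indicator E x *\<^sub>R (iexp (r * f j x) * of_real (cos (w x)))) = complex_of_real (g * exp (- r\<^sup>2 / 2) * c)" for r
  proof -
    have "(CLINT x|M. indicator E x *\<^sub>R (iexp (r * f j x) * of_real (cos (w x))))
       = (CLINT x|M. (indicator E x *\<^sub>R iexp (r * f j x + 1 * w x) + indicator E x *\<^sub>R iexp (r * f j x + (-1) * w x)) / 2)"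
      unfolding cos_exp by (intro Bochner_Integration.integral_cong refl) (auto simp: indicator_def)
    also have "\<dots> = complex_of_real (g * exp (- r\<^sup>2 / 2) * c)"
      using base[of 1 r] base[of "-1" r] by (subst integral_divide_zero, subst Bochner_Integration.integral_add[OF intb intb]) simp
    finally show ?thesis .
  qed
  have sin: "(CLINT x|M. indicator E x *\<^sub>R (iexp (r * f j x) * of_real (sin (w x)))) = complex_of_real (g * exp (- r\<^sup>2 / 2) * 0)" for r
  proof -
    have "(CLINT x|M. indicator E x *\<^sub>R (iexp (r * f j x) * of_real (sin (w x))))
       = (CLINT x|M. (indicator E x *\<^sub>R iexp (r * f j x + 1 * w x) - indicator E x *\<^sub>R iexp (r * f j x + (-1) * w x)) / (2 * \<i>))"
      unfolding sin_exp by (intro Bochner_Integration.integral_cong refl) (auto simp: indicator_def)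
    also have "\<dots> = complex_of_real (g * exp (- r\<^sup>2 / 2) * 0)"
      using base[of 1 r] base[of "-1" r] by (subst integral_divide_zero, subst Bochner_Integration.integral_diff[OF intb intb]) simp
    finally show ?thesis .
  qed
  have int1: "integrable M (\<lambda>x. indicator ?V x * (indicator E x * h (w x)))"
    if "h \<in> borel_measurable borel" "\<And>u. \<bar>h u\<bar> \<le> 2" for h :: "real \<Rightarrow> real"
  proof (rule integrable_const_bound[where B = 2])
    note that(1) [measurable]
    show "(\<lambda>x. indicator ?V x * (indicator E x * h (w x))) \<in> borel_measurable M" by measurable
    show "AE x in M. norm (indicator ?V x * (indicator E x * h (w x))) \<le> 2" using that(2) by (auto simp: indicator_def)
  qed
  have diff: "(\<integral>x. indicator ?V x * (indicator E x * h (w x)) \<partial>M) = g * k * ?G (A j)"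
    if h: "h \<in> borel_measurable borel" "\<And>u. \<bar>h u\<bar> \<le> 1"
      and hk: "\<And>r. (CLINT x|M. indicator E x *\<^sub>R (iexp (r * f j x) * of_real (h (w x)))) = complex_of_real (g * exp (- r\<^sup>2 / 2) * k)"
    for h :: "real \<Rightarrow> real" and k
  proof -
    have 2: "\<bar>1 + h u\<bar> \<le> 2" for u using h(2)[of u] by linarith
    have "(\<integral>x. indicator ?V x * (indicator E x * h (w x)) \<partial>M)
      = (\<integral>x. indicator ?V x * (indicator E x * (1 + h (w x))) - indicator ?V x * (indicator E x * (1 + 0)) \<partial>M)"
      by (intro Bochner_Integration.integral_cong) (auto simp: algebra_simps)
    also have "\<dots> = (\<integral>x. indicator ?V x * (indicator E x * (1 + h (w x))) \<partial>M)
        - (\<integral>x. indicator ?V x * (indicator E x * (1 + 0)) \<partial>M)"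
      by (rule Bochner_Integration.integral_diff[OF int1[of "\<lambda>u. 1 + h u"] int1[of "\<lambda>_. 1 + 0"]]) (use h(1) 2 in auto)
    also have "\<dots> = g * (1 + k) * ?G (A j) - g * (1 + 0) * ?G (A j)"
      by (rule arg_cong2[where f = "(-)", OF key[OF h hk] key[of "\<lambda>_. 0" 0]]) simp_all
    finally show ?thesis by (simp add: algebra_simps)
  qed
  have c': "(\<integral>x. indicator ?V x * (indicator E x * cos (w x)) \<partial>M) = g * c * ?G (A j)"
    by (rule diff[OF _ _ cos]) auto
  have s': "(\<integral>x. indicator ?V x * (indicator E x * sin (w x)) \<partial>M) = g * 0 * ?G (A j)"
    by (rule diff[OF _ _ sin]) auto
  have "(CLINT x|M. indicator {x\<in>space M. \<forall>p<Suc j. f p x \<in> A p} x *\<^sub>R iexp (w x))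
     = (CLINT x|M. of_real (indicator ?V x * (indicator E x * cos (w x))) + \<i> * of_real (indicator ?V x * (indicator E x * sin (w x))))"
    by (intro Bochner_Integration.integral_cong refl)
      (auto simp: indicator_def E_def less_Suc_eq complex_eq_iff Re_exp Im_exp)
  also have "\<dots> = of_real (\<integral>x. indicator ?V x * (indicator E x * cos (w x)) \<partial>M)
      + \<i> * of_real (\<integral>x. indicator ?V x * (indicator E x * sin (w x)) \<partial>M)"
  proof -
    have ic: "integrable M (\<lambda>x. indicator ?V x * (indicator E x * cos (w x)))"
      by (rule int1) (auto intro: order_trans[OF abs_cos_le_one])
    have isn: "integrable M (\<lambda>x. indicator ?V x * (indicator E x * sin (w x)))"
      by (rule int1) (auto intro: order_trans[OF abs_sin_le_one])
    show ?thesis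
      by (subst Bochner_Integration.integral_add[OF integrable_of_real[OF ic]
            integrable_mult_right[OF integrable_of_real[OF isn]]])
         (simp only: integral_mult_right_zero integral_complex_of_real)
  qed
  also have "\<dots> = complex_of_real ((\<Prod>p<Suc j. ?G (A p)) * c)"
    unfolding c' s' by (simp add: g_def mult_ac)
  finally show ?case by (simp add: w_def c_def)
qed

section \<open>Gaussian noise and its orthonormal scores\<close>

text \<open>
  Everything about the noise is reduced to the standard normal law by scaling.
\<close>

lemma normal_eq_distr_std_normal:
  assumes "0 < \<sigma>"
  shows "density lborel (normal_density 0 \<sigma>) = distr std_normal_distribution borel (\<lambda>x. \<sigma> * x)"
proof -
  interpret N: prob_space std_normal_distribution by (rule std_normal_prob)
  have "distributed std_normal_distribution lborel (\<lambda>x. x) std_normal_density"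
    by (simp add: distributed_def distr_id2)
  hence "distributed std_normal_distribution lborel (\<lambda>x. 0 + \<sigma> * x) (normal_density (0 + \<sigma> * 0) (\<bar>\<sigma>\<bar> * 1))"
    using assms by (intro N.normal_density_affine) auto
  hence "distr std_normal_distribution lborel (\<lambda>x. \<sigma> * x) = density lborel (normal_density 0 \<sigma>)"
    using assms by (simp add: distributed_def)
  moreover have "distr std_normal_distribution lborel (\<lambda>x. \<sigma> * x) = distr std_normal_distribution borel (\<lambda>x. \<sigma> * x)"
    by (intro distr_cong) auto
  ultimately show ?thesis by simp
qed

lemma char_normal:
  assumes "0 < \<sigma>"
  shows "(CLINT x|density lborel (normal_density 0 \<sigma>). iexp (c * x)) = complex_of_real (exp (- (\<sigma> * c)\<^sup>2 / 2))"
proof -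
  have "(CLINT x|density lborel (normal_density 0 \<sigma>). iexp (c * x)) = (CLINT x|std_normal_distribution. iexp (c * (\<sigma> * x)))"
    unfolding normal_eq_distr_std_normal[OF assms] by (subst integral_distr) auto
  also have "\<dots> = char std_normal_distribution (c * \<sigma>)" by (simp add: char_def mult.assoc)
  finally show ?thesis by (simp add: char_std_normal_distribution mult.commute)
qed

lemma noise_prob_space: "0 < \<sigma> \<Longrightarrow> prob_space (noise_law n \<sigma>)"
  unfolding noise_law_def by (intro prob_space_PiM prob_space_normal_density)

lemma sets_noise [measurable_cong]: "sets (noise_law n \<sigma>) = sets (\<Pi>\<^sub>M i\<in>{..<n}. borel)"
  unfolding noise_law_def by (intro sets_PiM_cong) auto

lemma space_noise: "space (noise_law n \<sigma>) = {..<n} \<rightarrow>\<^sub>E UNIV"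
  by (simp add: noise_law_def space_PiM)

lemma measurable_noise_component [measurable]:
  "l < n \<Longrightarrow> (\<lambda>u. u l) \<in> borel_measurable (noise_law n \<sigma>)"
  unfolding measurable_cong_sets[OF sets_noise refl] by (rule measurable_component_singleton) simp

lemma char_noise:
  assumes "0 < \<sigma>"
  shows "(CLINT u|noise_law n \<sigma>. iexp (\<Sum>l<n. c l * u l)) = complex_of_real (exp (- (\<Sum>l<n. (\<sigma> * c l)\<^sup>2) / 2))"
proof -
  interpret N: prob_space "density lborel (normal_density 0 \<sigma>)" by (rule prob_space_normal_density[OF assms])
  interpret F: product_sigma_finite "\<lambda>_::nat. density lborel (normal_density 0 \<sigma>)"
    by (simp add: product_sigma_finite_def N.sigma_finite_measure)
  have "(CLINT u|noise_law n \<sigma>. iexp (\<Sum>l<n. c l * u l)) = (CLINT u|noise_law n \<sigma>. (\<Prod>l<n. iexp (c l * u l)))"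
    by (simp add: sum_distrib_left exp_sum)
  also have "\<dots> = (\<Prod>l<n. (CLINT x|density lborel (normal_density 0 \<sigma>). iexp (c l * x)))"
    unfolding noise_law_def
    by (rule F.product_integral_prod) (auto intro!: N.integrable_const_bound[where B = 1])
  also have "\<dots> = complex_of_real (\<Prod>l<n. exp (- (\<sigma> * c l)\<^sup>2 / 2))"
    unfolding char_normal[OF assms] by simp
  also have "(\<Prod>l<n. exp (- (\<sigma> * c l)\<^sup>2 / 2)) = exp (\<Sum>l<n. - (\<sigma> * c l)\<^sup>2 / 2)"
    by (simp add: exp_sum)
  also have "(\<Sum>l<n. - (\<sigma> * c l)\<^sup>2 / 2) = - (\<Sum>l<n. (\<sigma> * c l)\<^sup>2) / 2"
    by (simp add: sum_negf sum_divide_distrib)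
  finally show ?thesis .
qed

text \<open>
  The limit experiment: one standard normal coordinate for each regressor.
\<close>

abbreviation gauss :: "nat \<Rightarrow> (nat \<Rightarrow> real) measure" where
  "gauss P \<equiv> (\<Pi>\<^sub>M r\<in>{..<P}. std_normal_distribution)"

lemma sum_squares_orthonormal:
  fixes v :: "nat \<Rightarrow> nat \<Rightarrow> real"
  assumes v: "\<And>r s. r < P \<Longrightarrow> s < P \<Longrightarrow> (\<Sum>l<n. v r l * v s l) = of_bool (r = s)"
  shows "(\<Sum>l<n. (\<Sum>r<P. v r l * w r)\<^sup>2) = (\<Sum>r<P. (w r)\<^sup>2)"
proof -
  have "(\<Sum>l<n. (\<Sum>r<P. v r l * w r)\<^sup>2) = (\<Sum>l<n. \<Sum>r<P. \<Sum>s<P. w r * w s * (v r l * v s l))"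
    by (simp add: power2_eq_square sum_product mult_ac)
  also have "\<dots> = (\<Sum>r<P. \<Sum>l<n. \<Sum>s<P. w r * w s * (v r l * v s l))" by (rule sum.swap)
  also have "\<dots> = (\<Sum>r<P. \<Sum>s<P. \<Sum>l<n. w r * w s * (v r l * v s l))" by (intro sum.cong refl sum.swap)
  also have "\<dots> = (\<Sum>r<P. \<Sum>s<P. of_bool (r = s) * (w r * w s))"
    by (intro sum.cong refl) (simp add: v mult.commute flip: sum_distrib_left)
  also have "\<dots> = (\<Sum>r<P. (w r)\<^sup>2)"
    by (intro sum.cong refl) (simp add: of_bool_def if_distrib[of "\<lambda>x. x * _"] power2_eq_square cong: if_cong)
  finally show ?thesis .
qed

text \<open>
  The joint law of the scores depends neither on the sample size nor on the
  directions: for orthonormal directions the quadratic form in the joint characteristic function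
  is the identity.
\<close>

theorem orthonormal_scores_distr:
  fixes v :: "nat \<Rightarrow> nat \<Rightarrow> real"
  assumes \<sigma>: "0 < \<sigma>"
    and v: "\<And>r s. r < P \<Longrightarrow> s < P \<Longrightarrow> (\<Sum>l<n. v r l * v s l) = of_bool (r = s)"
  shows "distr (noise_law n \<sigma>) (gauss P) (\<lambda>u. \<lambda>r\<in>{..<P}. (\<Sum>l<n. v r l * u l) / \<sigma>) = gauss P"
proof -
  let ?M = "noise_law n \<sigma>" and ?f = "\<lambda>r u. (\<Sum>l<n. v r l * u l) / \<sigma>"
  interpret M: prob_space ?M by (rule noise_prob_space[OF \<sigma>])
  interpret N: prob_space std_normal_distribution by (rule std_normal_prob)
  interpret F: product_sigma_finite "\<lambda>_::nat. std_normal_distribution"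
    by (simp add: product_sigma_finite_def N.sigma_finite_measure)
  have f [measurable]: "?f r \<in> borel_measurable ?M" for r by measurable
  have ch: "(CLINT u|?M. iexp (\<Sum>r<P. s r * ?f r u)) = complex_of_real (\<Prod>r<P. exp (- (s r)\<^sup>2 / 2))" for s
  proof -
    \<comment> \<open>The coefficients of a linear combination of the scores in terms of the noise.\<close>
    define c where "c l = (\<Sum>r<P. s r * v r l) / \<sigma>" for l
    have 1: "(\<Sum>r<P. s r * ?f r u) = (\<Sum>l<n. c l * u l)" for u
    proof -
      have "(\<Sum>r<P. s r * ?f r u) = (\<Sum>r<P. \<Sum>l<n. s r * v r l / \<sigma> * u l)"
        by (simp add: sum_distrib_left sum_divide_distrib mult_ac)
      also have "\<dots> = (\<Sum>l<n. \<Sum>r<P. s r * v r l / \<sigma> * u l)" by (rule sum.swap)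
      finally show ?thesis by (simp add: c_def sum_distrib_right sum_divide_distrib)
    qed
    have 2: "(\<Sum>l<n. (\<sigma> * c l)\<^sup>2) = (\<Sum>r<P. (s r)\<^sup>2)"
    proof -
      have "(\<Sum>l<n. (\<sigma> * c l)\<^sup>2) = (\<Sum>l<n. (\<Sum>r<P. v r l * s r)\<^sup>2)"
        using \<sigma> by (simp add: c_def mult.commute)
      also have "\<dots> = (\<Sum>r<P. (s r)\<^sup>2)" by (rule sum_squares_orthonormal[OF v])
      finally show ?thesis .
    qed
    show ?thesis unfolding 1 char_noise[OF \<sigma>] 2
      by (simp add: exp_sum[symmetric] sum_negf sum_divide_distrib)
  qed
  show ?thesis
  proof (rule F.PiM_eqI)
    fix A assume A': "\<And>r. r \<in> {..<P} \<Longrightarrow> A r \<in> sets std_normal_distribution"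
    have A: "A r \<in> sets borel" if "r < P" for r using A'[of r] that by simp
    define E where "E = {u\<in>space ?M. \<forall>r<P. ?f r u \<in> A r}"
    have E: "(\<lambda>u. \<lambda>r\<in>{..<P}. ?f r u) -` (\<Pi>\<^sub>E r\<in>{..<P}. A r) \<inter> space ?M = E"
      unfolding E_def by (rule Set.set_eqI) (simp add: PiE_iff conj_commute Ball_def)
    have ms: "(\<lambda>u. \<lambda>r\<in>{..<P}. ?f r u) \<in> ?M \<rightarrow>\<^sub>M gauss P"
      by (intro measurable_restrict) simp
    have AP: "(\<Pi>\<^sub>E r\<in>{..<P}. A r) \<in> sets (gauss P)" using A by (intro sets_PiM_I_finite) auto
    have Em: "E \<in> sets ?M" unfolding E[symmetric] by (rule measurable_sets[OF ms AP])
    have "complex_of_real (measure ?M E) = (CLINT u|?M. complex_of_real (indicator E u))"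
      unfolding integral_complex_of_real using Em sets.Int_space_eq2[OF Em] by simp
    also have "\<dots> = (CLINT u|?M. indicator E u *\<^sub>R iexp (\<Sum>r=P..<P. (\<lambda>_. 0) r * ?f r u))"
      by (intro Bochner_Integration.integral_cong refl) (simp add: scaleR_conv_of_real)
    also have "\<dots> = complex_of_real ((\<Prod>r<P. measure std_normal_distribution (A r)) * (\<Prod>r=P..<P. exp (- ((\<lambda>_. 0) r)\<^sup>2 / 2)))"
      unfolding E_def by (rule M.joint_char_std_normal_step[OF f ch A order_refl])
    finally have m: "measure ?M E = (\<Prod>r<P. measure std_normal_distribution (A r))"
      unfolding of_real_eq_iff by simp
    show "emeasure (distr ?M (gauss P) (\<lambda>u. \<lambda>r\<in>{..<P}. ?f r u)) (\<Pi>\<^sub>E r\<in>{..<P}. A r)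
       = (\<Prod>r\<in>{..<P}. emeasure std_normal_distribution (A r))"
      unfolding emeasure_distr[OF ms AP] E N.emeasure_eq_measure M.emeasure_eq_measure m
      by (simp add: prod_ennreal)
  qed simp_all
qed

lemma noise_linear_distr:
  assumes \<sigma>: "0 < \<sigma>" and v: "(\<Sum>l<n. (v l)\<^sup>2) = 1"
  shows "distr (noise_law n \<sigma>) borel (\<lambda>u. (\<Sum>l<n. v l * u l) / \<sigma>) = std_normal_distribution"
proof -
  interpret N: prob_space std_normal_distribution by (rule std_normal_prob)
  interpret F: product_prob_space "\<lambda>_::nat. std_normal_distribution" "{..<1::nat}"
    by (simp add: product_prob_space_def product_prob_space_axioms_def product_sigma_finite_def N.sigma_finite_measure N.prob_space_axioms)
  have "std_normal_distribution = distr (gauss 1) std_normal_distribution (\<lambda>z. z 0)"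
    using F.PiM_component[of 0] by simp
  also have "\<dots> = distr (distr (noise_law n \<sigma>) (gauss 1) (\<lambda>u. \<lambda>r\<in>{..<1}. (\<Sum>l<n. v l * u l) / \<sigma>)) std_normal_distribution (\<lambda>z. z 0)"
    using v by (subst orthonormal_scores_distr[OF \<sigma>, where P = 1 and n = n and v = "\<lambda>_. v"]) (auto simp: power2_eq_square)
  also have "\<dots> = distr (noise_law n \<sigma>) borel (\<lambda>u. (\<Sum>l<n. v l * u l) / \<sigma>)"
  proof (subst distr_distr)
    show "(\<lambda>z. z 0) \<in> gauss 1 \<rightarrow>\<^sub>M std_normal_distribution"
      by (rule measurable_component_singleton) simp
    show "(\<lambda>u. \<lambda>r\<in>{..<1}. (\<Sum>l<n. v l * u l) / \<sigma>) \<in> noise_law n \<sigma> \<rightarrow>\<^sub>M gauss 1"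
      by (intro measurable_restrict) simp
  qed (auto simp: o_def intro!: distr_cong)
  finally show ?thesis by simp
qed

lemma gauss_eq_noise: "gauss P = noise_law P 1"
  by (simp add: noise_law_def)

lemma gauss_prob_space: "prob_space (gauss P)"
  unfolding gauss_eq_noise by (rule noise_prob_space) simp

lemma sets_gauss [measurable_cong]: "sets (gauss P) = sets (\<Pi>\<^sub>M i\<in>{..<P}. borel)"
  unfolding gauss_eq_noise by (rule sets_noise)

lemma space_gauss: "space (gauss P) = {..<P} \<rightarrow>\<^sub>E UNIV"
  unfolding gauss_eq_noise by (rule space_noise)

lemma measurable_gauss_component [measurable]: "r < P \<Longrightarrow> (\<lambda>z. z r) \<in> borel_measurable (gauss P)"
  unfolding gauss_eq_noise by (rule measurable_noise_component)

text \<open>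
  A nontrivial linear function of the coordinates is a multiple of a standard normal variable, which
  has no atoms.
\<close>

lemma gauss_hyperplane_null:
  assumes r: "r < P" "b r \<noteq> 0"
  shows "AE z in gauss P. (\<Sum>r<P. b r * z r) \<noteq> \<tau>"
proof -
  interpret prob_space "gauss P" by (rule gauss_prob_space)
  define s where "s = sqrt (\<Sum>r<P. (b r)\<^sup>2)"
  have "0 < (\<Sum>r<P. (b r)\<^sup>2)" using r by (intro sum_pos2[of _ r]) auto
  hence s: "0 < s" "s\<^sup>2 = (\<Sum>r<P. (b r)\<^sup>2)" by (auto simp: s_def)
  define f where "f z = (\<Sum>r<P. b r / s * z r) / 1" for z
  have d: "distr (gauss P) borel f = std_normal_distribution"
    unfolding gauss_eq_noise f_def using s
    by (intro noise_linear_distr) (auto simp: power_divide simp flip: sum_divide_distrib)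
  have fm [measurable]: "f \<in> borel_measurable (gauss P)" unfolding f_def by measurable
  have "AE x in std_normal_distribution. x \<noteq> \<tau> / s"
    by (subst AE_density) (auto intro!: AE_lborel_singleton[THEN eventually_mono])
  hence "AE x in distr (gauss P) borel f. x \<noteq> \<tau> / s" unfolding d .
  hence "AE z in gauss P. f z \<noteq> \<tau> / s" by (subst (asm) AE_distr_iff) auto
  thus ?thesis using s by (auto simp: f_def sum_divide_distrib[symmetric] elim!: eventually_mono)
qed

lemma gauss_component_prob:
  assumes "r < P" "A \<in> sets borel"
  shows "\<P>(z in gauss P. z r \<in> A) = measure std_normal_distribution A"
proof -
  have "std_normal_distribution = distr (gauss P) std_normal_distribution (\<lambda>z. z r)"
    using assms by (intro distr_PiM_component[symmetric]) (auto intro: prob_space_normal_density)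
  hence "measure std_normal_distribution A = measure (distr (gauss P) std_normal_distribution (\<lambda>z. z r)) A" by simp
  also have "\<dots> = \<P>(z in gauss P. z r \<in> A)"
    using assms by (subst measure_distr) (auto simp: vimage_def Int_def conj_commute)
  finally show ?thesis by simp
qed

lemma gauss_box_prob:
  assumes A: "\<And>r. r < P \<Longrightarrow> A r \<in> sets borel"
  shows "\<P>(z in gauss P. \<forall>r<P. z r \<in> A r) = (\<Prod>r<P. measure std_normal_distribution (A r))"
proof -
  interpret N: prob_space std_normal_distribution by (rule std_normal_prob)
  interpret F: product_sigma_finite "\<lambda>_::nat. std_normal_distribution"
    by (simp add: product_sigma_finite_def N.sigma_finite_measure)
  have "{z\<in>space (gauss P). \<forall>r<P. z r \<in> A r} = (\<Pi>\<^sub>E r\<in>{..<P}. A r)"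
    by (rule Set.set_eqI) (simp add: space_gauss PiE_iff conj_commute Ball_def)
  moreover have "emeasure (gauss P) (\<Pi>\<^sub>E r\<in>{..<P}. A r) = (\<Prod>r<P. emeasure std_normal_distribution (A r))"
    using A by (intro F.emeasure_PiM) auto
  ultimately show ?thesis unfolding N.emeasure_eq_measure
    by (simp add: measure_def prod_ennreal prod_nonneg)
qed

text \<open>
  Independence of blocks of coordinates, phrased for events through invariance: an
  event belongs to the block \<open>J\<close> if changing the coordinates outside \<open>J\<close> does not affect it.
\<close>

lemma gauss_independent:
  assumes JK: "J \<subseteq> {..<P}" "K \<subseteq> {..<P}" "J \<inter> K = {}"
    and A: "A \<in> sets (gauss P)" and B: "B \<in> sets (gauss P)"
    and AJ: "\<And>z w. z \<in> space (gauss P) \<Longrightarrow> w \<in> space (gauss P) \<Longrightarrow> (\<And>j. j \<in> J \<Longrightarrow> z j = w j) \<Longrightarrow> z \<in> A \<Longrightarrow> w \<in> A"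
    and BK: "\<And>z w. z \<in> space (gauss P) \<Longrightarrow> w \<in> space (gauss P) \<Longrightarrow> (\<And>j. j \<in> K \<Longrightarrow> z j = w j) \<Longrightarrow> z \<in> B \<Longrightarrow> w \<in> B"
  shows "measure (gauss P) (A \<inter> B) = measure (gauss P) A * measure (gauss P) B"
proof (cases "P = 0")
  case True
  have sp: "space (gauss P) = {\<lambda>_. undefined}" using True by (simp add: space_PiM)
  have "A = {} \<or> A = space (gauss P)" "B = {} \<or> B = space (gauss P)"
    using sets.sets_into_space[OF A] sets.sets_into_space[OF B] sp by auto
  thus ?thesis using prob_space.prob_space[OF gauss_prob_space, of P] by auto
next
  case False
  interpret prob_space "gauss P" by (rule gauss_prob_space)
  let ?N = "\<lambda>_::nat. std_normal_distribution"
  have "indep_vars ?N (\<lambda>r z. z r) {..<P}"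
  proof (subst indep_vars_iff_distr_eq_PiM')
    have "distr (gauss P) (gauss P) (\<lambda>z. \<lambda>i\<in>{..<P}. z i) = distr (gauss P) (gauss P) (\<lambda>z. z)"
      by (intro distr_cong) (auto simp: space_gauss)
    also have "\<dots> = (\<Pi>\<^sub>M i\<in>{..<P}. distr (gauss P) std_normal_distribution (\<lambda>z. z i))"
      unfolding distr_id
      by (intro PiM_cong refl distr_PiM_component[symmetric]) (auto intro: prob_space_normal_density)
    finally show "distr (gauss P) (gauss P) (\<lambda>z. \<lambda>i\<in>{..<P}. z i) =
      (\<Pi>\<^sub>M i\<in>{..<P}. distr (gauss P) std_normal_distribution (\<lambda>z. z i))" .
  qed (use False in auto)
  hence "indep_vars (\<lambda>b. PiM (case_bool J K b) ?N) (\<lambda>b z. \<lambda>i\<in>case_bool J K b. z i) (UNIV :: bool set)"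
    using JK by (intro indep_vars_restrict) (auto simp: disjoint_family_on_def split: bool.splits)
  note ind = this
  \<comment> \<open>Filling in zeros recovers a point of the full space from a block; by invariance the event does not notice.\<close>
  define ext where "ext L w = (\<lambda>i\<in>{..<P}. if i \<in> L then w i else 0)" for L and w :: "nat \<Rightarrow> real"
  have ext: "ext L \<in> PiM L ?N \<rightarrow>\<^sub>M gauss P" if "L \<subseteq> {..<P}" for L
    unfolding ext_def
  proof (rule measurable_restrict)
    fix i assume "i \<in> {..<P}"
    show "(\<lambda>w. if i \<in> L then w i else 0) \<in> PiM L ?N \<rightarrow>\<^sub>M std_normal_distribution"
      using measurable_component_singleton[of i L ?N] by (cases "i \<in> L") simp_all
  qed
  define C where "C b = ext (case_bool J K b) -` (case_bool A B b) \<inter> space (PiM (case_bool J K b) ?N)" for b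
  have C: "C b \<in> sets (PiM (case_bool J K b) ?N)" for b
    unfolding C_def using JK A B by (intro measurable_sets[OF ext]) (auto split: bool.splits)
  have extsp: "ext L (restrict z L) \<in> space (gauss P)" for L z by (simp add: ext_def space_gauss)
  have eqA: "(\<lambda>z. \<lambda>i\<in>J. z i) -` C True \<inter> space (gauss P) = A"
  proof (intro Set.set_eqI iffI)
    fix z assume "z \<in> (\<lambda>z. \<lambda>i\<in>J. z i) -` C True \<inter> space (gauss P)"
    hence z: "ext J (restrict z J) \<in> A" "z \<in> space (gauss P)" by (auto simp: C_def)
    show "z \<in> A" by (rule AJ[OF extsp z(2) _ z(1)]) (use JK in \<open>auto simp: ext_def\<close>)
  next
    fix z assume zA: "z \<in> A"
    hence z: "z \<in> space (gauss P)" using sets.sets_into_space[OF A] by auto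
    have "ext J (restrict z J) \<in> A" by (rule AJ[OF z extsp _ zA]) (use JK in \<open>auto simp: ext_def\<close>)
    thus "z \<in> (\<lambda>z. \<lambda>i\<in>J. z i) -` C True \<inter> space (gauss P)" using z by (auto simp: C_def space_PiM)
  qed
  have eqB: "(\<lambda>z. \<lambda>i\<in>K. z i) -` C False \<inter> space (gauss P) = B"
  proof (intro Set.set_eqI iffI)
    fix z assume "z \<in> (\<lambda>z. \<lambda>i\<in>K. z i) -` C False \<inter> space (gauss P)"
    hence z: "ext K (restrict z K) \<in> B" "z \<in> space (gauss P)" by (auto simp: C_def)
    show "z \<in> B" by (rule BK[OF extsp z(2) _ z(1)]) (use JK in \<open>auto simp: ext_def\<close>)
  next
    fix z assume zB: "z \<in> B"
    hence z: "z \<in> space (gauss P)" using sets.sets_into_space[OF B] by auto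
    have "ext K (restrict z K) \<in> B" by (rule BK[OF z extsp _ zB]) (use JK in \<open>auto simp: ext_def\<close>)
    thus "z \<in> (\<lambda>z. \<lambda>i\<in>K. z i) -` C False \<inter> space (gauss P)" using z by (auto simp: C_def space_PiM)
  qed
  have "prob (\<Inter>b\<in>UNIV. (\<lambda>z. \<lambda>i\<in>case_bool J K b. z i) -` C b \<inter> space (gauss P))
      = (\<Prod>b\<in>UNIV. prob ((\<lambda>z. \<lambda>i\<in>case_bool J K b. z i) -` C b \<inter> space (gauss P)))"
    using indep_varsD[OF ind, of UNIV C] C by simp
  thus ?thesis by (simp add: UNIV_bool eqA eqB Int_commute mult.commute)
qed

section \<open>Probabilities in the limit experiment\<close>

lemma std_normal_interval_pos:
  assumes "a < b"
  shows "0 < measure std_normal_distribution {a<..<b}"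
proof (rule ccontr)
  interpret N: prob_space std_normal_distribution by (rule std_normal_prob)
  assume "\<not> ?thesis"
  hence "emeasure std_normal_distribution {a<..<b} = 0"
    by (simp add: N.emeasure_eq_measure zero_less_measure_iff)
  hence "{a<..<b} \<in> null_sets std_normal_distribution" by (intro null_setsI) auto
  hence "AE x in lborel. x \<in> {a<..<b} \<longrightarrow> ennreal (std_normal_density x) = 0"
    by (subst (asm) null_sets_density_iff) auto
  hence "AE x in lborel. x \<notin> {a<..<b}"
  proof eventually_elim
    case (elim x)
    thus ?case using normal_density_pos[of 1 0 x] by (auto simp: ennreal_eq_0_iff)
  qed
  hence "emeasure lborel {a<..<b} = 0"
    by (subst AE_iff_measurable[symmetric, where P = "\<lambda>x. x \<notin> {a<..<b}"]) auto
  thus False using assms by simp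
qed

lemma std_normal_reflect:
  assumes A: "A \<in> sets borel"
  shows "measure std_normal_distribution {x. - x \<in> A} = measure std_normal_distribution A"
proof -
  have "distr (noise_law 1 1) borel (\<lambda>u. (\<Sum>l<1. -1 * u l) / 1) = std_normal_distribution"
    by (rule noise_linear_distr) auto
  hence "measure std_normal_distribution A = measure (distr (noise_law 1 1) borel (\<lambda>u. - u 0)) A"
    by simp
  also have "\<dots> = measure (gauss 1) {z\<in>space (gauss 1). z 0 \<in> {x. - x \<in> A}}"
    unfolding gauss_eq_noise using A by (subst measure_distr) (auto simp: vimage_def Int_def conj_commute)
  also have "\<dots> = measure std_normal_distribution {x. - x \<in> A}"
  proof (rule gauss_component_prob)
    have "uminus -` A \<inter> space borel \<in> sets (borel :: real measure)"
      using A by (intro measurable_sets[of uminus borel borel]) auto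
    thus "{x. - x \<in> A} \<in> sets borel" by (simp add: vimage_def)
  qed simp
  finally show ?thesis by simp
qed

lemma std_normal_AE_neq: "AE x in std_normal_distribution. x \<noteq> (\<tau>::real)"
  by (subst AE_density) (auto intro!: AE_lborel_singleton[THEN eventually_mono])

lemma std_normal_symmetric_interval:
  "measure std_normal_distribution {-c<..<c} = (if c > 0 then 2 * std_normal_cdf c - 1 else 0)"
proof (cases "c > 0")
  case True
  interpret N: prob_space std_normal_distribution by (rule std_normal_prob)
  have 1: "measure std_normal_distribution {c..} = 1 - std_normal_cdf c"
  proof -
    have "measure std_normal_distribution {c..} = measure std_normal_distribution {c<..}"
      using std_normal_AE_neq[of c] by (intro N.finite_measure_eq_AE) (auto elim!: eventually_mono)
    also have "{c<..} = space std_normal_distribution - {..c}" by auto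
    also have "measure std_normal_distribution \<dots> = 1 - std_normal_cdf c"
      unfolding cdf_def by (rule N.prob_compl) simp
    finally show ?thesis .
  qed
  have 2: "measure std_normal_distribution {..-c} = 1 - std_normal_cdf c"
    using std_normal_reflect[of "{c..}"] 1 by (simp add: le_minus_iff atMost_def)
  have "measure std_normal_distribution ({..-c} \<union> {c..}) = 2 * (1 - std_normal_cdf c)"
    using True 1 2 by (subst N.finite_measure_Union) auto
  moreover have "{-c<..<c} = space std_normal_distribution - ({..-c} \<union> {c..})" by auto
  ultimately show ?thesis using True N.prob_compl[of "{..-c} \<union> {c..}"] by simp
next
  case False
  hence "{-c<..<c} = {}" by auto
  thus ?thesis using False by simp
qed

lemma std_normal_cdf_bounds:
  assumes "0 < c"
  shows "0 < 2 * std_normal_cdf c - 1" "std_normal_cdf c < 1"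
proof -
  interpret N: prob_space std_normal_distribution by (rule std_normal_prob)
  show "0 < 2 * std_normal_cdf c - 1"
    using std_normal_interval_pos[of "-c" c] assms by (simp add: std_normal_symmetric_interval)
  have "0 < measure std_normal_distribution {c<..<c + 1}" by (rule std_normal_interval_pos) simp
  also have "\<dots> \<le> measure std_normal_distribution (space std_normal_distribution - {..c})"
    by (intro N.finite_measure_mono) auto
  also have "\<dots> = 1 - std_normal_cdf c" unfolding cdf_def by (rule N.prob_compl) simp
  finally show "std_normal_cdf c < 1" by simp
qed

text \<open>
  Centred intervals have the largest normal probability among intervals of the same length. Subtracting
  from the density its value at \<open>c\<close> does not change the comparison, and makes it pointwise: the
  difference is nonnegative on the centred interval and nonpositive off it.
\<close>

lemma std_normal_interval_shift_le:
  assumes "0 < c"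
  shows "measure std_normal_distribution {d - c<..<d + c} \<le> measure std_normal_distribution {-c<..<c}"
proof -
  let ?S = "{-c<..<c}" and ?T = "{d - c<..<d + c}" and ?f = std_normal_density
  have int: "integrable lborel (\<lambda>x. (?f x - ?f c) * indicator {a<..<b} x)"
    and eq: "a < b \<Longrightarrow> (\<integral>x. (?f x - ?f c) * indicator {a<..<b} x \<partial>lborel)
       = measure std_normal_distribution {a<..<b} - ?f c * (b - a)" for a b
  proof -
    have i1: "integrable lborel (\<lambda>x. ?f x * indicator {a<..<b} x)"
      using integrable_normal_density[of 1 0] by (intro integrable_real_mult_indicator) auto
    have i2: "integrable lborel (\<lambda>x. ?f c * indicator {a<..<b} x)"
      by (cases "a \<le> b") (auto intro!: integrable_mult_right integrable_real_indicator simp: emeasure_lborel_Ioo)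
    have e: "(\<lambda>x. (?f x - ?f c) * indicator {a<..<b} x) = (\<lambda>x. ?f x * indicator {a<..<b} x - ?f c * indicator {a<..<b} x)"
      by (simp add: algebra_simps)
    show "integrable lborel (\<lambda>x. (?f x - ?f c) * indicator {a<..<b} x)"
      unfolding e using i1 i2 by simp
    assume "a < b"
    have "measure std_normal_distribution {a<..<b} = (\<integral>x. ?f x * indicator {a<..<b} x \<partial>lborel)"
    proof -
      have "emeasure std_normal_distribution {a<..<b} = (\<integral>\<^sup>+x. ennreal (?f x * indicator {a<..<b} x) \<partial>lborel)"
        by (subst emeasure_density) (auto simp: indicator_def intro!: nn_integral_cong)
      also have "\<dots> = ennreal (\<integral>x. ?f x * indicator {a<..<b} x \<partial>lborel)"
        using i1 by (intro nn_integral_eq_integral) auto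
      finally show ?thesis by (simp add: measure_def integral_nonneg)
    qed
    thus "(\<integral>x. (?f x - ?f c) * indicator {a<..<b} x \<partial>lborel)
       = measure std_normal_distribution {a<..<b} - ?f c * (b - a)"
      unfolding e Bochner_Integration.integral_diff[OF i1 i2] using \<open>a < b\<close> by simp
  qed
  have mono: "?f x \<le> ?f c" if "c \<le> \<bar>x\<bar>" for x
    using that assms abs_le_square_iff[of c x] by (simp add: std_normal_density_def divide_right_mono)
  have mono': "?f c \<le> ?f x" if "\<bar>x\<bar> \<le> c" for x
    using that assms abs_le_square_iff[of x c] by (simp add: std_normal_density_def divide_right_mono)
  have "(\<integral>x. (?f x - ?f c) * indicator ?T x \<partial>lborel) \<le> (\<integral>x. (?f x - ?f c) * indicator ?S x \<partial>lborel)"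
  proof (rule integral_mono[OF int int])
    fix x
    show "(?f x - ?f c) * indicator ?T x \<le> (?f x - ?f c) * indicator ?S x"
      using mono[of x] mono'[of x] by (cases "\<bar>x\<bar> < c") (auto simp: indicator_def)
  qed
  thus ?thesis using eq[of "d - c" "d + c"] eq[of "-c" c] assms by simp
qed

lemma (in prob_space) prob_tendsto_AE_eventually:
  assumes E: "\<And>n. E n \<in> sets M" "F \<in> sets M"
    and ev: "AE x in M. \<forall>\<^sub>F n in sequentially. x \<in> E n \<longleftrightarrow> x \<in> F"
  shows "(\<lambda>n. prob (E n)) \<longlonglongrightarrow> prob F"
proof -
  have "(\<lambda>n. \<integral>x. indicator (E n) x \<partial>M) \<longlonglongrightarrow> (\<integral>x. indicator F x \<partial>M :: real)"
  proof (rule integral_dominated_convergence[where w = "\<lambda>_. 1"])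
    show "AE x in M. (\<lambda>n. indicator (E n) x) \<longlonglongrightarrow> (indicator F x :: real)"
      using ev by eventually_elim (rule tendsto_eventually, auto elim!: eventually_mono simp: indicator_def)
  qed (use E in \<open>auto simp: indicator_def\<close>)
  thus ?thesis using E sets.Int_space_eq2 by (simp add: Int_absorb2 sets.sets_into_space)
qed

text \<open>
  Away from equality in the limit, the truth value of an inequality is eventually constant.
\<close>

lemma eventually_le_iff:
  fixes f g :: "nat \<Rightarrow> real"
  assumes "f \<longlonglongrightarrow> a" "g \<longlonglongrightarrow> b" "a \<noteq> b"
  shows "\<forall>\<^sub>F n in sequentially. f n \<le> g n \<longleftrightarrow> a \<le> b"
proof (cases "a < b")
  case True
  have "\<forall>\<^sub>F n in sequentially. 0 < g n - f n"
    by (rule order_tendstoD(1)[OF tendsto_diff[OF assms(2,1)]]) (use True in simp)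
  thus ?thesis by eventually_elim (use True in auto)
next
  case False
  hence "b < a" using assms by auto
  have "\<forall>\<^sub>F n in sequentially. 0 < f n - g n"
    by (rule order_tendstoD(1)[OF tendsto_diff[OF assms(1,2)]]) (use \<open>b < a\<close> in simp)
  thus ?thesis by eventually_elim (use \<open>b < a\<close> in auto)
qed

text \<open>
  The three conditions that make up the event of interest, in terms of the scores \<open>z\<close>. The thresholds are
  multiples of a noise level \<open>b\<close> that is passed separately, because it is estimated; \<open>e\<close> in the second
  condition is the local shift.
\<close>

definition below_target :: "nat \<Rightarrow> nat \<Rightarrow> (nat \<Rightarrow> nat \<Rightarrow> real) \<Rightarrow> (nat \<Rightarrow> real) \<Rightarrow> (nat \<Rightarrow> real) \<Rightarrow> bool" where
  "below_target k q \<beta> t z \<longleftrightarrow> (\<forall>i<k. (\<Sum>r<q. \<beta> i r * z r) \<le> t i)"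

definition exceeds :: "nat \<Rightarrow> real \<Rightarrow> real \<Rightarrow> real \<Rightarrow> (nat \<Rightarrow> real) \<Rightarrow> bool" where
  "exceeds s \<sigma> e b z \<longleftrightarrow> b \<le> \<bar>e + \<sigma> * z s\<bar>"

definition insignificant :: "nat \<Rightarrow> nat \<Rightarrow> (nat \<Rightarrow> real) \<Rightarrow> real \<Rightarrow> real \<Rightarrow> (nat \<Rightarrow> real) \<Rightarrow> bool" where
  "insignificant P q c \<sigma> b z \<longleftrightarrow> (\<forall>r\<in>{q..<P}. \<bar>\<sigma> * z r\<bar> < c (Suc r) * b)"

lemma below_target_sets [measurable]:
  "q \<le> P \<Longrightarrow> Measurable.pred (gauss P) (below_target k q \<beta> t)"
  unfolding below_target_def by measurable

lemma exceeds_sets [measurable]: "s < P \<Longrightarrow> Measurable.pred (gauss P) (exceeds s \<sigma> e b)"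
  unfolding exceeds_def by measurable

lemma insignificant_sets [measurable]: "Measurable.pred (gauss P) (insignificant P q c \<sigma> b)"
  unfolding insignificant_def by measurable

lemma gauss_coordinate_AE_neq:
  assumes "r < P" "0 < \<sigma>"
  shows "AE z in gauss P. \<sigma> * z r \<noteq> \<tau>"
  using gauss_hyperplane_null[of r P "\<lambda>s. of_bool (r = s) * \<sigma>" \<tau>] assms
  by (simp add: of_bool_def if_distrib[of "\<lambda>x. x * _"] cong: if_cong)

text \<open>
  Almost every point lies off the boundary of the limiting event, because the boundary consists of
  finitely many hyperplanes. At such a point membership is eventually constant. The two
  noise levels \<open>b1\<close> and \<open>b2\<close> are separate so that upper and lower approximations are both covered.
\<close>

lemma selection_event_tendsto:
  assumes q: "s < q" "q \<le> P" and \<sigma>: "0 < \<sigma>"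
    and \<beta>: "\<And>i r. i < k \<Longrightarrow> r < q \<Longrightarrow> (\<lambda>n. \<beta> n i r) \<longlonglongrightarrow> \<beta>' i r"
    and \<beta>0: "\<And>i. i < k \<Longrightarrow> \<exists>r<q. \<beta>' i r \<noteq> 0"
    and e: "e \<longlonglongrightarrow> e'" and b1: "b1 \<longlonglongrightarrow> \<sigma>" and b2: "b2 \<longlonglongrightarrow> \<sigma>"
  shows "(\<lambda>n. \<P>(z in gauss P. below_target k q (\<beta> n) t z \<and> exceeds s \<sigma> (e n) (c q * b1 n) z
        \<and> insignificant P q c \<sigma> (b2 n) z))
    \<longlonglongrightarrow> \<P>(z in gauss P. below_target k q \<beta>' t z \<and> exceeds s \<sigma> e' (c q * \<sigma>) z
        \<and> insignificant P q c \<sigma> \<sigma> z)"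
proof -
  interpret prob_space "gauss P" by (rule gauss_prob_space)
  have sP: "s < P" using q by simp
  have n1: "AE z in gauss P. \<forall>i<k. (\<Sum>r<q. \<beta>' i r * z r) \<noteq> t i"
  proof -
    have "AE z in gauss P. (\<Sum>r<q. \<beta>' i r * z r) \<noteq> t i" if i: "i < k" for i
    proof -
      obtain r where r: "r < q" "\<beta>' i r \<noteq> 0" using \<beta>0[OF i] by blast
      have "AE z in gauss P. (\<Sum>r<P. (if r < q then \<beta>' i r else 0) * z r) \<noteq> t i"
        using r q by (intro gauss_hyperplane_null[of r]) auto
      moreover have "(\<Sum>r<P. (if r < q then \<beta>' i r else 0) * z r) = (\<Sum>r<q. \<beta>' i r * z r)" for z :: "nat \<Rightarrow> real"
        using q(2) by (subst sum_lessThan_restrict[of q P]) auto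
      ultimately show ?thesis by simp
    qed
    hence "AE z in gauss P. \<forall>i\<in>{..<k}. (\<Sum>r<q. \<beta>' i r * z r) \<noteq> t i" by (intro AE_finite_allI) auto
    thus ?thesis by (auto elim!: eventually_mono)
  qed
  have n2: "AE z in gauss P. c q * \<sigma> \<noteq> \<bar>e' + \<sigma> * z s\<bar>"
    using gauss_coordinate_AE_neq[OF sP \<sigma>, of "c q * \<sigma> - e'"] gauss_coordinate_AE_neq[OF sP \<sigma>, of "- c q * \<sigma> - e'"]
    by eventually_elim (auto simp: abs_if split: if_splits)
  have n3: "AE z in gauss P. \<forall>r\<in>{q..<P}. c (Suc r) * \<sigma> \<noteq> \<bar>\<sigma> * z r\<bar>"
  proof (rule AE_finite_allI)
    fix r assume "r \<in> {q..<P}" hence r: "r < P" by simp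
    show "AE z in gauss P. c (Suc r) * \<sigma> \<noteq> \<bar>\<sigma> * z r\<bar>"
      using gauss_coordinate_AE_neq[OF r \<sigma>, of "c (Suc r) * \<sigma>"] gauss_coordinate_AE_neq[OF r \<sigma>, of "- c (Suc r) * \<sigma>"]
      by eventually_elim (auto simp: abs_if split: if_splits)
  qed simp
  show ?thesis
  proof (rule prob_tendsto_AE_eventually)
    show "AE z in gauss P. \<forall>\<^sub>F n in sequentially.
       z \<in> {z\<in>space (gauss P). below_target k q (\<beta> n) t z \<and> exceeds s \<sigma> (e n) (c q * b1 n) z \<and> insignificant P q c \<sigma> (b2 n) z}
       \<longleftrightarrow> z \<in> {z\<in>space (gauss P). below_target k q \<beta>' t z \<and> exceeds s \<sigma> e' (c q * \<sigma>) z \<and> insignificant P q c \<sigma> \<sigma> z}"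
      using n1 n2 n3
    proof eventually_elim
      case (elim z)
      have "\<forall>\<^sub>F n in sequentially. \<forall>i\<in>{..<k}. (\<Sum>r<q. \<beta> n i r * z r) \<le> t i \<longleftrightarrow> (\<Sum>r<q. \<beta>' i r * z r) \<le> t i"
        using elim(1) by (intro eventually_ball_finite ballI eventually_le_iff tendsto_intros \<beta>) auto
      moreover have "\<forall>\<^sub>F n in sequentially. c q * b1 n \<le> \<bar>e n + \<sigma> * z s\<bar> \<longleftrightarrow> c q * \<sigma> \<le> \<bar>e' + \<sigma> * z s\<bar>"
        using elim(2) by (intro eventually_le_iff tendsto_intros e b1)
      moreover have "\<forall>\<^sub>F n in sequentially. \<forall>r\<in>{q..<P}. c (Suc r) * b2 n \<le> \<bar>\<sigma> * z r\<bar> \<longleftrightarrow> c (Suc r) * \<sigma> \<le> \<bar>\<sigma> * z r\<bar>"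
        using elim(3) by (intro eventually_ball_finite ballI eventually_le_iff tendsto_intros b2) auto
      ultimately show ?case
        by eventually_elim (auto simp: below_target_def exceeds_def insignificant_def simp flip: not_le)
    qed
  qed (use q sP in measurable)
qed

text \<open>
  The tests of higher order involve coordinates from \<open>q\<close> on, the other conditions those below \<open>q\<close>.
\<close>

lemma selection_event_factor:
  assumes q: "s < q" "q \<le> P" and \<sigma>: "0 < \<sigma>" and c: "\<And>p. q < p \<Longrightarrow> p \<le> P \<Longrightarrow> 0 < c p"
  shows "\<P>(z in gauss P. below_target k q \<beta> t z \<and> exceeds s \<sigma> e b z \<and> insignificant P q c \<sigma> \<sigma> z)
    = \<P>(z in gauss P. below_target k q \<beta> t z \<and> exceeds s \<sigma> e b z)
      * (\<Prod>p=q+1..P. 2 * std_normal_cdf (c p) - 1)"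
proof -
  let ?A = "{z\<in>space (gauss P). below_target k q \<beta> t z \<and> exceeds s \<sigma> e b z}"
  let ?B = "{z\<in>space (gauss P). insignificant P q c \<sigma> \<sigma> z}"
  have sP: "s < P" using q by simp
  have "measure (gauss P) (?A \<inter> ?B) = measure (gauss P) ?A * measure (gauss P) ?B"
  proof (rule gauss_independent[where J = "{..<q}" and K = "{q..<P}"])
    fix z w assume zw: "w \<in> space (gauss P)" "\<And>j. j \<in> {..<q} \<Longrightarrow> z j = w j" "z \<in> ?A"
    have "(\<Sum>r<q. \<beta> i r * z r) = (\<Sum>r<q. \<beta> i r * w r)" for i using zw by (intro sum.cong) auto
    thus "w \<in> ?A" using zw q by (auto simp: below_target_def exceeds_def)
  qed (use q sP in \<open>auto simp: insignificant_def\<close>, measurable)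
  also have "?A \<inter> ?B = {z\<in>space (gauss P). below_target k q \<beta> t z \<and> exceeds s \<sigma> e b z \<and> insignificant P q c \<sigma> \<sigma> z}"
    by auto
  also have "measure (gauss P) ?B = (\<Prod>p=q+1..P. 2 * std_normal_cdf (c p) - 1)"
  proof -
    interpret N: prob_space std_normal_distribution by (rule std_normal_prob)
    let ?I = "\<lambda>r. if q \<le> r then {-c (Suc r)<..<c (Suc r)} else UNIV"
    have "\<bar>\<sigma> * x\<bar> < b * \<sigma> \<longleftrightarrow> x \<in> {-b<..<b}" for x b
      using \<sigma> by (auto simp: abs_mult abs_less_iff mult.commute[of b])
    hence "?B = {z\<in>space (gauss P). \<forall>r<P. z r \<in> ?I r}"
      by (auto simp: insignificant_def)
    hence "measure (gauss P) ?B = (\<Prod>r<P. measure std_normal_distribution (?I r))"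
      by (simp only:) (rule gauss_box_prob, auto)
    also have "\<dots> = (\<Prod>r\<in>{q..<P}. measure std_normal_distribution (?I r))"
      using N.prob_space by (intro prod.mono_neutral_right) auto
    also have "\<dots> = (\<Prod>r\<in>{q..<P}. 2 * std_normal_cdf (c (Suc r)) - 1)"
      using c by (intro prod.cong refl) (auto simp: std_normal_symmetric_interval)
    also have "\<dots> = (\<Prod>p=q+1..P. 2 * std_normal_cdf (c p) - 1)"
      by (rule prod.reindex_bij_witness[of _ "\<lambda>p. p - 1" Suc]) auto
    finally show ?thesis .
  qed
  finally show ?thesis .
qed

text \<open>
  The local shift can only raise the probability that the test of order \<open>s + 1\<close> is significant.
\<close>

lemma exceeds_prob:
  assumes s: "s < P" and \<sigma>: "0 < \<sigma>" and c: "0 < c"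
  shows "\<P>(z in gauss P. exceeds s \<sigma> e (c * \<sigma>) z)
      = 1 - measure std_normal_distribution {-e/\<sigma> - c<..<-e/\<sigma> + c}"
    and "2 * (1 - std_normal_cdf c) \<le> \<P>(z in gauss P. exceeds s \<sigma> e (c * \<sigma>) z)"
    and "\<P>(z in gauss P. exceeds s \<sigma> 0 (c * \<sigma>) z) = 2 * (1 - std_normal_cdf c)"
proof -
  interpret N: prob_space std_normal_distribution by (rule std_normal_prob)
  show 1: "\<P>(z in gauss P. exceeds s \<sigma> e (c * \<sigma>) z)
      = 1 - measure std_normal_distribution {-e/\<sigma> - c<..<-e/\<sigma> + c}" for e
  proof -
    have "\<bar>e + \<sigma> * x\<bar> = \<sigma> * \<bar>e / \<sigma> + x\<bar>" for x
      using \<sigma> by (simp add: abs_mult_pos' distrib_left flip: abs_mult_pos)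
    hence "exceeds s \<sigma> e (c * \<sigma>) z \<longleftrightarrow> z s \<in> space std_normal_distribution - {-e/\<sigma> - c<..<-e/\<sigma> + c}" for z
      using \<sigma> by (auto simp: exceeds_def mult.commute[of c])
    hence "\<P>(z in gauss P. exceeds s \<sigma> e (c * \<sigma>) z)
      = measure std_normal_distribution (space std_normal_distribution - {-e/\<sigma> - c<..<-e/\<sigma> + c})"
      by (simp only:) (rule gauss_component_prob[OF s], auto)
    also have "\<dots> = 1 - measure std_normal_distribution {-e/\<sigma> - c<..<-e/\<sigma> + c}"
      by (rule N.prob_compl) simp
    finally show ?thesis .
  qed
  show "2 * (1 - std_normal_cdf c) \<le> \<P>(z in gauss P. exceeds s \<sigma> e (c * \<sigma>) z)"
    using std_normal_interval_shift_le[OF c, of "-e/\<sigma>"] c by (simp add: 1 std_normal_symmetric_interval)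
  show "\<P>(z in gauss P. exceeds s \<sigma> 0 (c * \<sigma>) z) = 2 * (1 - std_normal_cdf c)"
    using c by (simp add: 1 std_normal_symmetric_interval)
qed

text \<open>
  A strict solution of the system of inequalities has a box around it that consists of solutions.
\<close>

lemma below_target_prob_pos:
  assumes q: "q \<le> P" and z0: "\<And>i. i < k \<Longrightarrow> (\<Sum>r<q. \<beta> i r * z0 r) < t i"
  shows "0 < \<P>(z in gauss P. below_target k q \<beta> t z)"
proof -
  interpret prob_space "gauss P" by (rule gauss_prob_space)
  define b where "b = (\<Sum>i<k. \<Sum>r<q. \<bar>\<beta> i r\<bar>)"
  have b0: "0 \<le> b" unfolding b_def by (intro sum_nonneg) auto
  have "\<exists>\<epsilon>>0. \<forall>i<k. (\<Sum>r<q. \<beta> i r * z0 r) + b * \<epsilon> \<le> t i"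
  proof -
    define g where "g = Min (insert 1 ((\<lambda>i. t i - (\<Sum>r<q. \<beta> i r * z0 r)) ` {..<k}))"
    have g: "0 < g" "\<And>i. i < k \<Longrightarrow> g \<le> t i - (\<Sum>r<q. \<beta> i r * z0 r)"
      using z0 by (auto simp: g_def)
    have "b * (g / (1 + b)) \<le> g" using b0 g(1) by (simp add: field_simps)
    thus ?thesis using g b0 by (intro exI[of _ "g / (1 + b)"]) (auto simp: add_nonneg_pos, smt (verit))
  qed
  then obtain \<epsilon> where \<epsilon>: "0 < \<epsilon>" "\<And>i. i < k \<Longrightarrow> (\<Sum>r<q. \<beta> i r * z0 r) + b * \<epsilon> \<le> t i" by blast
  have "0 < (\<Prod>r<P. measure std_normal_distribution {z0 r - \<epsilon><..<z0 r + \<epsilon>})"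
    using \<epsilon>(1) by (intro prod_pos std_normal_interval_pos) auto
  also have "\<dots> = prob {z\<in>space (gauss P). \<forall>r<P. z r \<in> {z0 r - \<epsilon><..<z0 r + \<epsilon>}}"
    by (rule gauss_box_prob[symmetric]) simp
  also have "\<dots> \<le> prob {z\<in>space (gauss P). below_target k q \<beta> t z}"
  proof (rule finite_measure_mono)
    show "{z\<in>space (gauss P). below_target k q \<beta> t z} \<in> events" using q by measurable
    show "{z\<in>space (gauss P). \<forall>r<P. z r \<in> {z0 r - \<epsilon><..<z0 r + \<epsilon>}} \<subseteq> {z\<in>space (gauss P). below_target k q \<beta> t z}"
    proof safe
      fix z assume z: "\<forall>r<P. z r \<in> {z0 r - \<epsilon><..<z0 r + \<epsilon>}"
      show "below_target k q \<beta> t z" unfolding below_target_def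
      proof safe
        fix i assume i: "i < k"
        have "(\<Sum>r<q. \<beta> i r * z r) = (\<Sum>r<q. \<beta> i r * z0 r) + (\<Sum>r<q. \<beta> i r * (z r - z0 r))"
          by (simp add: algebra_simps sum.distrib sum_subtractf)
        also have "(\<Sum>r<q. \<beta> i r * (z r - z0 r)) \<le> (\<Sum>r<q. \<bar>\<beta> i r\<bar> * \<epsilon>)"
        proof (rule sum_mono)
          fix r assume "r \<in> {..<q}" hence "z r \<in> {z0 r - \<epsilon><..<z0 r + \<epsilon>}" using z q by auto
          hence "\<bar>z r - z0 r\<bar> \<le> \<epsilon>" by (auto simp: abs_le_iff)
          hence "\<bar>\<beta> i r * (z r - z0 r)\<bar> \<le> \<bar>\<beta> i r\<bar> * \<epsilon>" by (simp add: abs_mult mult_left_mono)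
          thus "\<beta> i r * (z r - z0 r) \<le> \<bar>\<beta> i r\<bar> * \<epsilon>" by simp
        qed
        also have "\<dots> = (\<Sum>r<q. \<bar>\<beta> i r\<bar>) * \<epsilon>" by (simp add: sum_distrib_right)
        also have "\<dots> \<le> b * \<epsilon>" unfolding b_def
          using i \<epsilon>(1) by (intro mult_right_mono member_le_sum[of i "{..<k}" "\<lambda>i. \<Sum>r<q. \<bar>\<beta> i r\<bar>"]) (auto intro: sum_nonneg)
        finally show "(\<Sum>r<q. \<beta> i r * z r) \<le> t i" using \<epsilon>(2)[OF i] by simp
      qed
    qed
  qed
  finally show ?thesis .
qed

text \<open>
  The conditional probability of the target event given significance. For a suitable shift \<open>e\<close> it is the
  limit of the conditional distribution functions.
\<close>

definition cond_limit :: "nat \<Rightarrow> nat \<Rightarrow> nat \<Rightarrow> (nat \<Rightarrow> nat \<Rightarrow> real) \<Rightarrow> (nat \<Rightarrow> real) \<Rightarrow> nat \<Rightarrow> real \<Rightarrow> real \<Rightarrow> real \<Rightarrow> real" where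
  "cond_limit P k q \<beta> t s \<sigma> b e =
     \<P>(z in gauss P. below_target k q \<beta> t z \<and> exceeds s \<sigma> e b z)
     / \<P>(z in gauss P. exceeds s \<sigma> e b z)"

text \<open>
  Suppose that the conditional probability is a constant \<open>h\<close>. For a large shift significance is almost
  certain, so \<open>h\<close> is the unconditional probability of the target event, and then it is also the
  conditional probability of the target event on each window where the test is not significant.
  On a window centred far out in the direction of the sign of \<open>\<beta> i s\<close>, the target event forces the sum of the
  other terms of component \<open>i\<close>, which is independent of the window, to be very small. Hence \<open>h\<close> is zero, in
  contradiction to the positivity of the target event.
\<close>

lemma cond_limit_not_constant:
  assumes s: "s < q" "q \<le> P" and \<sigma>: "0 < \<sigma>" and c: "0 < c"
    and i: "i < k" "\<beta> i s \<noteq> 0"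
    and pos: "0 < \<P>(z in gauss P. below_target k q \<beta> t z)"
  shows "\<exists>e. cond_limit P k q \<beta> t s \<sigma> (c * \<sigma>) e \<noteq> cond_limit P k q \<beta> t s \<sigma> (c * \<sigma>) 0"
proof (rule ccontr)
  interpret prob_space "gauss P" by (rule gauss_prob_space)
  have sP: "s < P" using s by simp
  let ?A = "{z\<in>space (gauss P). below_target k q \<beta> t z}"
  let ?E = "\<lambda>e. {z\<in>space (gauss P). exceeds s \<sigma> e (c * \<sigma>) z}"
  define W where "W e = {z\<in>space (gauss P). \<not> exceeds s \<sigma> e (c * \<sigma>) z}" for e
  have [measurable]: "?A \<in> events" "?E e \<in> events" "W e \<in> events" for e
    unfolding W_def using s sP by measurable
  assume "\<not> ?thesis"
  then obtain h where h: "\<And>e. cond_limit P k q \<beta> t s \<sigma> (c * \<sigma>) e = h" by metis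
  have E0: "0 < prob (?E e)" for e
    using exceeds_prob(2)[OF sP \<sigma> c, of e] std_normal_cdf_bounds(2)[OF c] by simp
  have AE: "prob (?A \<inter> ?E e) = h * prob (?E e)" for e
  proof -
    have "?A \<inter> ?E e = {z\<in>space (gauss P). below_target k q \<beta> t z \<and> exceeds s \<sigma> e (c * \<sigma>) z}" by auto
    thus ?thesis using h[of e] E0[of e] by (simp add: cond_limit_def field_simps)
  qed
  have W1: "prob (W e) = 1 - prob (?E e)" for e
  proof -
    have "W e = space (gauss P) - ?E e" by (auto simp: W_def)
    thus ?thesis using prob_compl[of "?E e"] by simp
  qed
  have AW: "prob (?A \<inter> W e) = prob ?A - prob (?A \<inter> ?E e)" for e
  proof -
    have "prob ?A = prob (?A \<inter> W e) + prob (?A \<inter> ?E e)"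
      by (subst finite_measure_Union[symmetric]) (auto simp: W_def intro!: arg_cong[where f = prob])
    thus ?thesis by simp
  qed
  have W2: "prob (W e) = measure std_normal_distribution {-e/\<sigma> - c<..<-e/\<sigma> + c}" for e
    using W1[of e] exceeds_prob(1)[OF sP \<sigma> c, of e] by simp
  have W0: "0 < prob (W e)" for e
    unfolding W2 using c by (intro std_normal_interval_pos) simp
  define V where "V x = {z\<in>space (gauss P). (\<Sum>r\<in>{..<q} - {s}. \<beta> i r * z r) \<le> x}" for x
  have Vm [measurable]: "(\<lambda>z. \<Sum>r\<in>{..<q} - {s}. \<beta> i r * z r) \<in> borel_measurable (gauss P)"
    by (intro borel_measurable_sum borel_measurable_times borel_measurable_const measurable_gauss_component)
       (use s in auto)
  have V [measurable]: "V x \<in> events" for x unfolding V_def by measurable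
  define b where "b = \<beta> i s"
  \<comment> \<open>This shift centres the window for coordinate \<open>s\<close> at \<open>sgn b * n\<close>.\<close>
  define en where "en n = - \<sigma> * sgn b * real n" for n
  have sub: "?A \<inter> W (en n) \<subseteq> V (t i + \<bar>b\<bar> * c - \<bar>b\<bar> * real n) \<inter> W (en n)" for n
  proof
    fix z assume z: "z \<in> ?A \<inter> W (en n)"
    hence zsp: "z \<in> space (gauss P)" by auto
    have "(\<Sum>r<q. \<beta> i r * z r) = b * z s + (\<Sum>r\<in>{..<q} - {s}. \<beta> i r * z r)"
      unfolding b_def using s by (subst sum.remove[of _ s]) auto
    hence 1: "b * z s + (\<Sum>r\<in>{..<q} - {s}. \<beta> i r * z r) \<le> t i"
      using z i by (auto simp: below_target_def)
    have "\<bar>en n + \<sigma> * z s\<bar> < c * \<sigma>" using z by (auto simp: W_def exceeds_def)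
    also have "en n + \<sigma> * z s = \<sigma> * (z s - sgn b * real n)" by (simp add: en_def algebra_simps)
    finally have "\<bar>z s - sgn b * real n\<bar> < c" using \<sigma> by (simp add: abs_mult mult.commute[of c])
    hence "\<bar>b\<bar> * \<bar>z s - sgn b * real n\<bar> \<le> \<bar>b\<bar> * c" by (intro mult_left_mono) auto
    moreover have "b * (z s - sgn b * real n) = b * z s - \<bar>b\<bar> * real n"
      by (simp add: algebra_simps abs_sgn)
    ultimately have "\<bar>b * z s - \<bar>b\<bar> * real n\<bar> \<le> \<bar>b\<bar> * c" by (simp flip: abs_mult)
    hence "(\<Sum>r\<in>{..<q} - {s}. \<beta> i r * z r) \<le> t i + \<bar>b\<bar> * c - \<bar>b\<bar> * real n" using 1 by linarith
    thus "z \<in> V (t i + \<bar>b\<bar> * c - \<bar>b\<bar> * real n) \<inter> W (en n)" using z zsp by (auto simp: V_def)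
  qed
  have bound: "prob (?A \<inter> W (en n)) \<le> prob (V (t i + \<bar>b\<bar> * c - \<bar>b\<bar> * real n)) * prob (W (en n))" for n
  proof -
    have "prob (?A \<inter> W (en n)) \<le> prob (V (t i + \<bar>b\<bar> * c - \<bar>b\<bar> * real n) \<inter> W (en n))"
      by (rule finite_measure_mono[OF sub]) measurable
    also have "\<dots> = prob (V (t i + \<bar>b\<bar> * c - \<bar>b\<bar> * real n)) * prob (W (en n))"
    proof (rule gauss_independent[where J = "{..<q} - {s}" and K = "{s}"])
      fix z w :: "nat \<Rightarrow> real" and x
      assume zw: "w \<in> space (gauss P)" "\<And>j. j \<in> {..<q} - {s} \<Longrightarrow> z j = w j" "z \<in> V (t i + \<bar>b\<bar> * c - \<bar>b\<bar> * real n)"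
      have "(\<Sum>r\<in>{..<q} - {s}. \<beta> i r * z r) = (\<Sum>r\<in>{..<q} - {s}. \<beta> i r * w r)" using zw by (intro sum.cong) auto
      thus "w \<in> V (t i + \<bar>b\<bar> * c - \<bar>b\<bar> * real n)" using zw by (auto simp: V_def)
    qed (use s in \<open>auto simp: W_def exceeds_def\<close>)
    finally show ?thesis .
  qed
  have Vlim: "(\<lambda>n. prob (V (t i + \<bar>b\<bar> * c - \<bar>b\<bar> * real n))) \<longlonglongrightarrow> prob {}"
  proof (rule prob_tendsto_AE_eventually)
    have "filterlim (\<lambda>n. t i + \<bar>b\<bar> * c - \<bar>b\<bar> * real n) at_bot sequentially"
      using i(2) unfolding b_def by real_asymp
    hence low: "\<forall>\<^sub>F n in sequentially. t i + \<bar>b\<bar> * c - \<bar>b\<bar> * real n < y" for y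
      by (simp add: filterlim_at_bot_dense)
    have "\<forall>\<^sub>F n in sequentially. z \<notin> V (t i + \<bar>b\<bar> * c - \<bar>b\<bar> * real n)" for z
      using low[of "\<Sum>r\<in>{..<q} - {s}. \<beta> i r * z r"] by (rule eventually_mono) (auto simp: V_def)
    thus "AE z in gauss P. \<forall>\<^sub>F n in sequentially. z \<in> V (t i + \<bar>b\<bar> * c - \<bar>b\<bar> * real n) \<longleftrightarrow> z \<in> {}"
      by simp
  qed auto
  have Wlim: "(\<lambda>n. prob (W (en n))) \<longlonglongrightarrow> prob {}"
  proof (rule prob_tendsto_AE_eventually)
    have en_abs: "\<bar>en n\<bar> = \<sigma> * real n" for n
      using i(2) \<sigma> by (simp add: en_def abs_mult b_def abs_sgn_eq)
    have "filterlim (\<lambda>n. \<sigma> * real n) at_top sequentially"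
      using \<sigma> by real_asymp
    hence "\<forall>\<^sub>F n in sequentially. y < \<bar>en n\<bar>" for y
      unfolding en_abs by (simp add: filterlim_at_top_dense)
    hence "\<forall>\<^sub>F n in sequentially. z \<notin> W (en n)" for z
    proof (rule eventually_mono)
      fix n assume "\<bar>\<sigma> * z s\<bar> + c * \<sigma> < \<bar>en n\<bar>"
      thus "z \<notin> W (en n)" by (auto simp: W_def exceeds_def)
    qed
    thus "AE z in gauss P. \<forall>\<^sub>F n in sequentially. z \<in> W (en n) \<longleftrightarrow> z \<in> {}" by simp
  qed auto
  have Ah: "prob ?A = h"
  proof -
    have "(\<lambda>n. prob (?A \<inter> W (en n))) \<longlonglongrightarrow> 0"
      by (rule tendsto_sandwich[OF _ _ tendsto_const Wlim[simplified]])
         (auto intro!: always_eventually finite_measure_mono)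
    moreover have "(\<lambda>n. prob ?A - h * (1 - prob (W (en n)))) \<longlonglongrightarrow> prob ?A - h * (1 - 0)"
      using Wlim by (intro tendsto_intros) simp
    ultimately show ?thesis using LIMSEQ_unique unfolding AW AE W1 by fastforce
  qed
  have "h \<le> prob (V (t i + \<bar>b\<bar> * c - \<bar>b\<bar> * real n))" for n
  proof -
    have "prob (?A \<inter> W (en n)) = h * prob (W (en n))" unfolding AW AE Ah W1 by (simp add: algebra_simps)
    thus ?thesis using bound[of n] W0[of "en n"] by simp
  qed
  hence "h \<le> 0" using LIMSEQ_le_const[OF Vlim[simplified], of h] by auto
  thus False using pos Ah by simp
qed

section \<open>Likelihood ratios of Gaussian shifts\<close>

text \<open>
  Quantitative contiguity, from the Cauchy-Schwarz inequality.
\<close>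

lemma (in prob_space) density_prob_le_sqrt:
  fixes L :: "'a \<Rightarrow> real"
  assumes L: "L \<in> borel_measurable M" "\<And>x. 0 \<le> L x" and L2: "integrable M (\<lambda>x. (L x)\<^sup>2)"
    and L1: "integrable M L" and E: "E \<in> events"
  shows "(\<integral>x. L x * indicator E x \<partial>M) \<le> sqrt ((\<integral>x. (L x)\<^sup>2 \<partial>M) * prob E)"
proof -
  let ?I = "\<integral>x. L x * indicator E x \<partial>M"
  have I: "(\<integral>\<^sup>+x. ennreal (L x) * indicator E x \<partial>M) = ennreal ?I"
    unfolding ennreal_indicator[symmetric] ennreal_mult'[OF L(2), symmetric]
    using L L1 E by (intro nn_integral_eq_integral integrable_real_mult_indicator) auto
  have K: "(\<integral>\<^sup>+x. (ennreal (L x))\<^sup>2 \<partial>M) = ennreal (\<integral>x. (L x)\<^sup>2 \<partial>M)"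
    unfolding ennreal_power[OF L(2)] using L2 by (intro nn_integral_eq_integral) auto
  have "(indicator E x)\<^sup>2 = (indicator E x :: ennreal)" for x by (simp add: indicator_def)
  hence "(\<integral>\<^sup>+x. (indicator E x)\<^sup>2 \<partial>M) = ennreal (prob E)"
    using E by (simp add: emeasure_eq_measure)
  hence "(ennreal ?I)\<^sup>2 \<le> ennreal (\<integral>x. (L x)\<^sup>2 \<partial>M) * ennreal (prob E)"
    using Cauchy_Schwarz_nn_integral[of "\<lambda>x. ennreal (L x)" M "indicator E"] L(1) E unfolding I K by simp
  hence "?I\<^sup>2 \<le> (\<integral>x. (L x)\<^sup>2 \<partial>M) * prob E"
    using L(2) by (simp add: ennreal_power integral_nonneg flip: ennreal_mult)
  thus ?thesis by (rule real_le_rsqrt)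
qed

text \<open>
  The chi-square distance of a density from one dominates the difference of probabilities.
\<close>

lemma (in prob_space) density_prob_diff_le:
  fixes L :: "'a \<Rightarrow> real"
  assumes L2: "integrable M (\<lambda>x. (L x)\<^sup>2)" and L1: "integrable M L" "(\<integral>x. L x \<partial>M) = 1"
    and E: "E \<in> events"
  shows "\<bar>(\<integral>x. L x * indicator E x \<partial>M) - prob E\<bar> \<le> sqrt ((\<integral>x. (L x)\<^sup>2 \<partial>M) - 1)"
proof -
  define g where "g x = (L x - 1) * indicator E x" for x
  have g1: "integrable M g" unfolding g_def using L1 E by (intro integrable_real_mult_indicator) auto
  have d2: "integrable M (\<lambda>x. (L x - 1)\<^sup>2)"
    using L1 L2 by (simp add: power2_diff)
  have g2e: "(g x)\<^sup>2 = (L x - 1)\<^sup>2 * indicator E x" for x by (simp add: g_def indicator_def)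
  have g2: "integrable M (\<lambda>x. (g x)\<^sup>2)" unfolding g2e using d2 E by (intro integrable_real_mult_indicator)
  have "(\<integral>x. g x \<partial>M)\<^sup>2 \<le> (\<integral>x. (g x)\<^sup>2 \<partial>M)"
    using variance_eq[OF g1 g2] variance_positive[of g] by simp
  also have "\<dots> \<le> (\<integral>x. (L x - 1)\<^sup>2 \<partial>M)"
    by (rule integral_mono[OF g2 d2]) (simp add: g2e indicator_def)
  also have "\<dots> = (\<integral>x. (L x)\<^sup>2 \<partial>M) - 1"
    using L1 L2 by (simp add: power2_diff prob_space)
  finally have "\<bar>\<integral>x. g x \<partial>M\<bar> \<le> sqrt ((\<integral>x. (L x)\<^sup>2 \<partial>M) - 1)"
    by (intro real_le_rsqrt) simp
  also have "(\<integral>x. g x \<partial>M) = (\<integral>x. L x * indicator E x \<partial>M) - prob E"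
  proof -
    have "(\<integral>x. g x \<partial>M) = (\<integral>x. L x * indicator E x - indicator E x \<partial>M)"
      by (intro Bochner_Integration.integral_cong refl) (simp add: g_def algebra_simps)
    also have "\<dots> = (\<integral>x. L x * indicator E x \<partial>M) - (\<integral>x. indicator E x \<partial>M)"
      using L1 E by (intro Bochner_Integration.integral_diff integrable_real_mult_indicator)
        (auto intro!: integrable_real_indicator simp: emeasure_eq_measure)
    finally show ?thesis using E by (simp add: sets.Int_space_eq2)
  qed
  finally show ?thesis .
qed

text \<open>
  The likelihood ratio of a normal law with mean \<open>\<mu>\<close> against the centred one.
\<close>

definition shift_density :: "real \<Rightarrow> real \<Rightarrow> real \<Rightarrow> real" where
  "shift_density \<sigma> \<mu> x = exp ((\<mu> * x - \<mu>\<^sup>2 / 2) / \<sigma>\<^sup>2)"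

lemma shift_density_measurable [measurable]: "shift_density \<sigma> \<mu> \<in> borel_measurable borel"
  unfolding shift_density_def by measurable

lemma shift_density_nonneg [simp]: "0 \<le> shift_density \<sigma> \<mu> x"
  by (simp add: shift_density_def)

lemma normal_distr_shift:
  assumes "0 < \<sigma>"
  shows "distr (density lborel (normal_density 0 \<sigma>)) borel (\<lambda>x. \<mu> + x)
    = density (density lborel (normal_density 0 \<sigma>)) (\<lambda>x. ennreal (shift_density \<sigma> \<mu> x))"
proof -
  let ?N = "density lborel (normal_density 0 \<sigma>)"
  interpret N: prob_space ?N by (rule prob_space_normal_density[OF assms])
  have "distributed ?N lborel (\<lambda>x. x) (normal_density 0 \<sigma>)"
    by (simp add: distributed_def distr_id2)
  hence "distributed ?N lborel (\<lambda>x. \<mu> + 1 * x) (normal_density (\<mu> + 1 * 0) (\<bar>1\<bar> * \<sigma>))"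
    using assms by (intro N.normal_density_affine) auto
  hence "distr ?N lborel (\<lambda>x. \<mu> + x) = density lborel (normal_density \<mu> \<sigma>)"
    by (simp add: distributed_def)
  moreover have "distr ?N lborel (\<lambda>x. \<mu> + x) = distr ?N borel (\<lambda>x. \<mu> + x)" by (intro distr_cong) auto
  moreover have "density ?N (\<lambda>x. ennreal (shift_density \<sigma> \<mu> x)) = density lborel (normal_density \<mu> \<sigma>)"
  proof -
    have "normal_density 0 \<sigma> x * shift_density \<sigma> \<mu> x = normal_density \<mu> \<sigma> x" for x
      using assms
      by (simp add: normal_density_def shift_density_def exp_add[symmetric] field_simps power2_eq_square)
    thus ?thesis
      by (subst density_density_eq) (auto simp: ennreal_mult'[symmetric] shift_density_def)
  qed
  ultimately show ?thesis by simp
qed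

lemma shift_density_integral:
  assumes "0 < \<sigma>"
  shows "integrable (density lborel (normal_density 0 \<sigma>)) (shift_density \<sigma> \<mu>)"
    "(\<integral>x. shift_density \<sigma> \<mu> x \<partial>density lborel (normal_density 0 \<sigma>)) = 1"
proof -
  let ?N = "density lborel (normal_density 0 \<sigma>)"
  interpret N: prob_space ?N by (rule prob_space_normal_density[OF assms])
  have sets: "sets ?N = sets borel" by simp
  have m: "shift_density \<sigma> \<mu> \<in> borel_measurable ?N"
    unfolding measurable_cong_sets[OF sets refl] by (rule shift_density_measurable)
  interpret D: prob_space "distr ?N borel (\<lambda>x. \<mu> + x)" by (rule N.prob_space_distr) simp
  have "(\<integral>\<^sup>+x. ennreal (shift_density \<sigma> \<mu> x) \<partial>?N) = emeasure (distr ?N borel (\<lambda>x. \<mu> + x)) (space ?N)"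
    unfolding normal_distr_shift[OF assms] using m by (subst emeasure_density) (auto intro!: nn_integral_cong)
  also have "\<dots> = 1" using D.emeasure_space_1 by simp
  finally have nn: "(\<integral>\<^sup>+x. ennreal (shift_density \<sigma> \<mu> x) \<partial>?N) = 1" .
  show 1: "integrable ?N (shift_density \<sigma> \<mu>)"
    using nn m by (intro integrableI_nonneg) (auto simp: shift_density_def)
  show "(\<integral>x. shift_density \<sigma> \<mu> x \<partial>?N) = 1"
    using nn_integral_eq_integral[OF 1] nn by simp
qed

text \<open>
  Squaring the likelihood ratio for the shift \<open>\<mu>\<close> gives a multiple of the ratio for \<open>2\<mu>\<close>, which
  integrates to one.
\<close>

lemma shift_density_square_integral:
  assumes "0 < \<sigma>"
  shows "integrable (density lborel (normal_density 0 \<sigma>)) (\<lambda>x. (shift_density \<sigma> \<mu> x)\<^sup>2)"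
    "(\<integral>x. (shift_density \<sigma> \<mu> x)\<^sup>2 \<partial>density lborel (normal_density 0 \<sigma>)) = exp (\<mu>\<^sup>2 / \<sigma>\<^sup>2)"
proof -
  have "(shift_density \<sigma> \<mu> x)\<^sup>2 = exp (\<mu>\<^sup>2 / \<sigma>\<^sup>2) * shift_density \<sigma> (2 * \<mu>) x" for x
    using assms by (simp add: shift_density_def exp_double[symmetric] exp_add[symmetric] field_simps power2_eq_square)
  thus "integrable (density lborel (normal_density 0 \<sigma>)) (\<lambda>x. (shift_density \<sigma> \<mu> x)\<^sup>2)"
    "(\<integral>x. (shift_density \<sigma> \<mu> x)\<^sup>2 \<partial>density lborel (normal_density 0 \<sigma>)) = exp (\<mu>\<^sup>2 / \<sigma>\<^sup>2)"
    using shift_density_integral[OF assms, of "2 * \<mu>"] by simp_all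
qed

lemma noise_distr_shift:
  assumes \<sigma>: "0 < \<sigma>"
  shows "distr (noise_law n \<sigma>) (noise_law n \<sigma>) (\<lambda>u. \<lambda>l\<in>{..<n}. \<mu> l + u l)
    = density (noise_law n \<sigma>) (\<lambda>u. \<Prod>l<n. ennreal (shift_density \<sigma> (\<mu> l) (u l)))"
    (is "distr ?M ?M ?T = density ?M ?L")
proof -
  let ?N = "density lborel (normal_density 0 \<sigma>)"
  define N' where "N' l = density ?N (\<lambda>x. ennreal (shift_density \<sigma> (\<mu> l) x))" for l
  interpret N: prob_space ?N by (rule prob_space_normal_density[OF \<sigma>])
  interpret F: product_sigma_finite "\<lambda>_::nat. ?N"
    by (simp add: product_sigma_finite_def N.sigma_finite_measure)
  have N': "N' l = distr ?N borel (\<lambda>x. \<mu> l + x)" for l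
    unfolding N'_def by (rule normal_distr_shift[OF \<sigma>, symmetric])
  have "prob_space (N' l)" for l unfolding N' by (rule N.prob_space_distr) simp
  hence "sigma_finite_measure (N' l)" for l by (rule prob_space_imp_sigma_finite)
  then interpret F': product_sigma_finite N' by (simp add: product_sigma_finite_def)
  have sets': "sets (PiM {..<n} N') = sets ?M"
    unfolding noise_law_def by (intro sets_PiM_cong) (auto simp: N'_def)
  have T: "?T \<in> ?M \<rightarrow>\<^sub>M ?M"
    unfolding measurable_cong_sets[OF refl sets_noise] by (intro measurable_restrict) simp
  have Lm: "?L \<in> borel_measurable ?M" by measurable
  have "distr ?M ?M ?T = PiM {..<n} N'"
  proof (rule F'.PiM_eqI)
    fix A assume A': "\<And>l. l \<in> {..<n} \<Longrightarrow> A l \<in> sets (N' l)"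
    have A: "A l \<in> sets borel" if "l < n" for l using A'[of l] that by (simp add: N'_def)
    have Ash: "(\<lambda>x. \<mu> l + x) -` A l \<in> sets borel" if "l < n" for l
      using measurable_sets[of "\<lambda>x. \<mu> l + x" borel borel "A l"] A[OF that] by simp
    have AP: "(\<Pi>\<^sub>E l\<in>{..<n}. A l) \<in> sets ?M"
      unfolding sets_noise using A by (intro sets_PiM_I_finite) auto
    have "?T -` (\<Pi>\<^sub>E l\<in>{..<n}. A l) \<inter> space ?M = (\<Pi>\<^sub>E l\<in>{..<n}. (\<lambda>x. \<mu> l + x) -` A l)"
      by (rule Set.set_eqI) (simp add: PiE_iff space_noise conj_commute Ball_def)
    hence "emeasure (distr ?M ?M ?T) (\<Pi>\<^sub>E l\<in>{..<n}. A l) = emeasure ?M (\<Pi>\<^sub>E l\<in>{..<n}. (\<lambda>x. \<mu> l + x) -` A l)"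
      by (simp add: emeasure_distr[OF T AP])
    also have "\<dots> = (\<Prod>l<n. emeasure ?N ((\<lambda>x. \<mu> l + x) -` A l))"
      unfolding noise_law_def using Ash by (intro F.emeasure_PiM) auto
    also have "\<dots> = (\<Prod>l<n. emeasure (N' l) (A l))"
      unfolding N' using A by (intro prod.cong refl) (simp add: emeasure_distr)
    finally show "emeasure (distr ?M ?M ?T) (\<Pi>\<^sub>E l\<in>{..<n}. A l) = (\<Prod>l<n. emeasure (N' l) (A l))" .
  qed (simp_all add: sets')
  moreover have "density ?M ?L = PiM {..<n} N'"
  proof (rule F'.PiM_eqI)
    fix A assume A': "\<And>l. l \<in> {..<n} \<Longrightarrow> A l \<in> sets (N' l)"
    have A: "A l \<in> sets borel" if "l < n" for l using A'[of l] that by (simp add: N'_def)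
    have AP: "(\<Pi>\<^sub>E l\<in>{..<n}. A l) \<in> sets ?M"
      unfolding sets_noise using A by (intro sets_PiM_I_finite) auto
    have "emeasure (density ?M ?L) (\<Pi>\<^sub>E l\<in>{..<n}. A l)
        = (\<integral>\<^sup>+u. (\<Prod>l<n. ennreal (shift_density \<sigma> (\<mu> l) (u l)) * indicator (A l) (u l)) \<partial>?M)"
    proof (subst emeasure_density[OF Lm AP], rule nn_integral_cong)
      fix u assume "u \<in> space ?M"
      hence "u \<in> (\<Pi>\<^sub>E l\<in>{..<n}. A l) \<longleftrightarrow> (\<forall>l<n. u l \<in> A l)"
        by (simp add: PiE_iff space_noise Ball_def)
      hence "indicator (\<Pi>\<^sub>E l\<in>{..<n}. A l) u = (\<Prod>l<n. indicator (A l) (u l) :: ennreal)"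
        by (auto simp: indicator_def intro!: prod_zero[symmetric])
      thus "?L u * indicator (\<Pi>\<^sub>E l\<in>{..<n}. A l) u = (\<Prod>l<n. ennreal (shift_density \<sigma> (\<mu> l) (u l)) * indicator (A l) (u l))"
        by (simp add: prod.distrib)
    qed
    also have "\<dots> = (\<Prod>l<n. \<integral>\<^sup>+x. ennreal (shift_density \<sigma> (\<mu> l) x) * indicator (A l) x \<partial>?N)"
      unfolding noise_law_def using A by (intro F.product_nn_integral_prod) auto
    also have "\<dots> = (\<Prod>l<n. emeasure (N' l) (A l))"
      unfolding N'_def using A by (intro prod.cong refl) (subst emeasure_density, auto)
    finally show "emeasure (density ?M ?L) (\<Pi>\<^sub>E l\<in>{..<n}. A l) = (\<Prod>l<n. emeasure (N' l) (A l))" .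
  qed (simp_all add: sets')
  ultimately show ?thesis by simp
qed

theorem noise_shift_bounds:
  fixes \<mu> :: "nat \<Rightarrow> real"
  assumes \<sigma>: "0 < \<sigma>" and E: "E \<in> sets (noise_law n \<sigma>)"
  defines "E' \<equiv> {u\<in>space (noise_law n \<sigma>). (\<lambda>l\<in>{..<n}. \<mu> l + u l) \<in> E}"
  shows "measure (noise_law n \<sigma>) E' \<le> sqrt (exp ((\<Sum>l<n. (\<mu> l)\<^sup>2) / \<sigma>\<^sup>2) * measure (noise_law n \<sigma>) E)"
    and "\<bar>measure (noise_law n \<sigma>) E' - measure (noise_law n \<sigma>) E\<bar> \<le> sqrt (exp ((\<Sum>l<n. (\<mu> l)\<^sup>2) / \<sigma>\<^sup>2) - 1)"
proof -
  let ?M = "noise_law n \<sigma>" and ?N = "density lborel (normal_density 0 \<sigma>)"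
  interpret M: prob_space ?M by (rule noise_prob_space[OF \<sigma>])
  interpret N: prob_space ?N by (rule prob_space_normal_density[OF \<sigma>])
  interpret F: product_sigma_finite "\<lambda>_::nat. ?N"
    by (simp add: product_sigma_finite_def N.sigma_finite_measure)
  define L where "L u = (\<Prod>l<n. shift_density \<sigma> (\<mu> l) (u l))" for u :: "nat \<Rightarrow> real"
  have L0: "0 \<le> L u" for u unfolding L_def by (intro prod_nonneg) (simp add: shift_density_def)
  have Lm: "L \<in> borel_measurable ?M" unfolding L_def by measurable
  have L1: "integrable ?M L" "(\<integral>u. L u \<partial>?M) = 1"
    using F.product_integrable_prod[of "{..<n}" "\<lambda>l. shift_density \<sigma> (\<mu> l)"]
      F.product_integral_prod[of "{..<n}" "\<lambda>l. shift_density \<sigma> (\<mu> l)"] shift_density_integral[OF \<sigma>]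
    by (simp_all add: L_def[abs_def] noise_law_def)
  have L2: "integrable ?M (\<lambda>u. (L u)\<^sup>2)" "(\<integral>u. (L u)\<^sup>2 \<partial>?M) = exp ((\<Sum>l<n. (\<mu> l)\<^sup>2) / \<sigma>\<^sup>2)"
    using F.product_integrable_prod[of "{..<n}" "\<lambda>l x. (shift_density \<sigma> (\<mu> l) x)\<^sup>2"]
      F.product_integral_prod[of "{..<n}" "\<lambda>l x. (shift_density \<sigma> (\<mu> l) x)\<^sup>2"] shift_density_square_integral[OF \<sigma>]
    by (simp_all add: L_def[abs_def] noise_law_def sum_divide_distrib exp_sum flip: prod_power_distrib)
  have T: "(\<lambda>u. \<lambda>l\<in>{..<n}. \<mu> l + u l) \<in> ?M \<rightarrow>\<^sub>M ?M"
    unfolding measurable_cong_sets[OF refl sets_noise] by (intro measurable_restrict) simp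
  have "emeasure ?M E' = emeasure (distr ?M ?M (\<lambda>u. \<lambda>l\<in>{..<n}. \<mu> l + u l)) E"
    unfolding E'_def by (subst emeasure_distr[OF T E]) (auto intro!: arg_cong[where f = "emeasure _"])
  also have "\<dots> = (\<integral>\<^sup>+u. ennreal (L u * indicator E u) \<partial>?M)"
    unfolding noise_distr_shift[OF \<sigma>] using E Lm
    by (subst emeasure_density) (auto simp: L_def indicator_def prod_ennreal shift_density_def intro!: nn_integral_cong)
  also have "\<dots> = ennreal (\<integral>u. L u * indicator E u \<partial>?M)"
    using L0 L1 E by (intro nn_integral_eq_integral integrable_real_mult_indicator) auto
  finally have m: "measure ?M E' = (\<integral>u. L u * indicator E u \<partial>?M)"
    using L0 by (simp add: measure_def integral_nonneg)
  show "measure ?M E' \<le> sqrt (exp ((\<Sum>l<n. (\<mu> l)\<^sup>2) / \<sigma>\<^sup>2) * measure ?M E)"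
    unfolding m L2(2)[symmetric] by (rule M.density_prob_le_sqrt[OF Lm L0 L2(1) L1(1) E])
  show "\<bar>measure ?M E' - measure ?M E\<bar> \<le> sqrt (exp ((\<Sum>l<n. (\<mu> l)\<^sup>2) / \<sigma>\<^sup>2) - 1)"
    unfolding m L2(2)[symmetric] by (rule M.density_prob_diff_le[OF L2(1) L1 E])
qed

section \<open>Concentration of the residual standard deviation\<close>

lemma std_normal_moments:
  "integrable std_normal_distribution (\<lambda>x. x\<^sup>2)" "(\<integral>x. x\<^sup>2 \<partial>std_normal_distribution) = 1"
  "integrable std_normal_distribution (\<lambda>x. (x\<^sup>2 - 1)\<^sup>2)" "(\<integral>x. (x\<^sup>2 - 1)\<^sup>2 \<partial>std_normal_distribution) = 2"
proof -
  interpret N: prob_space std_normal_distribution by (rule std_normal_prob)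
  have m: "has_bochner_integral std_normal_distribution (\<lambda>x. x ^ (2 * k)) (fact (2 * k) / (2 ^ k * fact k))" for k
    using std_normal_moment_even[of k]
    by (intro has_bochner_integral_density) auto
  have 2: "has_bochner_integral std_normal_distribution (\<lambda>x. x\<^sup>2) 1"
    using m[of 1] by simp
  have 4: "has_bochner_integral std_normal_distribution (\<lambda>x. x ^ 4) 3"
    using m[of 2] by (simp add: fact_numeral)
  have e: "(x\<^sup>2 - 1)\<^sup>2 = x ^ 4 - 2 * x\<^sup>2 + 1" for x :: real
    by (simp add: power2_diff flip: power_mult)
  show "integrable std_normal_distribution (\<lambda>x. x\<^sup>2)" "(\<integral>x. x\<^sup>2 \<partial>std_normal_distribution) = 1"
    using 2 by (auto simp: has_bochner_integral_iff)
  show "integrable std_normal_distribution (\<lambda>x. (x\<^sup>2 - 1)\<^sup>2)" "(\<integral>x. (x\<^sup>2 - 1)\<^sup>2 \<partial>std_normal_distribution) = 2"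
    unfolding e using 2 4 N.prob_space by (auto simp: has_bochner_integral_iff)
qed

lemma noise_linear_square_integral:
  assumes \<sigma>: "0 < \<sigma>" and v: "(\<Sum>l<n. (v l)\<^sup>2) = 1"
  shows "integrable (noise_law n \<sigma>) (\<lambda>u. (\<Sum>l<n. v l * u l)\<^sup>2)"
    "(\<integral>u. (\<Sum>l<n. v l * u l)\<^sup>2 \<partial>noise_law n \<sigma>) = \<sigma>\<^sup>2"
proof -
  let ?f = "\<lambda>u. (\<Sum>l<n. v l * u l) / \<sigma>"
  have f: "?f \<in> borel_measurable (noise_law n \<sigma>)" by measurable
  have d: "distr (noise_law n \<sigma>) borel ?f = std_normal_distribution" by (rule noise_linear_distr[OF assms])
  have e: "(\<Sum>l<n. v l * u l)\<^sup>2 = \<sigma>\<^sup>2 * (?f u)\<^sup>2" for u using \<sigma> by (simp add: power_divide)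
  have "integrable (noise_law n \<sigma>) (\<lambda>u. (?f u)\<^sup>2)"
    using std_normal_moments(1) unfolding d[symmetric] by (subst (asm) integrable_distr_eq[OF f]) auto
  thus "integrable (noise_law n \<sigma>) (\<lambda>u. (\<Sum>l<n. v l * u l)\<^sup>2)" unfolding e by simp
  have "(\<integral>u. (?f u)\<^sup>2 \<partial>noise_law n \<sigma>) = 1"
    using std_normal_moments(2) unfolding d[symmetric] by (subst (asm) integral_distr[OF f]) auto
  thus "(\<integral>u. (\<Sum>l<n. v l * u l)\<^sup>2 \<partial>noise_law n \<sigma>) = \<sigma>\<^sup>2" unfolding e by simp
qed

text \<open>
  The squared deviations are uncorrelated, so the second moment of their sum is of order \<open>n\<close>. Averaging
  \<open>\<bar>x\<bar> \<le> (x\<^sup>2 / \<surd>n + \<surd>n) / 2\<close> turns this into a bound of order \<open>\<surd>n\<close> for the first absolute moment.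
\<close>

lemma noise_sum_squares_deviation:
  assumes \<sigma>: "0 < \<sigma>" and n: "0 < n"
  shows "integrable (noise_law n \<sigma>) (\<lambda>u. \<bar>\<Sum>l<n. (u l)\<^sup>2 - \<sigma>\<^sup>2\<bar>)"
    "(\<integral>u. \<bar>\<Sum>l<n. (u l)\<^sup>2 - \<sigma>\<^sup>2\<bar> \<partial>noise_law n \<sigma>) \<le> sqrt n * (\<sigma> ^ 4 + 1)"
proof -
  let ?M = "noise_law n \<sigma>" and ?N = "density lborel (normal_density 0 \<sigma>)"
  interpret M: prob_space ?M by (rule noise_prob_space[OF \<sigma>])
  interpret N: prob_space ?N by (rule prob_space_normal_density[OF \<sigma>])
  interpret F: product_sigma_finite "\<lambda>_::nat. ?N"
    by (simp add: product_sigma_finite_def N.sigma_finite_measure)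
  define g where "g x = x\<^sup>2 - \<sigma>\<^sup>2" for x :: real
  have gN: "integrable ?N g" "(\<integral>x. g x \<partial>?N) = 0" "integrable ?N (\<lambda>x. (g x)\<^sup>2)" "(\<integral>x. (g x)\<^sup>2 \<partial>?N) = 2 * \<sigma> ^ 4"
  proof -
    interpret S: prob_space std_normal_distribution by (rule std_normal_prob)
    have e: "g (\<sigma> * x) = \<sigma>\<^sup>2 * (x\<^sup>2 - 1)" "(g (\<sigma> * x))\<^sup>2 = \<sigma> ^ 4 * (x\<^sup>2 - 1)\<^sup>2" for x
      by (simp_all add: g_def power_mult_distrib algebra_simps) (simp add: power2_eq_square power4_eq_xxxx algebra_simps)
    have gm: "g \<in> borel_measurable borel" "(\<lambda>x. (g x)\<^sup>2) \<in> borel_measurable borel" unfolding g_def by measurable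
    show "integrable ?N g" "(\<integral>x. g x \<partial>?N) = 0"
      unfolding normal_eq_distr_std_normal[OF \<sigma>] using gm std_normal_moments S.prob_space
      by (simp_all add: integrable_distr_eq integral_distr e)
    show "integrable ?N (\<lambda>x. (g x)\<^sup>2)" "(\<integral>x. (g x)\<^sup>2 \<partial>?N) = 2 * \<sigma> ^ 4"
      unfolding normal_eq_distr_std_normal[OF \<sigma>] using gm std_normal_moments
      by (simp_all add: integrable_distr_eq integral_distr e(2))
  qed
  have gg: "integrable ?M (\<lambda>u. g (u l) * g (u m))"
    "(\<integral>u. g (u l) * g (u m) \<partial>?M) = of_bool (l = m) * (2 * \<sigma> ^ 4)" if lm: "l < n" "m < n" for l m
  proof -
    \<comment> \<open>A product over all coordinates with trivial factors except at \<open>l\<close> and \<open>m\<close>.\<close>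
    define h where "h k x = (if k = l then g x else 1) * (if k = m then g x else 1)" for k x
    have hN: "integrable ?N (h k)" for k
      using gN by (cases "k = l"; cases "k = m") (simp_all add: h_def[abs_def] power2_eq_square)
    have hI: "(\<integral>x. h k x \<partial>?N) = (if k = l \<and> k = m then 2 * \<sigma> ^ 4 else if k = l \<or> k = m then 0 else 1)" for k
      using gN N.prob_space by (cases "k = l"; cases "k = m") (simp_all add: h_def[abs_def] power2_eq_square)
    have h: "(\<Prod>k<n. h k (u k)) = g (u l) * g (u m)" for u
      using lm by (simp add: h_def prod.distrib)
    show "integrable ?M (\<lambda>u. g (u l) * g (u m))"
      using F.product_integrable_prod[of "{..<n}" h] hN unfolding h noise_law_def by simp
    have "(\<integral>u. g (u l) * g (u m) \<partial>?M) = (\<Prod>k<n. \<integral>x. h k x \<partial>?N)"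
      using F.product_integral_prod[of "{..<n}" h] hN unfolding h noise_law_def by simp
    also have "\<dots> = of_bool (l = m) * (2 * \<sigma> ^ 4)"
    proof (cases "l = m")
      case True
      hence "(\<Prod>k<n. \<integral>x. h k x \<partial>?N) = (\<Prod>k<n. if k = l then 2 * \<sigma> ^ 4 else 1)"
        unfolding hI by (intro prod.cong) auto
      also have "\<dots> = 2 * \<sigma> ^ 4" using lm by simp
      finally show ?thesis using True by simp
    next
      case False
      hence "(\<Prod>k<n. \<integral>x. h k x \<partial>?N) = 0" using lm unfolding hI by (intro prod_zero bexI[of _ l]) auto
      thus ?thesis using False by simp
    qed
    finally show "(\<integral>u. g (u l) * g (u m) \<partial>?M) = of_bool (l = m) * (2 * \<sigma> ^ 4)" .
  qed
  define S where "S u = (\<Sum>l<n. g (u l))" for u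
  have S2: "integrable ?M (\<lambda>u. (S u)\<^sup>2)" "(\<integral>u. (S u)\<^sup>2 \<partial>?M) = real n * (2 * \<sigma> ^ 4)"
  proof -
    have e: "(S u)\<^sup>2 = (\<Sum>l<n. \<Sum>m<n. g (u l) * g (u m))" for u by (simp only: S_def power2_eq_square sum_product)
    show "integrable ?M (\<lambda>u. (S u)\<^sup>2)" unfolding e by (intro Bochner_Integration.integrable_sum gg(1)) auto
    have "(\<integral>u. (S u)\<^sup>2 \<partial>?M) = (\<Sum>l<n. \<integral>u. (\<Sum>m<n. g (u l) * g (u m)) \<partial>?M)"
      unfolding e by (intro Bochner_Integration.integral_sum Bochner_Integration.integrable_sum gg(1)) auto
    also have "\<dots> = (\<Sum>l<n. \<Sum>m<n. \<integral>u. g (u l) * g (u m) \<partial>?M)"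
      by (intro sum.cong refl Bochner_Integration.integral_sum gg(1)) auto
    also have "\<dots> = (\<Sum>l<n. \<Sum>m<n. of_bool (l = m) * (2 * \<sigma> ^ 4))"
      by (intro sum.cong refl gg(2)) auto
    also have "\<dots> = (\<Sum>l<n. 2 * \<sigma> ^ 4)"
      by (intro sum.cong refl sum_of_bool_eq(2)) auto
    finally show "(\<integral>u. (S u)\<^sup>2 \<partial>?M) = real n * (2 * \<sigma> ^ 4)" by simp
  qed
  have Sm: "S \<in> borel_measurable ?M" unfolding S_def g_def by measurable
  have bd: "\<bar>S u\<bar> \<le> ((S u)\<^sup>2 / sqrt n + sqrt n) / 2" for u
  proof -
    have "0 \<le> (\<bar>S u\<bar> - sqrt n)\<^sup>2 / sqrt n" by simp
    also have "\<dots> = (S u)\<^sup>2 / sqrt n - 2 * \<bar>S u\<bar> + sqrt n"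
      using n by (simp add: power2_diff diff_divide_distrib add_divide_distrib real_div_sqrt)
    finally show ?thesis by simp
  qed
  have bi: "integrable ?M (\<lambda>u. ((S u)\<^sup>2 / sqrt n + sqrt n) / 2)" using S2 by auto
  have Si: "integrable ?M (\<lambda>u. \<bar>S u\<bar>)"
    by (rule Bochner_Integration.integrable_bound[OF bi]) (use Sm bd in \<open>auto simp: abs_of_nonneg\<close>)
  have Sb: "(\<integral>u. \<bar>S u\<bar> \<partial>?M) \<le> sqrt n * (\<sigma> ^ 4 + 1)"
  proof -
    have "(\<integral>u. \<bar>S u\<bar> \<partial>?M) \<le> (\<integral>u. ((S u)\<^sup>2 / sqrt n + sqrt n) / 2 \<partial>?M)"
      by (rule integral_mono[OF Si bi bd])
    also have "\<dots> = (real n * (2 * \<sigma> ^ 4) / sqrt n + sqrt n) / 2"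
      using S2 M.prob_space by simp
    also have "real n * (2 * \<sigma> ^ 4) / sqrt n = sqrt n * (2 * \<sigma> ^ 4)"
      using n real_div_sqrt[of "real n"] by (simp add: field_simps)
    also have "(sqrt n * (2 * \<sigma> ^ 4) + sqrt n) / 2 \<le> sqrt n * (\<sigma> ^ 4 + 1)"
      by (simp add: field_simps)
    finally show ?thesis .
  qed
  show "integrable (noise_law n \<sigma>) (\<lambda>u. \<bar>\<Sum>l<n. (u l)\<^sup>2 - \<sigma>\<^sup>2\<bar>)"
    "(\<integral>u. \<bar>\<Sum>l<n. (u l)\<^sup>2 - \<sigma>\<^sup>2\<bar> \<partial>noise_law n \<sigma>) \<le> sqrt n * (\<sigma> ^ 4 + 1)"
    using Si Sb by (simp_all add: S_def g_def)
qed

text \<open>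
  Pythagoras for the projection on the span of the directions.
\<close>

lemma residual_sum_squares:
  fixes v :: "nat \<Rightarrow> nat \<Rightarrow> real"
  assumes v: "\<And>r s. r < P \<Longrightarrow> s < P \<Longrightarrow> (\<Sum>l<n. v r l * v s l) = of_bool (r = s)"
  shows "(\<Sum>l<n. (u l - (\<Sum>r<P. v r l * (\<Sum>k<n. v r k * u k)))\<^sup>2)
    = (\<Sum>l<n. (u l)\<^sup>2) - (\<Sum>r<P. (\<Sum>k<n. v r k * u k)\<^sup>2)"
proof -
  define w where "w r = (\<Sum>k<n. v r k * u k)" for r
  have c: "(\<Sum>l<n. u l * (\<Sum>r<P. v r l * w r)) = (\<Sum>r<P. (w r)\<^sup>2)"
  proof -
    have "(\<Sum>l<n. u l * (\<Sum>r<P. v r l * w r)) = (\<Sum>l<n. \<Sum>r<P. w r * (v r l * u l))"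
      by (simp add: sum_distrib_left mult_ac)
    also have "\<dots> = (\<Sum>r<P. \<Sum>l<n. w r * (v r l * u l))" by (rule sum.swap)
    finally show ?thesis by (simp add: w_def power2_eq_square flip: sum_distrib_left)
  qed
  have d: "(\<Sum>l<n. (\<Sum>r<P. v r l * w r)\<^sup>2) = (\<Sum>r<P. (w r)\<^sup>2)"
    by (rule sum_squares_orthonormal[OF v])
  have "(\<Sum>l<n. (u l - (\<Sum>r<P. v r l * w r))\<^sup>2)
     = (\<Sum>l<n. (u l)\<^sup>2) - 2 * (\<Sum>l<n. u l * (\<Sum>r<P. v r l * w r)) + (\<Sum>l<n. (\<Sum>r<P. v r l * w r)\<^sup>2)"
    by (simp add: power2_diff sum.distrib sum_subtractf sum_distrib_left mult.assoc)
  thus ?thesis unfolding c d by (simp add: w_def)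
qed

text \<open>
  The residual standard deviation as a function of the noise alone.
\<close>

definition noise_scale :: "nat \<Rightarrow> nat \<Rightarrow> (nat \<Rightarrow> nat \<Rightarrow> real) \<Rightarrow> (nat \<Rightarrow> real) \<Rightarrow> real" where
  "noise_scale n P v u = sqrt ((\<Sum>l<n. (u l - (\<Sum>r<P. v r l * (\<Sum>k<n. v r k * u k)))\<^sup>2) / (real n - real P))"

definition scale_rate :: "nat \<Rightarrow> real \<Rightarrow> nat \<Rightarrow> real" where
  "scale_rate P \<sigma> n = (sqrt n * (\<sigma> ^ 4 + 1) + 2 * real P * \<sigma>\<^sup>2) / (real n - real P) / \<sigma>"

lemma scale_rate_tendsto: "(\<lambda>n. scale_rate P \<sigma> n) \<longlonglongrightarrow> 0"
  unfolding scale_rate_def by (cases "\<sigma> = 0") (simp, real_asymp)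

text \<open>
  The residual sum of squares differs from the sum of squared errors by \<open>P\<close> squared scores, each with
  mean \<open>\<sigma>\<^sup>2\<close>; Markov's inequality then gives the rate. The
  directions may vary with the sample size, as the bound does not involve them.
\<close>

lemma noise_scale_concentrates:
  assumes \<sigma>: "0 < \<sigma>" and nP: "P < n" and \<epsilon>: "0 < \<epsilon>"
    and v: "\<And>r s. r < P \<Longrightarrow> s < P \<Longrightarrow> (\<Sum>l<n. v r l * v s l) = of_bool (r = s)"
  shows "{u\<in>space (noise_law n \<sigma>). \<epsilon> \<le> \<bar>noise_scale n P v u - \<sigma>\<bar>} \<in> sets (noise_law n \<sigma>)"
    and "\<P>(u in noise_law n \<sigma>. \<epsilon> \<le> \<bar>noise_scale n P v u - \<sigma>\<bar>) \<le> scale_rate P \<sigma> n / \<epsilon>"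
proof -
  let ?M = "noise_law n \<sigma>"
  interpret M: prob_space ?M by (rule noise_prob_space[OF \<sigma>])
  have [measurable]: "noise_scale n P v \<in> borel_measurable ?M" unfolding noise_scale_def by measurable
  show "{u\<in>space ?M. \<epsilon> \<le> \<bar>noise_scale n P v u - \<sigma>\<bar>} \<in> sets ?M" by measurable
  define d where "d = real n - real P"
  have d: "0 < d" using nP by (simp add: d_def)
  define w where "w r u = (\<Sum>k<n. v r k * u k)" for r u
  define Y where "Y u = (\<bar>\<Sum>l<n. (u l)\<^sup>2 - \<sigma>\<^sup>2\<bar> + (\<Sum>r<P. (w r u)\<^sup>2) + real P * \<sigma>\<^sup>2) / d / \<sigma>" for u
  have wi: "integrable ?M (\<lambda>u. (w r u)\<^sup>2)" "(\<integral>u. (w r u)\<^sup>2 \<partial>?M) = \<sigma>\<^sup>2" if "r < P" for r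
    unfolding w_def using noise_linear_square_integral[OF \<sigma>, of "v r" n] v[OF that that]
    by (simp_all add: power2_eq_square)
  have n: "0 < n" using nP by simp
  have Yi: "integrable ?M Y"
    unfolding Y_def using wi
    by (intro integrable_divide Bochner_Integration.integrable_add Bochner_Integration.integrable_sum
        noise_sum_squares_deviation(1)[OF \<sigma> n] M.integrable_const) auto
  have "(\<integral>u. Y u \<partial>?M) = ((\<integral>u. \<bar>\<Sum>l<n. (u l)\<^sup>2 - \<sigma>\<^sup>2\<bar> \<partial>?M) + (\<Sum>r<P. \<sigma>\<^sup>2) + real P * \<sigma>\<^sup>2) / d / \<sigma>"
  proof -
    have i: "integrable ?M (\<lambda>u. \<Sum>r<P. (w r u)\<^sup>2)" "integrable ?M (\<lambda>u. real P * \<sigma>\<^sup>2)"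
      using wi by (auto intro: Bochner_Integration.integrable_sum)
    note a = noise_sum_squares_deviation(1)[OF \<sigma> n]
    show ?thesis unfolding Y_def integral_divide_zero
        Bochner_Integration.integral_add[OF Bochner_Integration.integrable_add[OF a i(1)] i(2)]
        Bochner_Integration.integral_add[OF a i(1)]
      using wi M.prob_space by (simp add: Bochner_Integration.integral_sum)
  qed
  also have "\<dots> \<le> scale_rate P \<sigma> n"
    unfolding scale_rate_def d_def[symmetric]
    using noise_sum_squares_deviation(2)[OF \<sigma> n] d \<sigma> by (intro divide_right_mono) auto
  finally have YI: "(\<integral>u. Y u \<partial>?M) \<le> scale_rate P \<sigma> n" .
  have dev: "\<bar>noise_scale n P v u - \<sigma>\<bar> \<le> Y u" for u
  proof -
    let ?s = "noise_scale n P v u"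
    have "0 \<le> (\<Sum>l<n. (u l - (\<Sum>r<P. v r l * (\<Sum>k<n. v r k * u k)))\<^sup>2) / d"
      using d by (intro divide_nonneg_nonneg sum_nonneg) auto
    hence s: "0 \<le> ?s" "?s\<^sup>2 = ((\<Sum>l<n. (u l)\<^sup>2) - (\<Sum>r<P. (w r u)\<^sup>2)) / d"
      unfolding noise_scale_def d_def[symmetric] by (simp_all add: residual_sum_squares[OF v] w_def)
    have "?s\<^sup>2 - \<sigma>\<^sup>2 = ((\<Sum>l<n. (u l)\<^sup>2 - \<sigma>\<^sup>2) - (\<Sum>r<P. (w r u)\<^sup>2) + real P * \<sigma>\<^sup>2) / d"
      unfolding s(2) using d by (simp add: sum_subtractf field_simps) (simp add: d_def algebra_simps)
    also have "\<bar>\<dots>\<bar> \<le> (\<bar>\<Sum>l<n. (u l)\<^sup>2 - \<sigma>\<^sup>2\<bar> + (\<Sum>r<P. (w r u)\<^sup>2) + real P * \<sigma>\<^sup>2) / d"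
    proof -
      have tri: "\<bar>x - y + z\<bar> \<le> \<bar>x\<bar> + y + z" if "0 \<le> y" "0 \<le> z" for x y z :: real
        using that by linarith
      have "0 \<le> (\<Sum>r<P. (w r u)\<^sup>2)" "0 \<le> real P * \<sigma>\<^sup>2" by (auto intro: sum_nonneg)
      thus ?thesis unfolding abs_divide abs_of_pos[OF d] using d by (intro divide_right_mono tri) auto
    qed
    finally have 1: "\<bar>?s\<^sup>2 - \<sigma>\<^sup>2\<bar> \<le> \<sigma> * Y u" using \<sigma> by (simp add: Y_def)
    have "?s\<^sup>2 - \<sigma>\<^sup>2 = (?s - \<sigma>) * (?s + \<sigma>)" by (simp add: power2_eq_square algebra_simps)
    hence "\<bar>?s - \<sigma>\<bar> * \<sigma> \<le> \<bar>?s\<^sup>2 - \<sigma>\<^sup>2\<bar>" using s(1) \<sigma> by (auto simp: abs_mult intro: mult_left_mono)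
    with 1 have "\<sigma> * \<bar>?s - \<sigma>\<bar> \<le> \<sigma> * Y u" by (simp add: mult.commute)
    thus ?thesis using \<sigma> by simp
  qed
  have "\<P>(u in ?M. \<epsilon> \<le> \<bar>noise_scale n P v u - \<sigma>\<bar>) \<le> \<P>(u in ?M. \<epsilon> \<le> Y u)"
    using dev Yi by (intro M.finite_measure_mono) (auto intro: order_trans)
  also have "\<dots> \<le> (\<integral>u. Y u \<partial>?M) / \<epsilon>"
    using Yi \<epsilon> dev by (intro integral_Markov_inequality_measure[where A = "{}"]) (auto intro: order_trans[OF abs_ge_zero dev])
  also have "\<dots> \<le> scale_rate P \<sigma> n / \<epsilon>" using YI \<epsilon> by (intro divide_right_mono) auto
  finally show "\<P>(u in ?M. \<epsilon> \<le> \<bar>noise_scale n P v u - \<sigma>\<bar>) \<le> scale_rate P \<sigma> n / \<epsilon>" .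
qed

section \<open>The law of the sample and the selection event\<close>

lemma sum_pick:
  fixes f :: "nat \<Rightarrow> real"
  assumes "m \<le> q" "q \<le> P"
  shows "(\<Sum>p=m..P. f p * of_bool (q = p)) = f q"
proof -
  have "(\<Sum>p=m..P. f p * of_bool (q = p)) = f q * of_bool (q = q) + (\<Sum>p\<in>{m..P} - {q}. f p * of_bool (q = p))"
    using assms by (intro sum.remove) auto
  also have "(\<Sum>p\<in>{m..P} - {q}. f p * of_bool (q = p)) = 0" by (intro sum.neutral) auto
  finally show ?thesis by simp
qed

lemma space_sample_space [simp]: "space (sample_space n) = carrier_vec n"
  by (simp add: sample_space_def)

lemma measurable_sample_component [measurable]:
  assumes "l < n"
  shows "(\<lambda>y. y $ l) \<in> borel_measurable (sample_space n)"
proof -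
  have "(\<lambda>v::real Matrix.vec. \<lambda>i\<in>{..<n}. v $ i) \<in> sample_space n \<rightarrow>\<^sub>M (\<Pi>\<^sub>M i\<in>{..<n}. (borel :: real measure))"
    unfolding sample_space_def by (rule measurable_vimage_algebra1) (simp add: space_PiM)
  hence "(\<lambda>y. (\<lambda>i\<in>{..<n}. y $ i) l) \<in> borel_measurable (sample_space n)"
    by (rule measurable_compose) (rule measurable_component_singleton, use assms in simp)
  thus ?thesis using assms by simp
qed

lemma measurable_observation:
  assumes \<mu>: "\<mu> \<in> carrier_vec n"
  shows "(\<lambda>u. \<mu> + Matrix.vec n u) \<in> noise_law n \<sigma> \<rightarrow>\<^sub>M sample_space n"
  unfolding sample_space_def
proof (rule measurable_vimage_algebra2)
  show "(\<lambda>u. \<mu> + Matrix.vec n u) \<in> space (noise_law n \<sigma>) \<rightarrow> carrier_vec n" using \<mu> by auto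
  have "(\<lambda>u. \<lambda>i\<in>{..<n}. \<mu> $ i + u i) \<in> noise_law n \<sigma> \<rightarrow>\<^sub>M (\<Pi>\<^sub>M i\<in>{..<n}. (borel :: real measure))"
    by (intro measurable_restrict) simp
  moreover have "(\<lambda>i\<in>{..<n}. (\<mu> + Matrix.vec n u) $ i) = (\<lambda>i\<in>{..<n}. \<mu> $ i + u i)" for u
    using \<mu> by (intro restrict_ext) auto
  ultimately show "(\<lambda>u. \<lambda>i\<in>{..<n}. (\<mu> + Matrix.vec n u) $ i) \<in> noise_law n \<sigma> \<rightarrow>\<^sub>M (\<Pi>\<^sub>M i\<in>{..<n}. (borel :: real measure))"
    by simp
qed

text \<open>
  The condition \<open>c m = 0\<close> makes the set of significant orders nonempty, so that its maximum is
  meaningful.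
\<close>

lemma sel_order_iff:
  assumes m: "m \<le> q" "q \<le> dim_col X" and c: "c m = 0"
  shows "sel_order m c X y = q \<longleftrightarrow> c q \<le> \<bar>t_stat X q y\<bar> \<and> (\<forall>p\<in>{q<..dim_col X}. \<bar>t_stat X p y\<bar> < c p)"
proof -
  let ?S = "{p. m \<le> p \<and> p \<le> dim_col X \<and> c p \<le> \<bar>t_stat X p y\<bar>}"
  have "finite ?S" by (rule finite_subset[of _ "{..dim_col X}"]) auto
  moreover have "m \<in> ?S" using m c by simp
  hence "?S \<noteq> {}" by blast
  ultimately have "sel_order m c X y = q \<longleftrightarrow> q \<in> ?S \<and> (\<forall>p\<in>?S. p \<le> q)"
    unfolding sel_order_def by (rule Max_eq_iff)
  also have "(\<forall>p\<in>?S. p \<le> q) \<longleftrightarrow> (\<forall>p\<in>{q<..dim_col X}. \<bar>t_stat X p y\<bar> < c p)"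
  proof (intro iffI ballI)
    fix p assume *: "\<forall>p\<in>?S. p \<le> q" "p \<in> {q<..dim_col X}"
    hence "p \<notin> ?S" by force
    thus "\<bar>t_stat X p y\<bar> < c p" using * m by auto
  next
    fix p assume "\<forall>p\<in>{q<..dim_col X}. \<bar>t_stat X p y\<bar> < c p" "p \<in> ?S"
    thus "p \<le> q" by (force simp: not_less[symmetric])
  qed
  finally show ?thesis using m by simp
qed

text \<open>
  The coefficient of the \<open>r\<close>-th score in component \<open>i\<close> of the scaled error of the target estimator.
\<close>

definition target_coef :: "real mat \<Rightarrow> real mat \<Rightarrow> real \<Rightarrow> nat \<Rightarrow> nat \<Rightarrow> real" where
  "target_coef A S \<sigma> i r = \<sigma> * (\<Sum>j<dim_col A. A $$ (i, j) * gs_coef S r j) / sqrt (gs_coef S r r)"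

text \<open>
  Here \<open>k\<close> is the number of components of the target that are constrained. The value \<open>0\<close> leaves the bare event
  that order \<open>q\<close> is selected, so numerator and denominator of the conditional distribution function are
  treated by the same lemmas.
\<close>

definition good_event :: "nat \<Rightarrow> nat \<Rightarrow> (nat \<Rightarrow> real) \<Rightarrow> real mat \<Rightarrow> real mat \<Rightarrow> real Matrix.vec \<Rightarrow> real Matrix.vec \<Rightarrow> nat \<Rightarrow> real Matrix.vec \<Rightarrow> bool" where
  "good_event k m c A X \<theta> t q y \<longleftrightarrow>
     (\<forall>i<k. (sqrt (real (dim_row X)) \<cdot>\<^sub>v (A *\<^sub>v (pms_estimator m c X y - \<theta>))) $ i \<le> t $ i) \<and> sel_order m c X y = q"

lemma sample_law_diff_aux:
  fixes \<mu>1 \<mu>2 :: "real Matrix.vec"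
  assumes "\<mu>1 \<in> carrier_vec n" "\<mu>2 \<in> carrier_vec n"
  shows "\<mu>2 + Matrix.vec n (\<lambda>l\<in>{..<n}. (\<mu>1 - \<mu>2) $ l + u l) = \<mu>1 + Matrix.vec n u"
  using assms by (intro eq_vecI) auto

context regression
begin

lemma signal_carrier: "X *\<^sub>v \<theta> \<in> carrier_vec n"
  by (rule carrier_vecI) simp

lemma measure_sample_law:
  assumes B: "B \<in> sets (sample_space n)"
  shows "measure (sample_law X \<theta> \<sigma>) B = \<P>(u in noise_law n \<sigma>. X *\<^sub>v \<theta> + Matrix.vec n u \<in> B)"
    "{u\<in>space (noise_law n \<sigma>). X *\<^sub>v \<theta> + Matrix.vec n u \<in> B} \<in> sets (noise_law n \<sigma>)"
proof -
  note m = measurable_observation[OF signal_carrier, of \<theta> \<sigma>]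
  have e: "(\<lambda>u. X *\<^sub>v \<theta> + Matrix.vec n u) -` B \<inter> space (noise_law n \<sigma>)
     = {u\<in>space (noise_law n \<sigma>). X *\<^sub>v \<theta> + Matrix.vec n u \<in> B}" by blast
  show "measure (sample_law X \<theta> \<sigma>) B = \<P>(u in noise_law n \<sigma>. X *\<^sub>v \<theta> + Matrix.vec n u \<in> B)"
    unfolding sample_law_def dim e[symmetric] by (rule measure_distr[OF m B])
  show "{u\<in>space (noise_law n \<sigma>). X *\<^sub>v \<theta> + Matrix.vec n u \<in> B} \<in> sets (noise_law n \<sigma>)"
    unfolding e[symmetric] by (rule measurable_sets[OF m B])
qed

lemma sets_sample_law: "sets (sample_law X \<theta> \<sigma>) = sets (sample_space n)"
  by (simp add: sample_law_def)

lemma space_sample_law: "space (sample_law X \<theta> \<sigma>) = carrier_vec n"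
  by (simp add: sample_law_def)

lemma sample_law_prob_space: "0 < \<sigma> \<Longrightarrow> prob_space (sample_law X \<theta> \<sigma>)"
  unfolding sample_law_def
  by (intro prob_space.prob_space_distr noise_prob_space) (simp_all add: measurable_observation[OF signal_carrier])

text \<open>
  Changing the parameter shifts the noise by the difference of the signals.
\<close>

theorem sample_law_bounds:
  fixes \<theta>1 \<theta>2 :: "real Matrix.vec"
  assumes \<sigma>: "0 < \<sigma>" and B: "B \<in> sets (sample_space n)"
  defines "D \<equiv> (\<Sum>l<n. ((X *\<^sub>v \<theta>1 - X *\<^sub>v \<theta>2) $ l)\<^sup>2)"
  shows "measure (sample_law X \<theta>1 \<sigma>) B \<le> sqrt (exp (D / \<sigma>\<^sup>2) * measure (sample_law X \<theta>2 \<sigma>) B)"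
    and "\<bar>measure (sample_law X \<theta>1 \<sigma>) B - measure (sample_law X \<theta>2 \<sigma>) B\<bar> \<le> sqrt (exp (D / \<sigma>\<^sup>2) - 1)"
proof -
  let ?M = "noise_law n \<sigma>" and ?\<mu> = "\<lambda>l. (X *\<^sub>v \<theta>1 - X *\<^sub>v \<theta>2) $ l"
  define E where "E = {u\<in>space ?M. X *\<^sub>v \<theta>2 + Matrix.vec n u \<in> B}"
  have E: "E \<in> sets ?M" unfolding E_def by (rule measure_sample_law(2)[OF B])
  have "{u\<in>space ?M. (\<lambda>l\<in>{..<n}. ?\<mu> l + u l) \<in> E} = {u\<in>space ?M. X *\<^sub>v \<theta>1 + Matrix.vec n u \<in> B}"
    unfolding E_def by (rule Collect_cong)
      (simp add: sample_law_diff_aux[OF signal_carrier signal_carrier] space_noise del: index_mult_mat_vec index_minus_vec)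
  hence "measure (sample_law X \<theta>1 \<sigma>) B = \<P>(u in ?M. (\<lambda>l\<in>{..<n}. ?\<mu> l + u l) \<in> E)"
    unfolding measure_sample_law(1)[OF B] by simp
  moreover have "measure (sample_law X \<theta>2 \<sigma>) B = measure ?M E"
    unfolding measure_sample_law(1)[OF B] E_def ..
  ultimately show "measure (sample_law X \<theta>1 \<sigma>) B \<le> sqrt (exp (D / \<sigma>\<^sup>2) * measure (sample_law X \<theta>2 \<sigma>) B)"
    and "\<bar>measure (sample_law X \<theta>1 \<sigma>) B - measure (sample_law X \<theta>2 \<sigma>) B\<bar> \<le> sqrt (exp (D / \<sigma>\<^sup>2) - 1)"
    using noise_shift_bounds[OF \<sigma> E, of ?\<mu>] unfolding D_def by simp_all
qed

lemma score_measurable [measurable]: "(\<lambda>y. score X r (($) y)) \<in> borel_measurable (sample_space n)"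
  unfolding score_def dim by measurable

lemma sigma_hat_measurable [measurable]: "sigma_hat X \<in> borel_measurable (sample_space n)"
proof -
  have "(\<lambda>y. sqrt ((\<Sum>l<n. (y $ l - (\<Sum>r<P. direction X r l * score X r (($) y)))\<^sup>2) / (real n - real P)))
     \<in> borel_measurable (sample_space n)" by measurable
  thus ?thesis by (rule measurable_cong[THEN iffD1, rotated]) (simp add: sigma_hat_eq)
qed

lemma t_stat_measurable [measurable]:
  assumes "p \<le> P"
  shows "t_stat X p \<in> borel_measurable (sample_space n)"
proof (cases "p = 0")
  case True
  thus ?thesis by (simp add: t_stat_def[abs_def])
next
  case False
  have "(\<lambda>y. score X (p - 1) (($) y) / sigma_hat X y) \<in> borel_measurable (sample_space n)" by measurable
  thus ?thesis by (rule measurable_cong[THEN iffD1, rotated]) (use False assms in \<open>simp add: t_stat_eq\<close>)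
qed

lemma restricted_ls_measurable [measurable]:
  assumes "p \<le> P" "i < P"
  shows "(\<lambda>y. restricted_ls X p y $ i) \<in> borel_measurable (sample_space n)"
proof -
  have "(\<lambda>y. \<Sum>r<p. a r i / (sqrt (real n) * sqrt (xi_sq X r)) * score X r (($) y)) \<in> borel_measurable (sample_space n)"
    by measurable
  thus ?thesis by (rule measurable_cong[THEN iffD1, rotated]) (use assms in \<open>simp add: restricted_ls_eq\<close>)
qed

lemma sel_order_sets:
  assumes c: "c m = 0" and q: "m \<le> q" "q \<le> P"
  shows "{y\<in>carrier_vec n. sel_order m c X y = q} \<in> sets (sample_space n)"
proof -
  have "{y\<in>space (sample_space n). c q \<le> \<bar>t_stat X q y\<bar> \<and> (\<forall>p\<in>{q<..P}. \<bar>t_stat X p y\<bar> < c p)} \<in> sets (sample_space n)"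
  proof (intro sets.sets_Collect_conj sets.sets_Collect_finite_All)
    show "{y\<in>space (sample_space n). c q \<le> \<bar>t_stat X q y\<bar>} \<in> sets (sample_space n)"
      by (intro borel_measurable_le borel_measurable_abs borel_measurable_const t_stat_measurable q)
    show "{y\<in>space (sample_space n). \<bar>t_stat X p y\<bar> < c p} \<in> sets (sample_space n)" if "p \<in> {q<..P}" for p
      using that by (intro borel_measurable_less borel_measurable_abs borel_measurable_const t_stat_measurable) simp
  qed simp
  thus ?thesis
    unfolding sel_order_iff[where X = X and m = m and c = c, unfolded dim(2), OF q c] space_sample_space .
qed

lemma cond_cdf_sel_measurable:
  assumes c: "c m = 0"
  shows "cond_cdf_sel m c A X \<theta> \<sigma> t \<in> borel_measurable (sample_space n)"
  unfolding cond_cdf_sel_def[abs_def]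
proof (intro borel_measurable_sum borel_measurable_times borel_measurable_const)
  fix p assume "p \<in> {m..dim_col X}"
  hence p: "m \<le> p" "p \<le> P" by auto
  have "(indicator {y\<in>carrier_vec n. sel_order m c X y = p} :: _ \<Rightarrow> real) \<in> borel_measurable (sample_space n)"
    by (rule borel_measurable_indicator[OF sel_order_sets[where m = m and c = c, OF c p]])
  thus "(\<lambda>y. of_bool (sel_order m c X y = p) :: real) \<in> borel_measurable (sample_space n)"
    by (rule measurable_cong[THEN iffD1, rotated]) (simp add: indicator_def)
qed

lemma error_sets:
  assumes c: "c m = 0" and g: "g \<in> estimators n"
  shows "{y\<in>carrier_vec n. \<delta> < \<bar>g y - cond_cdf_sel m c A X \<theta> \<sigma> t y\<bar>} \<in> sets (sample_space n)"
proof -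
  have "{y\<in>space (sample_space n). \<delta> < \<bar>g y - cond_cdf_sel m c A X \<theta> \<sigma> t y\<bar>} \<in> sets (sample_space n)"
    using g cond_cdf_sel_measurable[where c = c and m = m, OF c, of A \<theta> \<sigma> t] unfolding estimators_def by measurable
  thus ?thesis by simp
qed

lemma cond_cdf_sel_on_event:
  assumes "m \<le> q" "q \<le> P" "sel_order m c X y = q"
  shows "cond_cdf_sel m c A X \<theta> \<sigma> t y = cond_cdf m c A X \<theta> \<sigma> t q"
proof -
  have "cond_cdf_sel m c A X \<theta> \<sigma> t y = (\<Sum>p=m..P. cond_cdf m c A X \<theta> \<sigma> t p * of_bool (sel_order m c X y = p))"
    unfolding cond_cdf_sel_def dim(2) ..
  also have "\<dots> = cond_cdf m c A X \<theta> \<sigma> t (sel_order m c X y)"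
    by (rule sum_pick) (use assms in auto)
  finally show ?thesis unfolding assms(3) .
qed

lemma pms_on_event:
  assumes "m \<le> q" "q \<le> P" "sel_order m c X y = q" "j < P"
  shows "pms_estimator m c X y $ j = restricted_ls X q y $ j"
proof -
  have "pms_estimator m c X y $ j = (\<Sum>p=m..P. restricted_ls X p y $ j * of_bool (sel_order m c X y = p))"
    unfolding pms_estimator_def dim(2) by (rule index_vec[OF assms(4)])
  also have "\<dots> = restricted_ls X (sel_order m c X y) y $ j"
    by (rule sum_pick) (use assms in auto)
  finally show ?thesis unfolding assms(3) .
qed

lemma good_event_sets:
  assumes c: "c m = 0" and q: "m \<le> q" "q \<le> P" and A: "A \<in> carrier_mat k P" and k': "k' \<le> k" and \<theta>: "\<theta> \<in> carrier_vec P"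
  shows "{y\<in>carrier_vec n. good_event k' m c A X \<theta> t q y} \<in> sets (sample_space n)"
proof -
  have h: "{y\<in>space (sample_space n). \<forall>i\<in>{..<k'}. sqrt (real n) * (\<Sum>j<P. A $$ (i, j) * (restricted_ls X q y $ j - \<theta> $ j)) \<le> t $ i} \<in> sets (sample_space n)"
  proof (rule sets.sets_Collect_finite_All)
    fix i
    have "(\<lambda>y. sqrt (real n) * (\<Sum>j<P. A $$ (i, j) * (restricted_ls X q y $ j - \<theta> $ j))) \<in> borel_measurable (sample_space n)"
      using q by (intro borel_measurable_times borel_measurable_const borel_measurable_sum borel_measurable_diff restricted_ls_measurable) auto
    thus "{y\<in>space (sample_space n). sqrt (real n) * (\<Sum>j<P. A $$ (i, j) * (restricted_ls X q y $ j - \<theta> $ j)) \<le> t $ i} \<in> sets (sample_space n)"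
      by measurable
  qed simp
  have "{y\<in>carrier_vec n. \<forall>i\<in>{..<k'}. sqrt (real n) * (\<Sum>j<P. A $$ (i, j) * (restricted_ls X q y $ j - \<theta> $ j)) \<le> t $ i}
     \<inter> {y\<in>carrier_vec n. sel_order m c X y = q} \<in> sets (sample_space n)"
    by (rule sets.Int[OF h[unfolded space_sample_space] sel_order_sets[where m = m and c = c, OF c q]])
  also have "{y\<in>carrier_vec n. \<forall>i\<in>{..<k'}. sqrt (real n) * (\<Sum>j<P. A $$ (i, j) * (restricted_ls X q y $ j - \<theta> $ j)) \<le> t $ i}
     \<inter> {y\<in>carrier_vec n. sel_order m c X y = q} = {y\<in>carrier_vec n. good_event k' m c A X \<theta> t q y}"
  proof -
    have "(sqrt (real n) \<cdot>\<^sub>v (A *\<^sub>v (pms_estimator m c X y - \<theta>))) $ i = sqrt (real n) * (\<Sum>j<P. A $$ (i, j) * (restricted_ls X q y $ j - \<theta> $ j))"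
      if "sel_order m c X y = q" "i < k'" for y i
      using that A k' \<theta> pms_on_event[OF q that(1)]
      by (auto simp: scalar_prod_def lessThan_atLeast0 intro!: sum.cong)
    thus ?thesis by (auto simp: good_event_def)
  qed
  finally show ?thesis .
qed

lemma observation_score:
  "score X r (($) (X *\<^sub>v \<theta> + Matrix.vec n u)) = score X r (($) (X *\<^sub>v \<theta>)) + score X r u"
  by (subst score_add[symmetric]) (auto simp: score_def signal_carrier[THEN carrier_vecD] intro!: sum.cong)

lemma signal_fitted:
  assumes \<theta>: "\<theta> \<in> submodel P q" and q: "q \<le> P" and l: "l < n"
  shows "(X *\<^sub>v \<theta>) $ l = (\<Sum>r<P. direction X r l * score X r (($) (X *\<^sub>v \<theta>)))"
proof -
  have \<theta>': "\<theta> \<in> submodel P P" using \<theta> by (auto simp: submodel_def)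
  have "restricted_ls X P (X *\<^sub>v \<theta>) = \<theta>"
  proof (rule eq_vecI)
    show "dim_vec (restricted_ls X P (X *\<^sub>v \<theta>)) = dim_vec \<theta>" using \<theta> by (auto simp: restricted_ls_def submodel_def)
    fix i assume "i < dim_vec \<theta>"
    hence "i < P" using \<theta> by (auto simp: submodel_def)
    thus "restricted_ls X P (X *\<^sub>v \<theta>) $ i = \<theta> $ i"
      using signal_reproduced[OF \<theta>'] by (simp add: restricted_ls_eq[OF signal_carrier])
  qed
  thus ?thesis using fitted_eq[OF signal_carrier l, of \<theta>] by simp
qed

text \<open>
  The signal is reproduced exactly by the full model, so the residuals are those of the noise.
\<close>

lemma observation_sigma_hat:
  assumes \<theta>: "\<theta> \<in> submodel P q" and q: "q \<le> P"
  shows "sigma_hat X (X *\<^sub>v \<theta> + Matrix.vec n u) = noise_scale n P (direction X) u"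
proof -
  have y: "X *\<^sub>v \<theta> + Matrix.vec n u \<in> carrier_vec n" using signal_carrier[of \<theta>] by simp
  have eq: "(X *\<^sub>v \<theta> + Matrix.vec n u) $ l - (\<Sum>r<P. direction X r l * score X r (($) (X *\<^sub>v \<theta> + Matrix.vec n u)))
      = u l - (\<Sum>r<P. direction X r l * score X r u)" if l: "l < n" for l
  proof -
    have "(X *\<^sub>v \<theta> + Matrix.vec n u) $ l = (X *\<^sub>v \<theta>) $ l + u l" using l X by simp
    thus ?thesis
      unfolding observation_score distrib_left sum.distrib signal_fitted[OF \<theta> q l, symmetric] by simp
  qed
  have "(\<Sum>l<n. ((X *\<^sub>v \<theta> + Matrix.vec n u) $ l
        - (\<Sum>r<P. direction X r l * score X r (($) (X *\<^sub>v \<theta> + Matrix.vec n u))))\<^sup>2)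
      = (\<Sum>l<n. (u l - (\<Sum>r<P. direction X r l * score X r u))\<^sup>2)"
    by (intro sum.cong refl) (simp only: lessThan_iff eq)
  thus ?thesis unfolding sigma_hat_eq[OF y] noise_scale_def score_def[of X _ u, unfolded dim, symmetric]
    by (simp only:)
qed

text \<open>
  For a parameter of order \<open>s + 1\<close> the estimator has no bias on the selection event, so the
  scaled error is linear in the first \<open>s + 1\<close> scores; only the test of order \<open>s + 1\<close> contains the local
  shift, and the higher tests are centred. Positivity of the estimated noise level is needed to clear
  denominators.
\<close>

lemma good_event_iff:
  assumes \<theta>: "\<theta> \<in> submodel P (Suc s)" and s: "Suc s \<le> P" and m: "m \<le> Suc s" and c: "c m = 0"
    and A: "A \<in> carrier_mat k P" and k': "k' \<le> k" and \<sigma>: "0 < \<sigma>"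
    and pos: "0 < noise_scale n P (direction X) u"
  defines "z \<equiv> (\<lambda>r\<in>{..<P}. score X r u / \<sigma>)" and "b \<equiv> noise_scale n P (direction X) u"
  shows "good_event k' m c A X \<theta> t (Suc s) (X *\<^sub>v \<theta> + Matrix.vec n u) \<longleftrightarrow>
    below_target k' (Suc s) (target_coef A S \<sigma>) (($) t) z
    \<and> exceeds s \<sigma> (sqrt (real n) * \<theta> $ s / sqrt (xi_sq X s)) (c (Suc s) * b) z
    \<and> insignificant P (Suc s) c \<sigma> b z"
proof -
  let ?y = "X *\<^sub>v \<theta> + Matrix.vec n u"
  have y: "?y \<in> carrier_vec n" using signal_carrier[of \<theta>] by simp
  have sP: "s < P" using s by simp
  have b: "0 < b" using pos by (simp add: b_def)
  have dimA: "dim_row A = k" "dim_col A = P" using A by auto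
  have dth: "dim_vec \<theta> = P" using \<theta> by (auto simp: submodel_def)
  have t: "t_stat X p ?y = score X (p - 1) (($) ?y) / b" if "0 < p" "p \<le> P" for p
    using t_stat_eq[OF y that] by (simp add: observation_sigma_hat[OF \<theta> s] b_def)
  have ts: "t_stat X (Suc s) ?y = (sqrt (real n) * \<theta> $ s / sqrt (xi_sq X s) + \<sigma> * z s) / b"
    using t[of "Suc s"] s \<sigma> by (simp add: observation_score score_signal_top[OF \<theta> sP] z_def)
  have tr: "t_stat X (Suc r) ?y = \<sigma> * z r / b" if "Suc s \<le> r" "r < P" for r
    using t[of "Suc r"] that \<sigma> by (simp add: observation_score score_signal_above[OF \<theta>] z_def)
  have "sel_order m c X ?y = Suc s \<longleftrightarrow> c (Suc s) \<le> \<bar>t_stat X (Suc s) ?y\<bar> \<and> (\<forall>p\<in>{Suc s<..P}. \<bar>t_stat X p ?y\<bar> < c p)"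
    using sel_order_iff[of m "Suc s" X c] m s c by simp
  also have "(\<forall>p\<in>{Suc s<..P}. \<bar>t_stat X p ?y\<bar> < c p) \<longleftrightarrow> (\<forall>r\<in>{Suc s..<P}. \<bar>t_stat X (Suc r) ?y\<bar> < c (Suc r))"
  proof safe
    fix p assume *: "\<forall>r\<in>{Suc s..<P}. \<bar>t_stat X (Suc r) ?y\<bar> < c (Suc r)" "p \<in> {Suc s<..P}"
    then obtain r where "p = Suc r" by (cases p) auto
    thus "\<bar>t_stat X p ?y\<bar> < c p" using * by auto
  qed auto
  also have "\<dots> \<longleftrightarrow> insignificant P (Suc s) c \<sigma> b z"
    using b by (auto simp: insignificant_def tr pos_divide_less_eq)
  also have "c (Suc s) \<le> \<bar>t_stat X (Suc s) ?y\<bar> \<longleftrightarrow> exceeds s \<sigma> (sqrt (real n) * \<theta> $ s / sqrt (xi_sq X s)) (c (Suc s) * b) z"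
    using b by (simp add: exceeds_def ts pos_le_divide_eq)
  finally have sel: "sel_order m c X ?y = Suc s \<longleftrightarrow>
    exceeds s \<sigma> (sqrt (real n) * \<theta> $ s / sqrt (xi_sq X s)) (c (Suc s) * b) z \<and> insignificant P (Suc s) c \<sigma> b z" .
  have tgt: "(sqrt (real n) \<cdot>\<^sub>v (A *\<^sub>v (pms_estimator m c X ?y - \<theta>))) $ i = (\<Sum>r<Suc s. target_coef A S \<sigma> i r * z r)"
    if i: "i < k'" and se: "sel_order m c X ?y = Suc s" for i
  proof -
    have est: "pms_estimator m c X ?y $ j - \<theta> $ j
        = (\<Sum>r<Suc s. a r j / (sqrt (real n) * sqrt (xi_sq X r)) * (\<sigma> * z r))" if j: "j < P" for j
    proof -
      have "pms_estimator m c X ?y $ j = (\<Sum>r<Suc s. a r j / (sqrt (real n) * sqrt (xi_sq X r)) * (score X r (($) (X *\<^sub>v \<theta>)) + score X r u))"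
        unfolding pms_on_event[OF m s se j] restricted_ls_eq[OF y s j] observation_score ..
      also have "\<dots> = \<theta> $ j + (\<Sum>r<Suc s. a r j / (sqrt (real n) * sqrt (xi_sq X r)) * score X r u)"
        unfolding distrib_left sum.distrib signal_reproduced[OF \<theta> s j] ..
      also have "(\<Sum>r<Suc s. a r j / (sqrt (real n) * sqrt (xi_sq X r)) * score X r u)
          = (\<Sum>r<Suc s. a r j / (sqrt (real n) * sqrt (xi_sq X r)) * (\<sigma> * z r))"
        using s \<sigma> by (intro sum.cong refl) (simp add: z_def)
      finally show ?thesis by simp
    qed
    have "(sqrt (real n) \<cdot>\<^sub>v (A *\<^sub>v (pms_estimator m c X ?y - \<theta>))) $ i
        = sqrt (real n) * (\<Sum>j<P. A $$ (i, j) * (pms_estimator m c X ?y $ j - \<theta> $ j))"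
      using i k' dimA dth by (auto simp: scalar_prod_def lessThan_atLeast0 intro!: sum.cong)
    also have "\<dots> = sqrt (real n) * (\<Sum>j<P. \<Sum>r<Suc s. A $$ (i, j) * (a r j / (sqrt (real n) * sqrt (xi_sq X r)) * (\<sigma> * z r)))"
      by (simp add: est sum_distrib_left del: sum.lessThan_Suc)
    also have "\<dots> = sqrt (real n) * (\<Sum>r<Suc s. \<Sum>j<P. A $$ (i, j) * (a r j / (sqrt (real n) * sqrt (xi_sq X r)) * (\<sigma> * z r)))"
      by (simp only: sum.swap[of _ "{..<P}"])
    also have "\<dots> = (\<Sum>r<Suc s. target_coef A S \<sigma> i r * z r)"
    proof -
      have "sqrt (real n) * (\<Sum>j<P. A $$ (i, j) * (a r j / (sqrt (real n) * sqrt (xi_sq X r)) * (\<sigma> * z r)))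
          = target_coef A S \<sigma> i r * z r" for r
        unfolding target_coef_def dimA xi_sq_def sum_distrib_left sum_distrib_right sum_divide_distrib
        using n0 by (intro sum.cong refl) (simp add: field_simps)
      thus ?thesis by (simp only: sum_distrib_left[of "sqrt (real n)" _ "{..<Suc s}"])
    qed
    finally show ?thesis .
  qed
  show ?thesis unfolding good_event_def dim sel[symmetric] below_target_def using tgt by auto
qed

text \<open>
  The estimated noise level is dependent on the sample, but the selection event is monotone in the
  noise level in each of the two places where it occurs. Outside an exceptional event of small probability the level
  may thus be replaced by the constants \<open>\<sigma> - \<epsilon>\<close> and \<open>\<sigma> + \<epsilon>\<close>, and what remains has a probability under the
  fixed Gaussian law.
\<close>

theorem good_event_sandwich:
  fixes t \<theta> :: "real Matrix.vec"
  assumes \<theta>: "\<theta> \<in> submodel P (Suc s)" and s: "Suc s \<le> P" and m: "m \<le> Suc s" and c: "c m = 0"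
    and cpos: "\<And>p. Suc s \<le> p \<Longrightarrow> p \<le> P \<Longrightarrow> 0 \<le> c p"
    and A: "A \<in> carrier_mat k P" and k': "k' \<le> k" and \<sigma>: "0 < \<sigma>" and \<epsilon>: "0 < \<epsilon>" "\<epsilon> < \<sigma>"
  defines "L \<equiv> \<lambda>b1 b2. \<P>(z in gauss P. below_target k' (Suc s) (target_coef A S \<sigma>) (($) t) z
      \<and> exceeds s \<sigma> (sqrt (real n) * \<theta> $ s / sqrt (xi_sq X s)) (c (Suc s) * b1) z \<and> insignificant P (Suc s) c \<sigma> b2 z)"
    and "p \<equiv> measure (sample_law X \<theta> \<sigma>) {y\<in>carrier_vec n. good_event k' m c A X \<theta> t (Suc s) y}"
  shows "p \<le> L (\<sigma> - \<epsilon>) (\<sigma> + \<epsilon>) + scale_rate P \<sigma> n / \<epsilon>" "L (\<sigma> + \<epsilon>) (\<sigma> - \<epsilon>) - scale_rate P \<sigma> n / \<epsilon> \<le> p"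
proof -
  let ?M = "noise_law n \<sigma>"
  interpret M: prob_space ?M by (rule noise_prob_space[OF \<sigma>])
  have sP: "s < P" using s by simp
  have \<theta>c: "\<theta> \<in> carrier_vec P" using \<theta> by (simp add: submodel_def)
  define Z where "Z u = (\<lambda>r\<in>{..<P}. score X r u / \<sigma>)" for u
  define C where "C b1 b2 z \<longleftrightarrow> below_target k' (Suc s) (target_coef A S \<sigma>) (($) t) z
      \<and> exceeds s \<sigma> (sqrt (real n) * \<theta> $ s / sqrt (xi_sq X s)) (c (Suc s) * b1) z \<and> insignificant P (Suc s) c \<sigma> b2 z" for b1 b2 z
  define G where "G = {u\<in>space ?M. good_event k' m c A X \<theta> t (Suc s) (X *\<^sub>v \<theta> + Matrix.vec n u)}"
  define D where "D = {u\<in>space ?M. \<epsilon> \<le> \<bar>noise_scale n P (direction X) u - \<sigma>\<bar>}"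
  have on: "(\<Sum>l<n. direction X r l * direction X r' l) = of_bool (r = r')" if "r < P" "r' < P" for r r'
    by (rule direction_orthonormal[OF that])
  note D = noise_scale_concentrates[OF \<sigma> nP \<epsilon>(1), where v = "direction X", OF on, folded D_def]
  have es: "{y\<in>carrier_vec n. good_event k' m c A X \<theta> t (Suc s) y} \<in> sets (sample_space n)"
    by (rule good_event_sets[where m = m and c = c, OF c m s A k' \<theta>c])
  have G: "p = measure ?M G" "G \<in> sets ?M"
  proof -
    have "{u\<in>space ?M. X *\<^sub>v \<theta> + Matrix.vec n u \<in> {y\<in>carrier_vec n. good_event k' m c A X \<theta> t (Suc s) y}} = G"
      using signal_carrier[of \<theta>] by (auto simp: G_def)
    thus "p = measure ?M G" "G \<in> sets ?M" using measure_sample_law[OF es, where \<theta> = \<theta> and \<sigma> = \<sigma>] by (simp_all add: p_def)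
  qed
  have Zm: "Z \<in> ?M \<rightarrow>\<^sub>M gauss P" unfolding Z_def score_def dim by (intro measurable_restrict) simp
  have Zd: "distr ?M (gauss P) Z = gauss P"
    unfolding Z_def score_def dim by (rule orthonormal_scores_distr[OF \<sigma> on])
  have Cs: "{z\<in>space (gauss P). C b1 b2 z} \<in> sets (gauss P)" for b1 b2
    unfolding C_def using s sP by measurable
  have LC: "L b1 b2 = \<P>(u in ?M. C b1 b2 (Z u))" "{u\<in>space ?M. C b1 b2 (Z u)} \<in> sets ?M" for b1 b2
  proof -
    have e: "Z -` {z\<in>space (gauss P). C b1 b2 z} \<inter> space ?M = {u\<in>space ?M. C b1 b2 (Z u)}"
      using measurable_space[OF Zm] by auto
    have "L b1 b2 = measure (distr ?M (gauss P) Z) {z\<in>space (gauss P). C b1 b2 z}"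
      unfolding Zd by (simp add: L_def C_def)
    also have "\<dots> = \<P>(u in ?M. C b1 b2 (Z u))" unfolding measure_distr[OF Zm Cs] e ..
    finally show "L b1 b2 = \<P>(u in ?M. C b1 b2 (Z u))" .
    show "{u\<in>space ?M. C b1 b2 (Z u)} \<in> sets ?M" unfolding e[symmetric] by (rule measurable_sets[OF Zm Cs])
  qed
  have mono: "C b1' b2' z" if "C b1 b2 z" "b1' \<le> b1" "b2 \<le> b2'" for b1 b2 b1' b2' z
  proof -
    have "c (Suc s) * b1' \<le> c (Suc s) * b1" using cpos[of "Suc s"] s that by (intro mult_left_mono) auto
    moreover have "c (Suc r) * b2 \<le> c (Suc r) * b2'" if "r \<in> {Suc s..<P}" for r
      using cpos[of "Suc r"] that \<open>b2 \<le> b2'\<close> by (intro mult_left_mono) auto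
    ultimately show ?thesis using that(1) unfolding C_def exceeds_def insignificant_def by (meson order_trans less_le_trans)
  qed
  have iff: "u \<in> G \<longleftrightarrow> C (noise_scale n P (direction X) u) (noise_scale n P (direction X) u) (Z u)"
    if "u \<in> space ?M - D" for u
  proof -
    have us: "u \<in> space ?M" and "\<bar>noise_scale n P (direction X) u - \<sigma>\<bar> < \<epsilon>"
      using that by (auto simp: D_def not_le)
    hence pos: "0 < noise_scale n P (direction X) u" using \<epsilon> by linarith
    show ?thesis
      using good_event_iff[where m = m and c = c and t = t, OF \<theta> s m c A k' \<sigma> pos] us
      by (simp add: G_def C_def Z_def)
  qed
  have "G \<subseteq> {u\<in>space ?M. C (\<sigma> - \<epsilon>) (\<sigma> + \<epsilon>) (Z u)} \<union> D"
  proof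
    fix u assume u: "u \<in> G"
    show "u \<in> {u\<in>space ?M. C (\<sigma> - \<epsilon>) (\<sigma> + \<epsilon>) (Z u)} \<union> D"
    proof (cases "u \<in> D")
      case False
      have us: "u \<in> space ?M" using u by (simp add: G_def)
      have "C (\<sigma> - \<epsilon>) (\<sigma> + \<epsilon>) (Z u)"
        by (rule mono[OF iff[THEN iffD1, OF _ u]]) (use us False in \<open>auto simp: D_def\<close>)
      thus ?thesis using us by simp
    qed simp
  qed
  hence "measure ?M G \<le> measure ?M ({u\<in>space ?M. C (\<sigma> - \<epsilon>) (\<sigma> + \<epsilon>) (Z u)} \<union> D)"
    using LC D by (intro M.finite_measure_mono) auto
  also have "\<dots> \<le> L (\<sigma> - \<epsilon>) (\<sigma> + \<epsilon>) + measure ?M D"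
    unfolding LC(1) using LC(2) D(1) by (intro measure_Un_le)
  finally show "p \<le> L (\<sigma> - \<epsilon>) (\<sigma> + \<epsilon>) + scale_rate P \<sigma> n / \<epsilon>" using D(2) G(1) by simp
  have "{u\<in>space ?M. C (\<sigma> + \<epsilon>) (\<sigma> - \<epsilon>) (Z u)} \<subseteq> G \<union> D"
  proof
    fix u assume u: "u \<in> {u\<in>space ?M. C (\<sigma> + \<epsilon>) (\<sigma> - \<epsilon>) (Z u)}"
    show "u \<in> G \<union> D"
    proof (cases "u \<in> D")
      case False
      have "C (noise_scale n P (direction X) u) (noise_scale n P (direction X) u) (Z u)"
        by (rule mono[of "\<sigma> + \<epsilon>" "\<sigma> - \<epsilon>"]) (use u False in \<open>auto simp: D_def\<close>)
      thus ?thesis using iff[of u] u False by simp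
    qed simp
  qed
  hence "L (\<sigma> + \<epsilon>) (\<sigma> - \<epsilon>) \<le> measure ?M (G \<union> D)"
    unfolding LC(1) using G D by (intro M.finite_measure_mono) auto
  also have "\<dots> \<le> p + measure ?M D"
    unfolding G(1) using G(2) D(1) by (intro measure_Un_le)
  finally show "L (\<sigma> + \<epsilon>) (\<sigma> - \<epsilon>) - scale_rate P \<sigma> n / \<epsilon> \<le> p" using D(2) by simp
qed

end

section \<open>The limiting conditional distribution\<close>

text \<open>
  The limiting form is nonnegative, and a vector on which a nonnegative form vanishes lies in its
  kernel, which is trivial for an invertible matrix.
\<close>

lemma invertible_limit_pos_def:
  fixes B :: "nat \<Rightarrow> real mat"
  assumes Q: "Q \<in> carrier_mat P P" and inv: "invertible_mat Q"
    and lim: "\<And>i j. i < P \<Longrightarrow> j < P \<Longrightarrow> (\<lambda>n. B n $$ (i, j)) \<longlonglongrightarrow> Q $$ (i, j)"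
    and B: "\<forall>\<^sub>F n in sequentially. pos_def P (B n)"
  shows "pos_def P Q"
proof -
  define f where "f x y = (\<Sum>i<P. \<Sum>j<P. x i * Q $$ (i, j) * y j)" for x y :: "nat \<Rightarrow> real"
  have sym: "Q $$ (i, j) = Q $$ (j, i)" if "i < P" "j < P" for i j
  proof (rule LIMSEQ_unique[OF lim[OF that]])
    have "\<forall>\<^sub>F n in sequentially. B n $$ (j, i) = B n $$ (i, j)"
      using B by eventually_elim (use that in \<open>auto simp: pos_def_def\<close>)
    thus "(\<lambda>n. B n $$ (i, j)) \<longlonglongrightarrow> Q $$ (j, i)" by (rule Lim_transform_eventually[OF lim[OF that(2,1)]])
  qed
  have psd: "0 \<le> f x x" for x
  proof (rule tendsto_lowerbound)
    show "(\<lambda>n. \<Sum>i<P. \<Sum>j<P. x i * B n $$ (i, j) * x j) \<longlonglongrightarrow> f x x"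
      unfolding f_def by (intro tendsto_intros lim) auto
    show "\<forall>\<^sub>F n in sequentially. 0 \<le> (\<Sum>i<P. \<Sum>j<P. x i * B n $$ (i, j) * x j)"
      using B
    proof eventually_elim
      case (elim n)
      show ?case
      proof (cases "\<exists>j<P. x j \<noteq> 0")
        case True
        thus ?thesis using elim by (auto simp: pos_def_def intro: less_imp_le)
      qed auto
    qed
  qed simp
  have pd: "0 < f x x" if x: "\<exists>j<P. x j \<noteq> 0" for x
  proof (rule ccontr)
    assume "\<not> ?thesis"
    hence fx: "f x x = 0" using psd[of x] by simp
    have Qx: "(\<Sum>j<P. Q $$ (i, j) * x j) = 0" if i: "i < P" for i
    proof -
      define b where "b = (\<Sum>j<P. Q $$ (i, j) * x j)"
      define w where "w = (\<lambda>j. of_bool (j = i) :: real)"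
      define h where "h = f w w"
      have h0: "0 \<le> h" unfolding h_def by (rule psd)
      have fw: "f w y = (\<Sum>j<P. Q $$ (i, j) * y j)" for y
      proof -
        have "f w y = (\<Sum>l<P. of_bool (l = i) * (\<Sum>j<P. Q $$ (l, j) * y j))"
          unfolding f_def w_def sum_distrib_left by (simp only: mult.assoc)
        also have "\<dots> = (\<Sum>j<P. Q $$ (i, j) * y j)" by (rule sum_of_bool_eq(1)[OF i])
        finally show ?thesis .
      qed
      have fs: "f y z = f z y" for y z
      proof -
        have "f y z = (\<Sum>j<P. \<Sum>i<P. y i * Q $$ (i, j) * z j)" unfolding f_def by (rule sum.swap)
        also have "\<dots> = f z y" unfolding f_def using sym by (intro sum.cong refl) (simp add: mult_ac)
        finally show ?thesis .
      qed
      \<comment> \<open>This step along \<open>w\<close> would make the form negative unless \<open>b = 0\<close>; adding one to \<open>h\<close> covers \<open>h = 0\<close>.\<close>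
      define \<tau> where "\<tau> = - b / (h + 1)"
      have "f (\<lambda>j. x j + \<tau> * w j) (\<lambda>j. x j + \<tau> * w j) = f x x + \<tau> * f x w + \<tau> * f w x + \<tau>\<^sup>2 * f w w"
        unfolding f_def
        by (simp add: algebra_simps sum.distrib sum_distrib_left power2_eq_square)
      also have "\<dots> = 2 * \<tau> * b + \<tau>\<^sup>2 * h" by (simp add: fx fs[of x w] fw b_def h_def)
      finally have "0 \<le> 2 * \<tau> * b + \<tau>\<^sup>2 * h" using psd[of "\<lambda>j. x j + \<tau> * w j"] by simp
      also have "\<dots> = - (b\<^sup>2 * (h + 2)) / (h + 1)\<^sup>2"
        using h0 by (simp add: \<tau>_def divide_simps add_nonneg_eq_0_iff) (simp add: algebra_simps power2_eq_square)
      finally have "b\<^sup>2 * (h + 2) \<le> 0" using h0 by (simp add: divide_le_0_iff zero_le_divide_iff add_nonneg_eq_0_iff)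
      hence "b = 0" using h0 by (simp add: mult_le_0_iff)
      thus ?thesis by (simp add: b_def)
    qed
    obtain R where R: "R * Q = 1\<^sub>m P" "R \<in> carrier_mat P P"
    proof -
      obtain R where R: "inverts_mat Q R" "inverts_mat R Q" using inv by (auto simp: invertible_mat_def)
      have "Q * R = 1\<^sub>m P" using R Q by (simp add: inverts_mat_def)
      hence "dim_col R = P" by (metis index_mult_mat(3) index_one_mat(3))
      moreover have "R * Q = 1\<^sub>m (dim_row R)" using R by (simp add: inverts_mat_def)
      hence "dim_row R = P" using Q by (metis carrier_matD(2) index_mult_mat(3) index_one_mat(3))
      ultimately have "R \<in> carrier_mat P P" "R * Q = 1\<^sub>m P" using \<open>R * Q = 1\<^sub>m (dim_row R)\<close> by auto
      thus thesis using that by blast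
    qed
    have Qv: "Q *\<^sub>v Matrix.vec P x = 0\<^sub>v P"
      using Q Qx by (intro eq_vecI) (auto simp: scalar_prod_def lessThan_atLeast0)
    have "Matrix.vec P x = (R * Q) *\<^sub>v Matrix.vec P x" unfolding R(1) by simp
    also have "\<dots> = R *\<^sub>v (Q *\<^sub>v Matrix.vec P x)" by (rule assoc_mult_mat_vec[OF R(2) Q]) simp
    also have "\<dots> = 0\<^sub>v P" unfolding Qv using R(2) by (intro eq_vecI) (auto simp: scalar_prod_def)
    finally have "Matrix.vec P x $ j = 0\<^sub>v P $ j" for j by simp
    thus False using x by (metis index_vec index_zero_vec(1))
  qed
  show ?thesis unfolding pos_def_def using Q sym pd by (auto simp: f_def)
qed

text \<open>
  The correlation vectors are the images of the Gram-Schmidt vectors under the target matrix.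
\<close>

lemma C_inf_index:
  assumes A: "A \<in> carrier_mat k P" and Q: "pos_def P Q" and r: "r < P" and i: "i < k"
  shows "C_inf A Q (Suc r) $ i = (\<Sum>j<P. A $$ (i, j) * gs_coef Q r j)"
proof -
  have rP: "Suc r \<le> P" using r by simp
  note I = leading_submat_inverse(1)[OF Q rP]
  have u: "(inv_mat (leading_submat Q (Suc r)) *\<^sub>v unit_vec (Suc r) r) $ j = gs_coef Q r j" if "j < Suc r" for j
    using that I by (auto simp: gs_coef_def)
  have "C_inf A Q (Suc r) $ i = (\<Sum>j<Suc r. A $$ (i, j) * gs_coef Q r j)"
    using A i I u unfolding C_inf_def diff_Suc_1
    by (auto simp: scalar_prod_def first_cols_def lessThan_atLeast0 simp del: sum.op_ivl_Suc sum.lessThan_Suc index_mult_mat_vec(1) intro!: sum.cong)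
       (auto simp: scalar_prod_def first_cols_def lessThan_atLeast0 simp del: sum.op_ivl_Suc sum.lessThan_Suc intro!: sum.cong)
  also have "\<dots> = (\<Sum>j<P. A $$ (i, j) * gs_coef Q r j)"
    by (rule sum_lessThan_restrict[OF rP, symmetric]) simp
  finally show ?thesis .
qed

lemma C_inf_carrier: "A \<in> carrier_mat k P \<Longrightarrow> C_inf A Q q \<in> carrier_vec k"
  by (rule carrier_vecI) (simp add: C_inf_def first_cols_def)

text \<open>
  The assumptions that fix the limit experiment, independently of the designs: \<open>Suc s\<close> is the last
  order at which the correlation vector is nonzero.
\<close>

locale last_correlated =
  fixes P k s :: nat and A Q :: "real mat" and \<sigma> :: real
  assumes A: "A \<in> carrier_mat k P" and rankA: "vec_space.rank k A = k"
    and Q: "pos_def P Q" and sP: "s < P" and \<sigma>: "0 < \<sigma>"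
    and corr: "C_inf A Q (Suc s) \<noteq> 0\<^sub>v k"
    and uncorr: "\<And>q. Suc s < q \<Longrightarrow> q \<le> P \<Longrightarrow> C_inf A Q q = 0\<^sub>v k"
begin

abbreviation "\<beta> \<equiv> target_coef A Q \<sigma>"

lemma diag_pos: "r < P \<Longrightarrow> 0 < gs_coef Q r r"
  by (rule gs_coef_diag_pos[OF Q])

lemma \<beta>_C_inf: "r < P \<Longrightarrow> i < k \<Longrightarrow> \<beta> i r = \<sigma> * C_inf A Q (Suc r) $ i / sqrt (gs_coef Q r r)"
  using A by (auto simp: target_coef_def C_inf_index[OF A Q])

lemma \<beta>_above: "Suc s \<le> r \<Longrightarrow> r < P \<Longrightarrow> i < k \<Longrightarrow> \<beta> i r = 0"
  by (simp add: \<beta>_C_inf uncorr)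

lemma \<beta>_top_nonzero: "\<exists>i<k. \<beta> i s \<noteq> 0"
proof (rule ccontr)
  assume *: "\<not> ?thesis"
  have "C_inf A Q (Suc s) = 0\<^sub>v k"
  proof (rule eq_vecI)
    fix i assume "i < dim_vec (0\<^sub>v k :: real Matrix.vec)"
    hence i: "i < k" by simp
    hence "\<beta> i s = 0" using * by blast
    thus "C_inf A Q (Suc s) $ i = 0\<^sub>v k $ i" using i \<sigma> diag_pos[OF sP] by (simp add: \<beta>_C_inf[OF sP])
  qed (use C_inf_carrier[OF A] in auto)
  thus False using corr by simp
qed

text \<open>
  The target matrix has full row rank and the Gram-Schmidt vectors form a basis; the vectors beyond
  index \<open>s\<close> are mapped to zero and can be left out.
\<close>

lemma \<beta>_surjective:
  obtains z where "\<And>i. i < k \<Longrightarrow> (\<Sum>r<Suc s. \<beta> i r * z r) = w i"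
proof -
  obtain x where x: "\<And>i. i < k \<Longrightarrow> (\<Sum>j<P. A $$ (i, j) * x j) = w i"
    using full_row_rank_surjective[OF A rankA] by blast
  obtain z where z: "\<And>j. j < P \<Longrightarrow> x j = (\<Sum>r<P. z r * gs_coef Q r j)"
    using gs_coef_basis[OF Q order_refl, of x] by force
  show thesis
  proof (rule that)
    fix i assume i: "i < k"
    have "w i = (\<Sum>j<P. \<Sum>r<P. A $$ (i, j) * (z r * gs_coef Q r j))"
      using x[OF i] by (simp add: z sum_distrib_left)
    also have "\<dots> = (\<Sum>r<P. \<Sum>j<P. A $$ (i, j) * (z r * gs_coef Q r j))" by (rule sum.swap)
    also have "\<dots> = (\<Sum>r<P. \<beta> i r * (z r * sqrt (gs_coef Q r r) / \<sigma>))"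
    proof (intro sum.cong refl)
      fix r assume "r \<in> {..<P}"
      hence "0 < sqrt (gs_coef Q r r)" using diag_pos by simp
      moreover have "(\<Sum>j<P. A $$ (i, j) * (z r * gs_coef Q r j)) = z r * (\<Sum>j<P. A $$ (i, j) * gs_coef Q r j)"
        by (simp add: sum_distrib_left mult_ac)
      ultimately show "(\<Sum>j<P. A $$ (i, j) * (z r * gs_coef Q r j)) = \<beta> i r * (z r * sqrt (gs_coef Q r r) / \<sigma>)"
        using \<sigma> carrier_matD(2)[OF A] by (simp add: target_coef_def)
    qed
    also have "\<dots> = (\<Sum>r<Suc s. \<beta> i r * (z r * sqrt (gs_coef Q r r) / \<sigma>))"
      by (rule sum_lessThan_restrict) (use sP \<beta>_above[OF _ _ i] in auto)
    finally show "(\<Sum>r<Suc s. \<beta> i r * (z r * sqrt (gs_coef Q r r) / \<sigma>)) = w i" by simp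
  qed
qed

lemma \<beta>_row_nonzero: "i < k \<Longrightarrow> \<exists>r<Suc s. \<beta> i r \<noteq> 0"
proof (rule ccontr)
  assume i: "i < k" and *: "\<not> (\<exists>r<Suc s. \<beta> i r \<noteq> 0)"
  obtain z where "\<And>i. i < k \<Longrightarrow> (\<Sum>r<Suc s. \<beta> i r * z r) = 1"
    using \<beta>_surjective[of "\<lambda>_. 1"] by blast
  hence "(\<Sum>r<Suc s. \<beta> i r * z r) = 1" using i by blast
  moreover have "(\<Sum>r<Suc s. \<beta> i r * z r) = 0" using * by (intro sum.neutral) auto
  ultimately show False by simp
qed

text \<open>
  The limit of the conditional distribution function at the local parameter \<open>\<nu>\<close>, with critical value \<open>b\<close>.
\<close>

definition limit_cdf :: "real Matrix.vec \<Rightarrow> real \<Rightarrow> real \<Rightarrow> real" where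
  "limit_cdf t b \<nu> = cond_limit P k (Suc s) \<beta> (($) t) s \<sigma> (b * \<sigma>) (\<nu> / sqrt (gs_coef Q s s))"

lemma limit_cdf_not_constant:
  assumes b: "0 < b"
  shows "\<exists>\<nu>. limit_cdf t b \<nu> \<noteq> limit_cdf t b 0"
proof -
  have sP': "Suc s \<le> P" using sP by simp
  obtain z where z: "\<And>i. i < k \<Longrightarrow> (\<Sum>r<Suc s. \<beta> i r * z r) = t $ i - 1"
    using \<beta>_surjective[of "\<lambda>i. t $ i - 1"] by blast
  have pos: "0 < \<P>(z in gauss P. below_target k (Suc s) \<beta> (($) t) z)"
    by (rule below_target_prob_pos[OF sP', where ?z0.0 = z]) (simp add: z del: sum.lessThan_Suc)
  obtain i where i: "i < k" "\<beta> i s \<noteq> 0" using \<beta>_top_nonzero by blast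
  obtain e where e: "cond_limit P k (Suc s) \<beta> (($) t) s \<sigma> (b * \<sigma>) e \<noteq> cond_limit P k (Suc s) \<beta> (($) t) s \<sigma> (b * \<sigma>) 0"
    using cond_limit_not_constant[OF lessI sP' \<sigma> b i pos] by blast
  thus ?thesis using diag_pos[OF sP]
    by (intro exI[of _ "e * sqrt (gs_coef Q s s)"]) (simp add: limit_cdf_def)
qed

end

section \<open>Limits along local parameters\<close>

text \<open>
  The unit vector is that of index \<open>s\<close>, belonging to the coefficient that is tested at order
  \<open>s + 1\<close>.
\<close>

definition local_param :: "nat \<Rightarrow> nat \<Rightarrow> real Matrix.vec \<Rightarrow> nat \<Rightarrow> real \<Rightarrow> real Matrix.vec" where
  "local_param P s \<theta> n \<nu> = \<theta> + (\<nu> / sqrt (real n)) \<cdot>\<^sub>v unit_vec P s"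

locale local_asymptotics = last_correlated +
  fixes X :: "nat \<Rightarrow> real mat" and m :: nat and c :: "nat \<Rightarrow> real" and \<theta> t :: "real Matrix.vec"
  assumes X: "\<And>n. P < n \<Longrightarrow> X n \<in> carrier_mat n P \<and> vec_space.rank n (X n) = P"
    and gram_limit: "\<And>i j. i < P \<Longrightarrow> j < P \<Longrightarrow> (\<lambda>n. gram (X n) $$ (i, j) / real n) \<longlonglongrightarrow> Q $$ (i, j)"
    and m: "m \<le> Suc s" and cm: "c m = 0" and c: "\<And>p. Suc s \<le> p \<Longrightarrow> p \<le> P \<Longrightarrow> 0 < c p"
    and \<theta>: "\<theta> \<in> submodel P s" and t: "t \<in> carrier_vec k"
begin

lemma reg: "P < n \<Longrightarrow> regression (X n) n P"
  using X sP by unfold_locales auto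

lemma dims: "P < n \<Longrightarrow> dim_row (X n) = n" "P < n \<Longrightarrow> dim_col (X n) = P"
  using X by auto

lemma ev_n: "\<forall>\<^sub>F n in sequentially. P < n"
  by (rule eventually_gt_at_top)

lemma moment_limit:
  assumes "i < P" "j < P"
  shows "(\<lambda>n. moment_mat (X n) $$ (i, j)) \<longlonglongrightarrow> Q $$ (i, j)"
proof (rule Lim_transform_eventually[OF gram_limit[OF assms]])
  show "\<forall>\<^sub>F n in sequentially. gram (X n) $$ (i, j) / real n = moment_mat (X n) $$ (i, j)"
    using ev_n by eventually_elim (use dims assms in \<open>simp add: moment_mat_gram\<close>)
qed

abbreviation "th n \<nu> \<equiv> local_param P s \<theta> n \<nu>"

lemma \<theta>_carrier: "\<theta> \<in> carrier_vec P" and \<theta>_zero: "s \<le> j \<Longrightarrow> j < P \<Longrightarrow> \<theta> $ j = 0"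
  using \<theta> by (auto simp: submodel_def)

lemma th_carrier: "th n \<nu> \<in> carrier_vec P"
  using \<theta>_carrier by (simp add: local_param_def)

lemma th_index: "j < P \<Longrightarrow> th n \<nu> $ j = (if j = s then \<nu> / sqrt (real n) else \<theta> $ j)"
  using \<theta>_carrier \<theta>_zero[of s] sP by (auto simp: local_param_def)

lemma th_submodel: "th n \<nu> \<in> submodel P (Suc s)"
  using th_carrier by (auto simp: submodel_def th_index \<theta>_zero)

lemma th_0: "th n 0 = \<theta>"
  using \<theta>_carrier th_carrier[of n 0] \<theta>_zero by (intro eq_vecI) (auto simp: th_index)

lemma th_norm: "euclid_norm (th n \<nu> - \<theta>) = \<bar>\<nu>\<bar> / sqrt (real n)"
proof -
  have d: "dim_vec (th n \<nu> - \<theta>) = P" using \<theta>_carrier by simp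
  have "(\<Sum>j<P. ((th n \<nu> - \<theta>) $ j)\<^sup>2) = (\<Sum>j<P. of_bool (j = s) * (\<nu> / sqrt (real n))\<^sup>2)"
    using \<theta>_carrier \<theta>_zero by (intro sum.cong refl) (auto simp: th_index)
  also have "\<dots> = (\<nu> / sqrt (real n))\<^sup>2" by (rule sum_of_bool_eq(1)[OF sP])
  finally show ?thesis unfolding euclid_norm_def L2_set_def d
    by (simp only: real_sqrt_abs) (simp add: abs_divide)
qed

text \<open>
  Signals at two local parameters keep a bounded distance, since the column of index \<open>s\<close> has a
  squared length of order \<open>n\<close>.
\<close>

lemma th_signal_distance:
  assumes n: "P < n"
  shows "(\<Sum>l<n. ((X n *\<^sub>v th n \<nu>1 - X n *\<^sub>v th n \<nu>2) $ l)\<^sup>2) = (\<nu>1 - \<nu>2)\<^sup>2 * moment_mat (X n) $$ (s, s)"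
proof -
  have diff: "(X n *\<^sub>v th n \<nu>1 - X n *\<^sub>v th n \<nu>2) $ l = X n $$ (l, s) * ((\<nu>1 - \<nu>2) / sqrt (real n))" if l: "l < n" for l
  proof -
    have e: "(X n *\<^sub>v th n \<nu>) $ l = (\<Sum>j<P. X n $$ (l, j) * th n \<nu> $ j)" for \<nu>
      using l dims[OF n] th_carrier[of n \<nu>] by (auto simp: scalar_prod_def lessThan_atLeast0)
    have "(X n *\<^sub>v th n \<nu>1 - X n *\<^sub>v th n \<nu>2) $ l = (X n *\<^sub>v th n \<nu>1) $ l - (X n *\<^sub>v th n \<nu>2) $ l"
      using l dims[OF n] by (intro index_minus_vec) simp
    also have "\<dots> = (\<Sum>j<P. X n $$ (l, j) * (th n \<nu>1 $ j - th n \<nu>2 $ j))"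
      unfolding e by (simp add: sum_subtractf right_diff_distrib)
    also have "\<dots> = (\<Sum>j<P. of_bool (j = s) * (X n $$ (l, j) * ((\<nu>1 - \<nu>2) / sqrt (real n))))"
      by (intro sum.cong refl) (auto simp: th_index diff_divide_distrib)
    also have "\<dots> = X n $$ (l, s) * ((\<nu>1 - \<nu>2) / sqrt (real n))" by (rule sum_of_bool_eq(1)[OF sP])
    finally show ?thesis .
  qed
  have "(\<Sum>l<n. ((X n *\<^sub>v th n \<nu>1 - X n *\<^sub>v th n \<nu>2) $ l)\<^sup>2)
      = (\<Sum>l<n. (\<nu>1 - \<nu>2)\<^sup>2 * (X n $$ (l, s) * X n $$ (l, s)) / real n)"
  proof (intro sum.cong refl)
    fix l assume "l \<in> {..<n}"
    thus "((X n *\<^sub>v th n \<nu>1 - X n *\<^sub>v th n \<nu>2) $ l)\<^sup>2 = (\<nu>1 - \<nu>2)\<^sup>2 * (X n $$ (l, s) * X n $$ (l, s)) / real n"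
      using n by (simp only: lessThan_iff diff) (simp add: power_mult_distrib power_divide power2_eq_square)
  qed
  thus ?thesis using dims[OF n] sP by (simp add: moment_mat_index sum_distrib_left sum_divide_distrib)
qed

definition event_prob :: "nat \<Rightarrow> nat \<Rightarrow> real \<Rightarrow> real" where
  "event_prob k' n \<nu> = measure (sample_law (X n) (th n \<nu>) \<sigma>)
     {y\<in>carrier_vec n. good_event k' m c A (X n) (th n \<nu>) t (Suc s) y}"

definition later_insignificant :: real where
  "later_insignificant = (\<Prod>p=Suc s+1..P. 2 * std_normal_cdf (c p) - 1)"

definition limit_prob :: "nat \<Rightarrow> real \<Rightarrow> real" where
  "limit_prob k' \<nu> = \<P>(z in gauss P. below_target k' (Suc s) \<beta> (($) t) z
      \<and> exceeds s \<sigma> (\<nu> / sqrt (gs_coef Q s s)) (c (Suc s) * \<sigma>) z)"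

text \<open>
  The sandwich is applied with a width \<open>\<epsilon> n\<close> that tends to zero slowly enough for the probability of
  the exceptional event to vanish; both bounds then have the same limit.
\<close>

theorem event_prob_tendsto:
  assumes k': "k' \<le> k"
  shows "(\<lambda>n. event_prob k' n \<nu>) \<longlonglongrightarrow> limit_prob k' \<nu> * later_insignificant"
proof -
  have sP': "Suc s \<le> P" using sP by simp
  \<comment> \<open>With this width the exceptional probability \<open>scale_rate P \<sigma> n / \<epsilon> n\<close> equals \<open>\<epsilon> n\<close>.\<close>
  define \<epsilon> where "\<epsilon> n = sqrt (scale_rate P \<sigma> n)" for n
  define e where "e n = \<nu> / sqrt (gs_coef (moment_mat (X n)) s s)" for n
  define L where "L b1 b2 n = measure (gauss P) {z\<in>space (gauss P).
      below_target k' (Suc s) (target_coef A (moment_mat (X n)) \<sigma>) (($) t) z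
      \<and> exceeds s \<sigma> (e n) (c (Suc s) * b1 n) z \<and> insignificant P (Suc s) c \<sigma> (b2 n) z}" for b1 b2 :: "nat \<Rightarrow> real" and n
  have gs: "(\<lambda>n. gs_coef (moment_mat (X n)) r j) \<longlonglongrightarrow> gs_coef Q r j" if "r < P" for r j
    by (rule tendsto_gs_coef[OF Q that moment_limit])
  have \<epsilon>0: "\<epsilon> \<longlonglongrightarrow> 0"
    unfolding \<epsilon>_def using tendsto_real_sqrt[OF scale_rate_tendsto[of P \<sigma>]] by simp
  have Llim: "L b1 b2 \<longlonglongrightarrow> limit_prob k' \<nu> * later_insignificant" if "b1 \<longlonglongrightarrow> \<sigma>" "b2 \<longlonglongrightarrow> \<sigma>" for b1 b2
  proof -
    have "L b1 b2 \<longlonglongrightarrow> \<P>(z in gauss P. below_target k' (Suc s) \<beta> (($) t) z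
        \<and> exceeds s \<sigma> (\<nu> / sqrt (gs_coef Q s s)) (c (Suc s) * \<sigma>) z \<and> insignificant P (Suc s) c \<sigma> \<sigma> z)"
      unfolding L_def
    proof (rule selection_event_tendsto[OF lessI sP' \<sigma> _ _ _ that])
      show "(\<lambda>n. target_coef A (moment_mat (X n)) \<sigma> i r) \<longlonglongrightarrow> \<beta> i r" if "i < k'" "r < Suc s" for i r
        unfolding target_coef_def using that sP diag_pos[of r]
        by (intro tendsto_intros gs) auto
      show "\<exists>r<Suc s. \<beta> i r \<noteq> 0" if "i < k'" for i using \<beta>_row_nonzero that k' by simp
      show "e \<longlonglongrightarrow> \<nu> / sqrt (gs_coef Q s s)"
        unfolding e_def using diag_pos[OF sP] by (intro tendsto_intros gs sP) auto
    qed
    also have "\<P>(z in gauss P. below_target k' (Suc s) \<beta> (($) t) z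
        \<and> exceeds s \<sigma> (\<nu> / sqrt (gs_coef Q s s)) (c (Suc s) * \<sigma>) z \<and> insignificant P (Suc s) c \<sigma> \<sigma> z)
      = limit_prob k' \<nu> * later_insignificant"
      unfolding limit_prob_def later_insignificant_def
      by (rule selection_event_factor[OF lessI sP' \<sigma>]) (use c in auto)
    finally show ?thesis .
  qed
  have up: "(\<lambda>n. L (\<lambda>n. \<sigma> - \<epsilon> n) (\<lambda>n. \<sigma> + \<epsilon> n) n + \<epsilon> n) \<longlonglongrightarrow> limit_prob k' \<nu> * later_insignificant + 0"
    using tendsto_diff[OF tendsto_const \<epsilon>0, of \<sigma>] tendsto_add[OF tendsto_const \<epsilon>0, of \<sigma>]
    by (intro tendsto_add Llim \<epsilon>0) simp_all
  have lo: "(\<lambda>n. L (\<lambda>n. \<sigma> + \<epsilon> n) (\<lambda>n. \<sigma> - \<epsilon> n) n - \<epsilon> n) \<longlonglongrightarrow> limit_prob k' \<nu> * later_insignificant - 0"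
    using tendsto_diff[OF tendsto_const \<epsilon>0, of \<sigma>] tendsto_add[OF tendsto_const \<epsilon>0, of \<sigma>]
    by (intro tendsto_diff Llim \<epsilon>0) simp_all
  have bounds: "\<forall>\<^sub>F n in sequentially. L (\<lambda>n. \<sigma> + \<epsilon> n) (\<lambda>n. \<sigma> - \<epsilon> n) n - \<epsilon> n \<le> event_prob k' n \<nu>
      \<and> event_prob k' n \<nu> \<le> L (\<lambda>n. \<sigma> - \<epsilon> n) (\<lambda>n. \<sigma> + \<epsilon> n) n + \<epsilon> n"
    using ev_n order_tendstoD(2)[OF \<epsilon>0 \<sigma>]
  proof eventually_elim
    case (elim n)
    interpret R: regression "X n" n P by (rule reg[OF elim(1)])
    have n0: "0 < real n" using elim by simp
    have "0 < sqrt (real n) * (\<sigma> ^ 4 + 1) + 2 * real P * \<sigma>\<^sup>2"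
      using n0 \<sigma> by (intro add_pos_nonneg mult_pos_pos) (auto simp: add_pos_pos)
    hence rate: "0 < scale_rate P \<sigma> n" unfolding scale_rate_def using elim \<sigma> by (intro divide_pos_pos) auto
    have \<epsilon>n: "0 < \<epsilon> n" "scale_rate P \<sigma> n / \<epsilon> n = \<epsilon> n"
      using rate by (simp_all add: \<epsilon>_def real_div_sqrt)
    have e: "sqrt (real n) * th n \<nu> $ s / sqrt (xi_sq (X n) s) = e n"
      using n0 by (simp add: th_index sP e_def xi_sq_def)
    have cp: "0 \<le> c p" if "Suc s \<le> p" "p \<le> P" for p using c[OF that] by simp
    have i: "m \<le> Suc s" "c m = 0" by (rule m, rule cm)
    note sw = R.good_event_sandwich[where m = m and c = c and t = t, OF th_submodel[of n \<nu>] sP' i cp A k' \<sigma> \<epsilon>n(1) elim(2), unfolded e \<epsilon>n(2)]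
    show ?case using sw by (simp add: L_def event_prob_def)
  qed
  show ?thesis
    by (rule tendsto_sandwich[OF _ _ lo[simplified] up[simplified]])
       (use bounds in \<open>auto elim: eventually_mono\<close>)
qed

text \<open>
  The selection probability is smallest at \<open>\<nu> = 0\<close>; this makes the bound hold at every local
  parameter.
\<close>

lemma limit_prob_selection:
  "2 * (1 - std_normal_cdf (c (Suc s))) \<le> limit_prob 0 \<nu>" "limit_prob 0 0 = 2 * (1 - std_normal_cdf (c (Suc s)))"
  using exceeds_prob(2,3)[OF sP \<sigma>, of "c (Suc s)"] c[of "Suc s"] sP
  by (simp_all add: limit_prob_def below_target_def)

lemma later_insignificant_pos: "0 < later_insignificant"
  unfolding later_insignificant_def using c by (intro prod_pos std_normal_cdf_bounds(1)) auto

lemma selection_pos: "0 < 1 - std_normal_cdf (c (Suc s))"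
  using std_normal_cdf_bounds(2)[of "c (Suc s)"] c[of "Suc s"] sP by simp

lemma limit_prob_pos: "0 < limit_prob 0 \<nu>"
  by (rule less_le_trans[OF _ limit_prob_selection(1)]) (use selection_pos in simp)

definition cdf_n :: "nat \<Rightarrow> real \<Rightarrow> real" where
  "cdf_n n \<nu> = cond_cdf m c A (X n) (th n \<nu>) \<sigma> t (Suc s)"

lemma cdf_n_eq:
  assumes n: "P < n"
  shows "cdf_n n \<nu> = event_prob k n \<nu> / event_prob 0 n \<nu>"
proof -
  interpret R: regression "X n" n P by (rule reg[OF n])
  have "(sqrt (real n) \<cdot>\<^sub>v (A *\<^sub>v (pms_estimator m c (X n) y - th n \<nu>)) \<le> t) \<longleftrightarrow>
     (\<forall>i<k. (sqrt (real n) \<cdot>\<^sub>v (A *\<^sub>v (pms_estimator m c (X n) y - th n \<nu>))) $ i \<le> t $ i)" for y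
    using A t by (auto simp: less_eq_vec_def simp del: index_mult_mat_vec)
  thus ?thesis
    unfolding cdf_n_def cond_cdf_def cond_prob_def event_prob_def good_event_def R.space_sample_law R.dim
    by (simp del: index_mult_mat_vec index_smult_vec)
qed

text \<open>
  The factor contributed by the tests of higher order cancels, so the limit involves only the
  critical value \<open>c (Suc s)\<close>.
\<close>

lemma cdf_n_tendsto: "(\<lambda>n. cdf_n n \<nu>) \<longlonglongrightarrow> limit_cdf t (c (Suc s)) \<nu>"
proof -
  have "(\<lambda>n. event_prob k n \<nu> / event_prob 0 n \<nu>) \<longlonglongrightarrow> limit_prob k \<nu> * later_insignificant / (limit_prob 0 \<nu> * later_insignificant)"
    using limit_prob_pos[of \<nu>] later_insignificant_pos
    by (intro tendsto_divide event_prob_tendsto) auto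
  also have "limit_prob k \<nu> * later_insignificant / (limit_prob 0 \<nu> * later_insignificant) = limit_cdf t (c (Suc s)) \<nu>"
    using later_insignificant_pos by (simp add: limit_cdf_def cond_limit_def limit_prob_def below_target_def)
  finally show ?thesis
    by (rule Lim_transform_eventually) (rule eventually_mono[OF ev_n], simp add: cdf_n_eq)
qed

definition err :: "nat \<Rightarrow> real \<Rightarrow> real \<Rightarrow> (real Matrix.vec \<Rightarrow> real) \<Rightarrow> real" where
  "err n \<nu> \<delta> g = error_prob m c A (X n) (th n \<nu>) \<sigma> t \<delta> g"

lemma err_nonneg: "0 \<le> err n \<nu> \<delta> g"
  by (simp add: err_def error_prob_def)

definition signal_dist :: "nat \<Rightarrow> real \<Rightarrow> real \<Rightarrow> real" where
  "signal_dist n \<nu>1 \<nu>2 = (\<nu>1 - \<nu>2)\<^sup>2 * moment_mat (X n) $$ (s, s) / \<sigma>\<^sup>2"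

lemma signal_dist_tendsto:
  "(\<lambda>n. signal_dist n \<nu>1 \<nu>2) \<longlonglongrightarrow> (\<nu>1 - \<nu>2)\<^sup>2 * Q $$ (s, s) / \<sigma>\<^sup>2"
  unfolding signal_dist_def using \<sigma> by (intro tendsto_intros moment_limit sP) auto

text \<open>
  On the selection event the targets at the two parameters are two numbers more than \<open>2\<delta>\<close>
  apart, so an estimator misses at least one of them by more than \<open>\<delta>\<close>. The event of missing the second one is
  then transferred to the law at the second parameter, by contiguity or in total variation.
\<close>

theorem two_point_bound:
  assumes n: "P < n" and g: "g \<in> estimators n" and sep: "2 * \<delta> < \<bar>cdf_n n \<nu>1 - cdf_n n \<nu>2\<bar>"
  shows "event_prob 0 n \<nu>1 \<le> err n \<nu>1 \<delta> g + sqrt (exp (signal_dist n \<nu>1 \<nu>2) * err n \<nu>2 \<delta> g)"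
    and "event_prob 0 n \<nu>1 \<le> err n \<nu>1 \<delta> g + err n \<nu>2 \<delta> g + sqrt (exp (signal_dist n \<nu>1 \<nu>2) - 1)"
proof -
  interpret R: regression "X n" n P by (rule reg[OF n])
  define B where "B \<nu> = {y\<in>carrier_vec n. \<delta> < \<bar>g y - cond_cdf_sel m c A (X n) (th n \<nu>) \<sigma> t y\<bar>}" for \<nu>
  have B: "B \<nu> \<in> sets (sample_space n)" for \<nu>
    unfolding B_def by (rule R.error_sets[where m = m and c = c, OF cm g])
  have errB: "err n \<nu> \<delta> g = measure (sample_law (X n) (th n \<nu>) \<sigma>) (B \<nu>)" for \<nu>
    by (simp add: err_def error_prob_def R.space_sample_law B_def)
  interpret M: prob_space "sample_law (X n) (th n \<nu>1) \<sigma>" by (rule R.sample_law_prob_space[OF \<sigma>])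
  have sP': "Suc s \<le> P" using sP by simp
  have "{y\<in>carrier_vec n. good_event 0 m c A (X n) (th n \<nu>1) t (Suc s) y} \<subseteq> B \<nu>1 \<union> B \<nu>2"
  proof
    fix y assume "y \<in> {y\<in>carrier_vec n. good_event 0 m c A (X n) (th n \<nu>1) t (Suc s) y}"
    hence y: "y \<in> carrier_vec n" "sel_order m c (X n) y = Suc s" by (auto simp: good_event_def)
    have "cond_cdf_sel m c A (X n) (th n \<nu>) \<sigma> t y = cdf_n n \<nu>" for \<nu>
      unfolding cdf_n_def by (rule R.cond_cdf_sel_on_event[OF m sP' y(2)])
    thus "y \<in> B \<nu>1 \<union> B \<nu>2" using y(1) sep by (auto simp: B_def)
  qed
  hence "event_prob 0 n \<nu>1 \<le> measure (sample_law (X n) (th n \<nu>1) \<sigma>) (B \<nu>1 \<union> B \<nu>2)"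
    unfolding event_prob_def using B by (intro M.finite_measure_mono) (auto simp: R.sets_sample_law)
  also have "\<dots> \<le> err n \<nu>1 \<delta> g + measure (sample_law (X n) (th n \<nu>1) \<sigma>) (B \<nu>2)"
    unfolding errB using B by (intro measure_Un_le) (auto simp: R.sets_sample_law)
  finally have le: "event_prob 0 n \<nu>1 \<le> err n \<nu>1 \<delta> g + measure (sample_law (X n) (th n \<nu>1) \<sigma>) (B \<nu>2)" .
  note b = R.sample_law_bounds[OF \<sigma> B[of \<nu>2], of "th n \<nu>1" "th n \<nu>2", unfolded th_signal_distance[OF n], folded signal_dist_def errB]
  show "event_prob 0 n \<nu>1 \<le> err n \<nu>1 \<delta> g + sqrt (exp (signal_dist n \<nu>1 \<nu>2) * err n \<nu>2 \<delta> g)"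
    using le b(1) by linarith
  show "event_prob 0 n \<nu>1 \<le> err n \<nu>1 \<delta> g + err n \<nu>2 \<delta> g + sqrt (exp (signal_dist n \<nu>1 \<nu>2) - 1)"
    using le b(2) by linarith
qed

lemma local_sup_ge:
  assumes n: "P < n" and \<nu>: "\<bar>\<nu>\<bar> < \<rho>"
  shows "ereal (err n \<nu> \<delta> g) \<le> local_sup_error m c A (X n) \<theta> \<sigma> t (Suc s) \<rho> \<delta> g"
  unfolding local_sup_error_def err_def dims[OF n]
  by (rule SUP_upper) (use th_submodel th_norm[of n \<nu>] \<nu> n in \<open>auto intro!: divide_strict_right_mono\<close>)

end

section \<open>Lower bounds for the estimation error\<close>

lemma liminf_ge_of_eventually_ge:
  fixes f :: "nat \<Rightarrow> ereal" and h :: "nat \<Rightarrow> real"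
  assumes "\<forall>\<^sub>F n in sequentially. ereal (h n) \<le> f n" and "h \<longlonglongrightarrow> a" and "b \<le> a"
  shows "ereal b \<le> liminf f"
proof -
  have "(\<lambda>n. ereal (h n)) \<longlonglongrightarrow> ereal a" using assms(2) by simp
  hence "liminf (\<lambda>n. ereal (h n)) = ereal a" by (intro lim_imp_Liminf) simp_all
  moreover have "liminf (\<lambda>n. ereal (h n)) \<le> liminf f" using assms(1) by (rule Liminf_mono)
  moreover have "ereal b \<le> ereal a" using assms(3) by simp
  ultimately show ?thesis by (metis order_trans)
qed

context local_asymptotics
begin

abbreviation "worst \<rho> \<delta> n \<equiv> local_sup_error m c A (X n) \<theta> \<sigma> t (Suc s) \<rho> \<delta>"
abbreviation "H \<equiv> limit_cdf t (c (Suc s))"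

definition half_prob :: real where
  "half_prob = (1 - std_normal_cdf (c (Suc s))) * later_insignificant"

lemma half_prob_pos: "0 < half_prob"
  unfolding half_prob_def using selection_pos later_insignificant_pos by simp

lemma two_half_prob_le: "2 * half_prob \<le> limit_prob 0 \<nu> * later_insignificant"
  using mult_right_mono[OF limit_prob_selection(1)[of \<nu>], of later_insignificant] later_insignificant_pos
  by (simp add: half_prob_def mult.assoc)

lemma eventually_separated:
  assumes "2 * \<delta> < \<bar>H \<nu>1 - H \<nu>2\<bar>"
  shows "\<forall>\<^sub>F n in sequentially. 2 * \<delta> < \<bar>cdf_n n \<nu>1 - cdf_n n \<nu>2\<bar>"
  by (rule order_tendstoD(1)[OF _ assms]) (intro tendsto_intros cdf_n_tendsto)

theorem selection_prob_tendsto: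
  "(\<lambda>n. \<P>(y in sample_law (X n) \<theta> \<sigma>. sel_order m c (X n) y = Suc s)) \<longlonglongrightarrow> 2 * half_prob"
proof -
  have "(\<lambda>n. event_prob 0 n 0) \<longlonglongrightarrow> 2 * half_prob"
    using event_prob_tendsto[of 0 0] unfolding limit_prob_selection(2) half_prob_def mult.assoc by simp
  moreover have "\<forall>\<^sub>F n in sequentially. event_prob 0 n 0 = \<P>(y in sample_law (X n) \<theta> \<sigma>. sel_order m c (X n) y = Suc s)"
    using ev_n
  proof eventually_elim
    case (elim n)
    interpret R: regression "X n" n P by (rule reg[OF elim])
    show ?case by (simp add: event_prob_def good_event_def th_0 R.space_sample_law)
  qed
  ultimately show ?thesis by (rule Lim_transform_eventually)
qed

text \<open>
  Contiguity carries the vanishing error at \<open>\<theta>\<close> over to the local parameter, where the estimator is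
  thus close to the wrong value.
\<close>

theorem consistent_estimator_fails:
  assumes \<nu>: "\<bar>\<nu>\<bar> < \<rho>" and sep: "2 * \<delta> < \<bar>H \<nu> - H 0\<bar>"
    and G: "\<And>n. P < n \<Longrightarrow> G n \<in> estimators n"
    and consistent: "(\<lambda>n. error_prob m c A (X n) \<theta> \<sigma> t \<delta> (G n)) \<longlonglongrightarrow> 0"
  shows "ereal (2 * half_prob) \<le> liminf (\<lambda>n. worst \<rho> \<delta> n (G n))"
proof (rule liminf_ge_of_eventually_ge[OF _ _ two_half_prob_le[of \<nu>]])
  let ?h = "\<lambda>n. event_prob 0 n \<nu> - sqrt (exp (signal_dist n \<nu> 0) * err n 0 \<delta> (G n))"
  have e0: "(\<lambda>n. err n 0 \<delta> (G n)) \<longlonglongrightarrow> 0" using consistent by (simp add: err_def th_0)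
  have "(\<lambda>n. sqrt (exp (signal_dist n \<nu> 0) * err n 0 \<delta> (G n))) \<longlonglongrightarrow> sqrt (exp ((\<nu> - 0)\<^sup>2 * Q $$ (s, s) / \<sigma>\<^sup>2) * 0)"
    by (intro tendsto_intros signal_dist_tendsto e0)
  thus "?h \<longlonglongrightarrow> limit_prob 0 \<nu> * later_insignificant"
    using tendsto_diff[OF event_prob_tendsto[of 0 \<nu>]] by fastforce
  show "\<forall>\<^sub>F n in sequentially. ereal (?h n) \<le> worst \<rho> \<delta> n (G n)"
    using ev_n eventually_separated[OF sep]
  proof eventually_elim
    case (elim n)
    have "ereal (?h n) \<le> ereal (err n \<nu> \<delta> (G n))"
      using two_point_bound(1)[OF elim(1) G[OF elim(1)] elim(2)] by simp
    thus ?case using local_sup_ge[OF elim(1) \<nu>] by (rule order_trans)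
  qed
qed

text \<open>
  An estimator with small errors at both parameters would contradict the first two-point bound, as
  the selection probability stays away from zero.
\<close>

theorem uniform_error_bounded_below:
  assumes \<nu>: "\<bar>\<nu>\<bar> < \<rho>" and sep: "2 * \<delta> < \<bar>H \<nu> - H 0\<bar>"
  shows "0 < liminf (\<lambda>n. INF g\<in>estimators n. worst \<rho> \<delta> n g)"
proof -
  have \<rho>: "\<bar>0::real\<bar> < \<rho>" using \<nu> by simp
  define K where "K = exp (\<nu>\<^sup>2 * Q $$ (s, s) / \<sigma>\<^sup>2) + 1"
  have K: "1 < K" by (simp add: K_def)
  \<comment> \<open>If both errors are below \<open>\<eta>\<close>, each of the two terms of the bound is at most \<open>half_prob / 2\<close>.\<close>
  define \<eta> where "\<eta> = min (half_prob / 2) (half_prob\<^sup>2 / (4 * K))"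
  have \<eta>: "0 < \<eta>" using half_prob_pos K by (simp add: \<eta>_def)
  have "(\<lambda>n. exp (signal_dist n \<nu> 0)) \<longlonglongrightarrow> exp ((\<nu> - 0)\<^sup>2 * Q $$ (s, s) / \<sigma>\<^sup>2)"
    by (intro tendsto_intros signal_dist_tendsto)
  hence evK: "\<forall>\<^sub>F n in sequentially. exp (signal_dist n \<nu> 0) < K"
    by (rule order_tendstoD(2)) (simp add: K_def)
  have evp: "\<forall>\<^sub>F n in sequentially. half_prob < event_prob 0 n \<nu>"
    by (rule order_tendstoD(1)[OF event_prob_tendsto]) (use two_half_prob_le[of \<nu>] half_prob_pos in auto)
  have "ereal \<eta> \<le> liminf (\<lambda>n. INF g\<in>estimators n. worst \<rho> \<delta> n g)"
  proof (rule liminf_ge_of_eventually_ge[OF _ tendsto_const order_refl])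
    show "\<forall>\<^sub>F n in sequentially. ereal \<eta> \<le> (INF g\<in>estimators n. worst \<rho> \<delta> n g)"
      using ev_n eventually_separated[OF sep] evK evp
    proof eventually_elim
      case (elim n)
      show ?case
      proof (rule INF_greatest, rule ccontr)
        fix g assume g: "g \<in> estimators n"
        assume "\<not> ereal \<eta> \<le> worst \<rho> \<delta> n g"
        hence small: "worst \<rho> \<delta> n g < ereal \<eta>" by simp
        have e: "err n \<nu> \<delta> g < \<eta>" "err n 0 \<delta> g < \<eta>"
          using le_less_trans[OF local_sup_ge[OF elim(1) \<nu>] small] le_less_trans[OF local_sup_ge[OF elim(1) \<rho>] small]
          by simp_all
        have "exp (signal_dist n \<nu> 0) * err n 0 \<delta> g \<le> K * (half_prob\<^sup>2 / (4 * K))"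
          using e(2) elim(3) err_nonneg[of n 0 \<delta> g] K by (intro mult_mono) (auto simp: \<eta>_def)
        also have "\<dots> = (half_prob / 2)\<^sup>2" using K by (simp add: power_divide)
        finally have "sqrt (exp (signal_dist n \<nu> 0) * err n 0 \<delta> g) \<le> half_prob / 2"
          using half_prob_pos by (intro real_le_lsqrt) auto
        moreover have "err n \<nu> \<delta> g \<le> half_prob / 2" using e(1) by (simp add: \<eta>_def)
        ultimately show False
          using two_point_bound(1)[OF elim(1) g elim(2)] elim(4) by simp
      qed
    qed
  qed
  moreover have "0 < ereal \<eta>" using \<eta> by simp
  ultimately show ?thesis by (rule less_le_trans[rotated])
qed

lemma neighbours_separated:
  assumes H: "H \<nu> \<noteq> H 0" and N: "0 < N"
  shows "\<exists>j<N. H (real (Suc j) / real N * \<nu>) \<noteq> H (real j / real N * \<nu>)"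
proof (rule ccontr)
  assume *: "\<not> (\<exists>j<N. H (real (Suc j) / real N * \<nu>) \<noteq> H (real j / real N * \<nu>))"
  have "j \<le> N \<longrightarrow> H (real j / real N * \<nu>) = H 0" for j
  proof (induction j)
    case (Suc j)
    show ?case
    proof
      assume j: "Suc j \<le> N"
      hence "H (real (Suc j) / real N * \<nu>) = H (real j / real N * \<nu>)" using * by (meson Suc_le_lessD)
      also have "\<dots> = H 0" using Suc.IH j by simp
      finally show "H (real (Suc j) / real N * \<nu>) = H 0" .
    qed
  qed simp
  from this[of N] show False using H N by simp
qed

text \<open>
  The total-variation form of the two-point bound loses only the distance of the two laws. Refining a
  subdivision of the segment from \<open>0\<close> to \<open>\<nu>\<close> makes this distance as small as desired, while
  some step of the subdivision still separates the values of the limit. The tolerance \<open>\<delta>\<close> shrinks with the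
  step, which is why the supremum over all tolerances is taken.
\<close>

theorem uniform_error_near_half:
  assumes \<nu>: "\<bar>\<nu>\<bar> < \<rho>" and H: "H \<nu> \<noteq> H 0"
  shows "ereal half_prob \<le> (SUP \<delta>\<in>{0<..}. liminf (\<lambda>n. INF g\<in>estimators n.
      worst \<rho> \<delta> n g))"
proof (rule ereal_le_epsilon2)
  fix \<kappa> :: real assume \<kappa>: "0 < \<kappa>"
  have "(\<lambda>N. sqrt (exp ((\<nu> / real N)\<^sup>2 * Q $$ (s, s) / \<sigma>\<^sup>2) - 1)) \<longlonglongrightarrow> sqrt (exp (0\<^sup>2 * Q $$ (s, s) / \<sigma>\<^sup>2) - 1)"
    using \<sigma> by (intro tendsto_intros lim_const_over_n) auto
  hence "\<forall>\<^sub>F N in sequentially. sqrt (exp ((\<nu> / real N)\<^sup>2 * Q $$ (s, s) / \<sigma>\<^sup>2) - 1) < 2 * \<kappa>"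
    by (rule order_tendstoD(2)) (use \<kappa> in simp)
  hence "\<forall>\<^sub>F N in sequentially. 0 < N \<and> sqrt (exp ((\<nu> / real N)\<^sup>2 * Q $$ (s, s) / \<sigma>\<^sup>2) - 1) < 2 * \<kappa>"
    using eventually_gt_at_top[of 0] by eventually_elim simp
  then obtain N where N: "0 < N" "sqrt (exp ((\<nu> / real N)\<^sup>2 * Q $$ (s, s) / \<sigma>\<^sup>2) - 1) < 2 * \<kappa>"
    by (auto simp: eventually_sequentially)
  obtain j where j: "j < N" "H (real (Suc j) / real N * \<nu>) \<noteq> H (real j / real N * \<nu>)"
    using neighbours_separated[OF H N(1)] by blast
  define \<nu>1 where "\<nu>1 = real (Suc j) / real N * \<nu>"
  define \<nu>2 where "\<nu>2 = real j / real N * \<nu>"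
  have "\<bar>real i / real N * \<nu>\<bar> < \<rho>" if "i \<le> N" for i
  proof -
    have "real i / real N \<le> 1" using that N(1) by simp
    hence "real i / real N * \<bar>\<nu>\<bar> \<le> 1 * \<bar>\<nu>\<bar>" by (intro mult_right_mono) auto
    thus ?thesis using \<nu> by (simp add: abs_mult)
  qed
  hence \<nu>12: "\<bar>\<nu>1\<bar> < \<rho>" "\<bar>\<nu>2\<bar> < \<rho>" using j(1) unfolding \<nu>1_def \<nu>2_def by (simp_all del: of_nat_Suc)
  have d12: "\<nu>1 - \<nu>2 = \<nu> / real N" using N(1) by (simp add: \<nu>1_def \<nu>2_def field_simps)
  define \<delta> where "\<delta> = \<bar>H \<nu>1 - H \<nu>2\<bar> / 3"
  have H12: "0 < \<bar>H \<nu>1 - H \<nu>2\<bar>" using j(2) by (simp add: \<nu>1_def \<nu>2_def del: of_nat_Suc)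
  have \<delta>: "0 < \<delta>" "2 * \<delta> < \<bar>H \<nu>1 - H \<nu>2\<bar>" using H12 by (simp_all add: \<delta>_def)
  let ?h = "\<lambda>n. (event_prob 0 n \<nu>1 - sqrt (exp (signal_dist n \<nu>1 \<nu>2) - 1)) / 2"
  have "ereal (half_prob - \<kappa>) \<le> liminf (\<lambda>n. INF g\<in>estimators n.
      worst \<rho> \<delta> n g)"
  proof (rule liminf_ge_of_eventually_ge)
    show "?h \<longlonglongrightarrow> (limit_prob 0 \<nu>1 * later_insignificant - sqrt (exp ((\<nu>1 - \<nu>2)\<^sup>2 * Q $$ (s, s) / \<sigma>\<^sup>2) - 1)) / 2"
      by (intro tendsto_intros event_prob_tendsto signal_dist_tendsto) auto
    show "half_prob - \<kappa> \<le> (limit_prob 0 \<nu>1 * later_insignificant - sqrt (exp ((\<nu>1 - \<nu>2)\<^sup>2 * Q $$ (s, s) / \<sigma>\<^sup>2) - 1)) / 2"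
      using two_half_prob_le[of \<nu>1] N(2) unfolding d12 by simp
    show "\<forall>\<^sub>F n in sequentially. ereal (?h n) \<le> (INF g\<in>estimators n.
      worst \<rho> \<delta> n g)"
      using ev_n eventually_separated[OF \<delta>(2)]
    proof eventually_elim
      case (elim n)
      show ?case
      proof (rule INF_greatest)
        fix g assume g: "g \<in> estimators n"
        have "?h n \<le> max (err n \<nu>1 \<delta> g) (err n \<nu>2 \<delta> g)"
          using two_point_bound(2)[OF elim(1) g elim(2)] by simp
        hence "ereal (?h n) \<le> max (ereal (err n \<nu>1 \<delta> g)) (ereal (err n \<nu>2 \<delta> g))"
          by (simp add: max_def split: if_splits)
        also have "\<dots> \<le> worst \<rho> \<delta> n g"
          using local_sup_ge[OF elim(1) \<nu>12(1)] local_sup_ge[OF elim(1) \<nu>12(2)] by (rule max.boundedI)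
        finally show "ereal (?h n) \<le> worst \<rho> \<delta> n g" .
      qed
    qed
  qed
  also have "\<dots> \<le> (SUP \<delta>\<in>{0<..}. liminf (\<lambda>n. INF g\<in>estimators n.
      worst \<rho> \<delta> n g))"
    using \<delta>(1) by (intro SUP_upper) simp
  finally have "ereal (half_prob - \<kappa>) + ereal \<kappa> \<le> (SUP \<delta>\<in>{0<..}. liminf (\<lambda>n. INF g\<in>estimators n.
      worst \<rho> \<delta> n g)) + ereal \<kappa>"
    by (rule add_right_mono)
  thus "ereal half_prob \<le> (SUP \<delta>\<in>{0<..}. liminf (\<lambda>n. INF g\<in>estimators n.
      worst \<rho> \<delta> n g)) + ereal \<kappa>" by simp
qed

end

text \<open>
  The index is determined by \<open>A\<close> and \<open>Q\<close>: a larger minimal order only removes small orders from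
  the competition, as long as some correlated order remains. So the constants can be chosen before the
  minimal order is known.
\<close>

lemma last_correlated_unique:
  assumes "last_correlated P k s A Q \<sigma>" "last_correlated P k s' A Q \<sigma>"
  shows "s = s'"
proof -
  interpret L: last_correlated P k s A Q \<sigma> by fact
  interpret L': last_correlated P k s' A Q \<sigma> by fact
  have "\<not> s < s'" using L.uncorr[of "Suc s'"] L'.corr L'.sP by auto
  moreover have "\<not> s' < s" using L'.uncorr[of "Suc s"] L.corr L.sP by auto
  ultimately show ?thesis by simp
qed

lemma local_asymptoticsI:
  assumes A: "A \<in> carrier_mat k P" "vec_space.rank k A = k"
    and Q: "Q \<in> carrier_mat P P" "invertible_mat Q" and t: "t \<in> carrier_vec k" and \<sigma>: "0 < \<sigma>"
    and X: "\<forall>n > P. X n \<in> carrier_mat n P \<and> vec_space.rank n (X n) = P"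
    and gram: "\<forall>i < P. \<forall>j < P. (\<lambda>n. gram (X n) $$ (i, j) / real n) \<longlonglongrightarrow> Q $$ (i, j)"
    and c: "c m = 0" "\<forall>p. m < p \<and> p \<le> P \<longrightarrow> 0 < c p"
    and ex: "\<exists>q. m < q \<and> q \<le> P \<and> C_inf A Q q \<noteq> 0\<^sub>v k"
    and qs: "qs = Max {q. m < q \<and> q \<le> P \<and> C_inf A Q q \<noteq> 0\<^sub>v k}"
    and \<theta>: "\<theta> \<in> submodel P (qs - 1)"
  shows "\<exists>s. qs = Suc s \<and> local_asymptotics P k s A Q \<sigma> X m c \<theta> t"
proof -
  let ?S = "{q. m < q \<and> q \<le> P \<and> C_inf A Q q \<noteq> 0\<^sub>v k}"
  have S: "finite ?S" "?S \<noteq> {}" using ex by (auto intro: finite_subset[of _ "{..P}"])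
  have q1: "m < qs" "qs \<le> P" "C_inf A Q qs \<noteq> 0\<^sub>v k" using Max_in[OF S] by (auto simp: qs)
  have q2: "q \<le> qs" if "q \<in> ?S" for q using Max_ge[OF S(1) that] by (simp add: qs)
  obtain s where s: "qs = Suc s" using q1(1) by (cases qs) auto
  have reg: "regression (X n) n P" if "P < n" for n
    using X that q1 by unfold_locales auto
  have Qpd: "pos_def P Q"
  proof (rule invertible_limit_pos_def[OF Q])
    fix i j assume ij: "i < P" "j < P"
    have ev: "\<forall>\<^sub>F n in sequentially. gram (X n) $$ (i, j) / real n = moment_mat (X n) $$ (i, j)"
      using eventually_gt_at_top[of P]
    proof eventually_elim
      case (elim n)
      have d: "dim_row (X n) = n" "dim_col (X n) = P" using X elim by auto
      show ?case by (rule moment_mat_gram[of i "X n" j, unfolded d, OF ij, symmetric])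
    qed
    have "(\<lambda>n. gram (X n) $$ (i, j) / real n) \<longlonglongrightarrow> Q $$ (i, j)" using gram ij by blast
    thus "(\<lambda>n. moment_mat (X n) $$ (i, j)) \<longlonglongrightarrow> Q $$ (i, j)"
      using ev by (rule Lim_transform_eventually)
  next
    show "\<forall>\<^sub>F n in sequentially. pos_def P (moment_mat (X n))"
      using eventually_gt_at_top[of P] by eventually_elim (rule regression.moment_pos_def[OF reg])
  qed
  have "last_correlated P k s A Q \<sigma>"
  proof (rule last_correlated.intro[OF A Qpd _ \<sigma>])
    show "s < P" using q1(2) s by simp
    show "C_inf A Q (Suc s) \<noteq> 0\<^sub>v k" using q1(3) unfolding s .
    show "C_inf A Q q = 0\<^sub>v k" if "Suc s < q" "q \<le> P" for q
    proof (rule ccontr)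
      assume "C_inf A Q q \<noteq> 0\<^sub>v k"
      moreover have "m < q" using that q1(1) s by linarith
      ultimately have "q \<le> qs" using q2[of q] that by blast
      thus False using that s by simp
    qed
  qed
  moreover have "local_asymptotics_axioms P k s Q X m c \<theta> t"
  proof (rule local_asymptotics_axioms.intro)
    show "c m = 0" by (rule c(1))
    show "t \<in> carrier_vec k" by (rule t)
    show "X n \<in> carrier_mat n P \<and> vec_space.rank n (X n) = P" if "P < n" for n using X that by blast
    show "(\<lambda>n. gram (X n) $$ (i, j) / real n) \<longlonglongrightarrow> Q $$ (i, j)" if "i < P" "j < P" for i j
      using gram that by blast
    show "m \<le> Suc s" using q1(1) s by simp
    show "0 < c p" if "Suc s \<le> p" "p \<le> P" for p using c(2) that q1(1) s by simp
    show "\<theta> \<in> submodel P s" using \<theta> s by simp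
  qed
  ultimately have "local_asymptotics P k s A Q \<sigma> X m c \<theta> t" by (rule local_asymptotics.intro)
  thus ?thesis using s by blast
qed

text \<open>
  If some admissible design and critical values exist, then they determine the limit \<open>H\<close> up to the given data, and
  the constants are chosen from a point where \<open>H\<close> differs from its value at zero. Otherwise the
  claim is empty.
\<close>

theorem theorem2p3:
  fixes P k :: nat and A Q :: "real mat" and t :: "real Matrix.vec" and \<sigma> c_star :: real
  assumes "1 \<le> k" "k \<le> P"
    and "A \<in> carrier_mat k P" "vec_space.rank k A = k"
    and "Q \<in> carrier_mat P P" "invertible_mat Q"
    and "t \<in> carrier_vec k"
    and "0 < \<sigma>"
  shows "\<exists>\<delta>\<^sub>0 > 0. \<exists>\<rho>\<^sub>0 > 0.
    \<forall>(X :: nat \<Rightarrow> real mat) (m :: nat) (c :: nat \<Rightarrow> real) (qs :: nat) (\<theta> :: real Matrix.vec).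
      (\<forall>n > P. X n \<in> carrier_mat n P \<and> vec_space.rank n (X n) = P) \<longrightarrow>
      (\<forall>i < P. \<forall>j < P. (\<lambda>n. gram (X n) $$ (i, j) / real n) \<longlonglongrightarrow> Q $$ (i, j)) \<longrightarrow>
      m < P \<longrightarrow> c m = 0 \<longrightarrow> (\<forall>p. m < p \<and> p \<le> P \<longrightarrow> 0 < c p) \<longrightarrow>
      (\<exists>q. m < q \<and> q \<le> P \<and> C_inf A Q q \<noteq> 0\<^sub>v k) \<longrightarrow>
      qs = Max {q. m < q \<and> q \<le> P \<and> C_inf A Q q \<noteq> 0\<^sub>v k} \<longrightarrow>
      c qs = c_star \<longrightarrow>
      \<theta> \<in> submodel P (qs - 1) \<longrightarrow>
      (let \<pi> = (1 - std_normal_cdf (c qs)) * (\<Prod>q = qs + 1..P. 2 * std_normal_cdf (c q) - 1) in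
        (\<forall>G :: nat \<Rightarrow> real Matrix.vec \<Rightarrow> real.
           (\<forall>n > P. G n \<in> estimators n) \<longrightarrow>
           (\<forall>\<delta> > 0. (\<lambda>n. error_prob m c A (X n) \<theta> \<sigma> t \<delta> (G n)) \<longlonglongrightarrow> 0) \<longrightarrow>
           liminf (\<lambda>n. local_sup_error m c A (X n) \<theta> \<sigma> t qs \<rho>\<^sub>0 \<delta>\<^sub>0 (G n)) \<ge> ereal (2 * \<pi>)) \<and>
        2 * \<pi> > 0 \<and>
        liminf (\<lambda>n. INF g \<in> estimators n.
                  local_sup_error m c A (X n) \<theta> \<sigma> t qs \<rho>\<^sub>0 \<delta>\<^sub>0 g) > 0 \<and>
        (SUP \<delta> \<in> {0<..}. liminf (\<lambda>n. INF g \<in> estimators n.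
                  local_sup_error m c A (X n) \<theta> \<sigma> t qs \<rho>\<^sub>0 \<delta> g)) \<ge> ereal \<pi> \<and>
        \<pi> > 0 \<and>
        (\<lambda>n. \<P>(y in sample_law (X n) \<theta> \<sigma>. sel_order m c (X n) y = qs)) \<longlonglongrightarrow> 2 * \<pi>)"
proof (cases "0 < c_star \<and> (\<exists>s. last_correlated P k s A Q \<sigma>)")
  case False
  show ?thesis
  proof (intro exI[of _ 1] conjI allI impI, goal_cases)
    case (3 X m c qs \<theta>)
    obtain s where s: "qs = Suc s" "local_asymptotics P k s A Q \<sigma> X m c \<theta> t"
      using local_asymptoticsI[OF assms(3-8) 3(1,2,4-7,9)] by blast
    interpret local_asymptotics P k s A Q \<sigma> X m c \<theta> t by (rule s(2))
    have "0 < c_star" using c[of "Suc s"] sP s(1) 3(8) by simp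
    hence False using False last_correlated_axioms by blast
    thus ?case ..
  qed simp_all
next
  case True
  then obtain s where L: "last_correlated P k s A Q \<sigma>" and cs: "0 < c_star" by blast
  interpret L: last_correlated P k s A Q \<sigma> by (rule L)
  obtain \<nu> where \<nu>: "L.limit_cdf t c_star \<nu> \<noteq> L.limit_cdf t c_star 0"
    using L.limit_cdf_not_constant[OF cs] by blast
  \<comment> \<open>Any tolerance below half of the gap would do.\<close>
  define \<delta>\<^sub>0 where "\<delta>\<^sub>0 = \<bar>L.limit_cdf t c_star \<nu> - L.limit_cdf t c_star 0\<bar> / 3"
  define \<rho>\<^sub>0 where "\<rho>\<^sub>0 = \<bar>\<nu>\<bar> + 1"
  have \<delta>\<^sub>0: "0 < \<delta>\<^sub>0" "2 * \<delta>\<^sub>0 < \<bar>L.limit_cdf t c_star \<nu> - L.limit_cdf t c_star 0\<bar>"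
    using \<nu> by (simp_all add: \<delta>\<^sub>0_def)
  have \<rho>\<^sub>0: "0 < \<rho>\<^sub>0" "\<bar>\<nu>\<bar> < \<rho>\<^sub>0" by (simp_all add: \<rho>\<^sub>0_def)
  show ?thesis
  proof (rule exI[of _ \<delta>\<^sub>0], rule conjI[OF \<delta>\<^sub>0(1)], rule exI[of _ \<rho>\<^sub>0], rule conjI[OF \<rho>\<^sub>0(1)],
      intro allI impI, goal_cases)
    case (1 X m c qs \<theta>)
    obtain s' where s': "qs = Suc s'" "local_asymptotics P k s' A Q \<sigma> X m c \<theta> t"
      using local_asymptoticsI[OF assms(3-8) 1(1,2,4-7,9)] by blast
    have "last_correlated P k s' A Q \<sigma>" using s'(2) by (rule local_asymptotics.axioms(1))
    hence ss: "s' = s" using last_correlated_unique[OF L] by simp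
    interpret local_asymptotics P k s A Q \<sigma> X m c \<theta> t using s'(2) unfolding ss .
    have cS: "c (Suc s) = c_star" and qs: "qs = Suc s" using 1(8) s'(1) ss by simp_all
    have \<pi>: "(1 - std_normal_cdf (c qs)) * (\<Prod>q = qs + 1..P. 2 * std_normal_cdf (c q) - 1) = half_prob"
      by (simp add: half_prob_def later_insignificant_def qs)
    have sep: "2 * \<delta>\<^sub>0 < \<bar>H \<nu> - H 0\<bar>" and neq: "H \<nu> \<noteq> H 0" using \<delta>\<^sub>0(2) \<nu> unfolding cS by simp_all
    show ?case
      unfolding Let_def \<pi>
    proof (intro conjI allI impI)
      fix G :: "nat \<Rightarrow> real Matrix.vec \<Rightarrow> real"
      assume G: "\<forall>n > P. G n \<in> estimators n"
        "\<forall>\<delta> > 0. (\<lambda>n. error_prob m c A (X n) \<theta> \<sigma> t \<delta> (G n)) \<longlonglongrightarrow> 0"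
      show "ereal (2 * half_prob) \<le> liminf (\<lambda>n. local_sup_error m c A (X n) \<theta> \<sigma> t qs \<rho>\<^sub>0 \<delta>\<^sub>0 (G n))"
        unfolding qs by (rule consistent_estimator_fails[OF \<rho>\<^sub>0(2) sep]) (use G \<delta>\<^sub>0(1) in auto)
    next
      show "0 < liminf (\<lambda>n. INF g\<in>estimators n. local_sup_error m c A (X n) \<theta> \<sigma> t qs \<rho>\<^sub>0 \<delta>\<^sub>0 g)"
        unfolding qs by (rule uniform_error_bounded_below[OF \<rho>\<^sub>0(2) sep])
      show "ereal half_prob \<le> (SUP \<delta>\<in>{0<..}. liminf (\<lambda>n. INF g\<in>estimators n.
          local_sup_error m c A (X n) \<theta> \<sigma> t qs \<rho>\<^sub>0 \<delta> g))"
        unfolding qs by (rule uniform_error_near_half[OF \<rho>\<^sub>0(2) neq])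
      show "(\<lambda>n. \<P>(y in sample_law (X n) \<theta> \<sigma>. sel_order m c (X n) y = qs)) \<longlonglongrightarrow> 2 * half_prob"
        unfolding qs by (rule selection_prob_tendsto)
    qed (use half_prob_pos in simp_all)
  qed
qed

end
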